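(* Let $M$ be an integral $P_l(\mathcal{O}_K)$-module and let $S$ be a standard submodule of finite index in $M$. Let $r_i$ be the rank of $Q_i(S)$ as a free $\mathcal{O}_K$-module for $1 \leq i \leq l$. (a) For $1 \le i \le l$ the map $$K_i(S)/L_i(S) \to K_i(M)/L_i(M) : a + L_i(S) \mapsto a + L_i(M)$$ induces an embedding of $Q_i(S)$ into $Q_i(M)$, with image denoted $\overline{Q}_i(S)$. (b) If $[Q_i(M):\overline{Q}_i(S)] = h_i$ for $1 \leq i \leq l$, then $[M:S] = h_1 h_2^2 \cdots h_l^l$. (c) With $h_i = [Q_i(M):\overline{Q}_i(S)]$ for $1 \le i \le l$, there are exactly $$\prod_{i=1}^l \frac{(h_i \cdots h_l)^{(r_i + \cdots + r_l)}}{h_i^{r_i}}$$ standard submodules $T$ in $M$ with $\overline{Q}_i(T) = \overline{Q}_i(S)$ for $1 \leq i \leq l$.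
   Context: Let $K$ be an algebraic number field with maximal order $\mathcal{O}_K$, let $l \in \mathbb{N}$ be positive, and let $P_l(\mathcal{O}_K) = \mathcal{O}_K[y]/(y^l)$. Modules are written with the action on the right. A $P_l(\mathcal{O}_K)$-module $M$ is integral if $M \cong \mathbb{Z}^n$ as abelian group for some $n \in \mathbb{N}$. For a $P_l(\mathcal{O}_K)$-module $M$ define $K_i(M) = \{ m \in M \mid m y^i = 0\}$ for $0 \leq i \leq l+1$, $L_i(M) = K_{i+1}(M)y + K_{i-1}(M)$ for $1 \leq i \leq l$, and $Q_i(M) = K_i(M)/L_i(M)$ for $1 \leq i \leq l$. The module $M$ is standard if it is integral and $Q_i(M)$ is free as $\mathcal{O}_K$-module for $1 \leq i \leq l$. A standard submodule of $M$ is a $P_l(\mathcal{O}_K)$-submodule that is standard as a $P_l(\mathcal{O}_K)$-module. For a standard submodule $T$ of $M$, $\overline{Q}_i(T)$ denotes the image of $Q_i(T)$ in $Q_i(M)$ under $a + L_i(T) \mapsto a + L_i(M)$. *)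

theory Defs
  imports "HOL-Computational_Algebra.Polynomial" "HOL-Algebra.Algebraic_Closure_Type"
    "HOL-Algebra.Algebra"
begin

section \<open>Number fields and their maximal orders\<close>

text \<open>A number field is given by a type of characteristic 0 fields that is
  finite-dimensional over the rationals.\<close>

definition number_field :: "'k::field_char_0 itself \<Rightarrow> bool" where
  "number_field _ \<longleftrightarrow>
     (\<exists>B. finite_dimensional_vector_space (\<lambda>(q::rat) (x::'k). of_rat q * x) B)"

definition maximal_order :: "'k::field_char_0 ring"  (\<open>\<O>\<close>) where
  "maximal_order = ring_of_type_algebra\<lparr>carrier := {x. algebraic_int x}\<rparr>"


section \<open>The ring $R[y]/(y^l)$\<close>

definition trunc_ideal :: "('a, 'm) ring_scheme \<Rightarrow> nat \<Rightarrow> (nat \<Rightarrow> 'a) set" where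
  "trunc_ideal R l = PIdl\<^bsub>UP R\<^esub> (up_ring.monom (UP R) \<one>\<^bsub>R\<^esub> 1 [^]\<^bsub>UP R\<^esub> l)"

definition trunc_poly_ring :: "('a, 'm) ring_scheme \<Rightarrow> nat \<Rightarrow> (nat \<Rightarrow> 'a) set ring" where
  "trunc_poly_ring R l = UP R Quot trunc_ideal R l"

definition trunc_const :: "('a, 'm) ring_scheme \<Rightarrow> nat \<Rightarrow> 'a \<Rightarrow> (nat \<Rightarrow> 'a) set" where
  "trunc_const R l c = trunc_ideal R l +>\<^bsub>UP R\<^esub> up_ring.monom (UP R) c 0"

definition trunc_var :: "('a, 'm) ring_scheme \<Rightarrow> nat \<Rightarrow> (nat \<Rightarrow> 'a) set" where
  "trunc_var R l = trunc_ideal R l +>\<^bsub>UP R\<^esub> up_ring.monom (UP R) \<one>\<^bsub>R\<^esub> 1"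


section \<open>General module theory\<close>

text \<open>The record type of modules extends that of rings; its fields \<open>monoid.mult\<close> and \<open>one\<close>
  play no role for modules and are left unspecified below.\<close>

definition restrict_scalars ::
    "('r \<Rightarrow> 's) \<Rightarrow> ('s, 'b, 'm) module_scheme \<Rightarrow> ('r, 'b) module" where
  "restrict_scalars \<phi> M =
     \<lparr>carrier = carrier M, monoid.mult = undefined, one = undefined,
      ring.zero = \<zero>\<^bsub>M\<^esub>, add = add M, module.smult = (\<lambda>r x. \<phi> r \<odot>\<^bsub>M\<^esub> x)\<rparr>"

definition quotient_module ::
    "('r, 'b, 'm) module_scheme \<Rightarrow> 'b set \<Rightarrow> ('r, 'b set) module" where
  "quotient_module M N =
     \<lparr>carrier = a_rcosets\<^bsub>M\<^esub> N, monoid.mult = undefined, one = undefined,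
      ring.zero = N, add = set_add M, module.smult = (\<lambda>r C. \<Union>x\<in>C. N +>\<^bsub>M\<^esub> (r \<odot>\<^bsub>M\<^esub> x))\<rparr>"

definition mod_hom ::
    "('r, 'k) ring_scheme \<Rightarrow> ('r, 'a, 'm) module_scheme \<Rightarrow> ('r, 'b, 'n) module_scheme
      \<Rightarrow> ('a \<Rightarrow> 'b) set" where
  "mod_hom R M N =
     {f \<in> hom (add_monoid M) (add_monoid N).
        \<forall>r\<in>carrier R. \<forall>x\<in>carrier M. f (r \<odot>\<^bsub>M\<^esub> x) = r \<odot>\<^bsub>N\<^esub> f x}"

definition module_basis ::
    "('r, 'k) ring_scheme \<Rightarrow> ('r, 'b, 'm) module_scheme \<Rightarrow> 'b set \<Rightarrow> bool" where
  "module_basis R M B \<longleftrightarrow>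
     B \<subseteq> carrier M \<and>
     (\<forall>x\<in>carrier M. \<exists>A c. finite A \<and> A \<subseteq> B \<and> c \<in> A \<rightarrow> carrier R \<and>
        x = (\<Oplus>\<^bsub>M\<^esub>b\<in>A. c b \<odot>\<^bsub>M\<^esub> b)) \<and>
     (\<forall>A c. finite A \<and> A \<subseteq> B \<and> c \<in> A \<rightarrow> carrier R \<and>
        (\<Oplus>\<^bsub>M\<^esub>b\<in>A. c b \<odot>\<^bsub>M\<^esub> b) = \<zero>\<^bsub>M\<^esub> \<longrightarrow> (\<forall>b\<in>A. c b = \<zero>\<^bsub>R\<^esub>))"

definition free_module ::
    "('r, 'k) ring_scheme \<Rightarrow> ('r, 'b, 'm) module_scheme \<Rightarrow> bool" where
  "free_module R M \<longleftrightarrow> module R M \<and> (\<exists>B. module_basis R M B)"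

definition free_of_rank ::
    "('r, 'k) ring_scheme \<Rightarrow> ('r, 'b, 'm) module_scheme \<Rightarrow> nat \<Rightarrow> bool" where
  "free_of_rank R M r \<longleftrightarrow>
     module R M \<and> (\<exists>B. module_basis R M B \<and> finite B \<and> card B = r)"

text \<open>The index $[M : N]$; as for \<^const>\<open>card\<close>, the value is 0 if it is infinite.\<close>

definition add_index :: "('b, 'm) ring_scheme \<Rightarrow> 'b set \<Rightarrow> nat" where
  "add_index M N = card (a_rcosets\<^bsub>M\<^esub> N)"

definition integral_module :: "('b, 'm) ring_scheme \<Rightarrow> bool" where
  "integral_module M \<longleftrightarrow>
     (\<exists>n. add_monoid M \<cong> product_group {..<n::nat} (\<lambda>_. integer_group))"


section \<open>Modules over $R[y]/(y^l)$\<close>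

text \<open>The ring $R[y]/(y^l)$ is commutative, so the right action of the ring is
  written as the left action \<open>\<odot>\<close> of the library.\<close>

definition K_sub ::
    "('a, 'k) ring_scheme \<Rightarrow> nat \<Rightarrow> ((nat \<Rightarrow> 'a) set, 'b, 'm) module_scheme
      \<Rightarrow> nat \<Rightarrow> 'b set" where
  "K_sub R l M i =
     {m \<in> carrier M. (trunc_var R l [^]\<^bsub>trunc_poly_ring R l\<^esub> i) \<odot>\<^bsub>M\<^esub> m = \<zero>\<^bsub>M\<^esub>}"

definition L_sub ::
    "('a, 'k) ring_scheme \<Rightarrow> nat \<Rightarrow> ((nat \<Rightarrow> 'a) set, 'b, 'm) module_scheme
      \<Rightarrow> nat \<Rightarrow> 'b set" where
  "L_sub R l M i =
     ((\<lambda>m. trunc_var R l \<odot>\<^bsub>M\<^esub> m) ` K_sub R l M (i + 1)) <+>\<^bsub>M\<^esub> K_sub R l M (i - 1)"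

definition Q_mod ::
    "('a, 'k) ring_scheme \<Rightarrow> nat \<Rightarrow> ((nat \<Rightarrow> 'a) set, 'b, 'm) module_scheme
      \<Rightarrow> nat \<Rightarrow> ('a, 'b set) module" where
  "Q_mod R l M i =
     quotient_module
       (restrict_scalars (trunc_const R l) (M\<lparr>carrier := K_sub R l M i\<rparr>))
       (L_sub R l M i)"

definition standard_module ::
    "('a, 'k) ring_scheme \<Rightarrow> nat \<Rightarrow> ((nat \<Rightarrow> 'a) set, 'b, 'm) module_scheme \<Rightarrow> bool" where
  "standard_module R l M \<longleftrightarrow>
     module (trunc_poly_ring R l) M \<and> integral_module M \<and>
     (\<forall>i\<in>{1..l}. free_module R (Q_mod R l M i))"

definition standard_submodule ::
    "('a, 'k) ring_scheme \<Rightarrow> nat \<Rightarrow> ((nat \<Rightarrow> 'a) set, 'b, 'm) module_scheme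
      \<Rightarrow> 'b set \<Rightarrow> bool" where
  "standard_submodule R l M T \<longleftrightarrow>
     submodule T (trunc_poly_ring R l) M \<and> standard_module R l (M\<lparr>carrier := T\<rparr>)"

text \<open>The map $a + L_i(T) \mapsto a + L_i(M)$. For a submodule \<open>T\<close> of \<open>M\<close>, all elements \<open>a\<close>
  of one coset of $L_i(T)$ yield the same coset of $L_i(M)$, which \<^const>\<open>the_elem\<close> selects.\<close>

definition Q_map ::
    "('a, 'k) ring_scheme \<Rightarrow> nat \<Rightarrow> ((nat \<Rightarrow> 'a) set, 'b, 'm) module_scheme
      \<Rightarrow> 'b set \<Rightarrow> nat \<Rightarrow> 'b set \<Rightarrow> 'b set" where
  "Q_map R l M T i =
     (\<lambda>C\<in>carrier (Q_mod R l (M\<lparr>carrier := T\<rparr>) i).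
        the_elem ((\<lambda>a. L_sub R l M i +>\<^bsub>M\<^esub> a) ` C))"

definition Q_bar ::
    "('a, 'k) ring_scheme \<Rightarrow> nat \<Rightarrow> ((nat \<Rightarrow> 'a) set, 'b, 'm) module_scheme
      \<Rightarrow> 'b set \<Rightarrow> nat \<Rightarrow> 'b set set" where
  "Q_bar R l M T i = Q_map R l M T i ` carrier (Q_mod R l (M\<lparr>carrier := T\<rparr>) i)"

end

theory Submission
  imports Defs
begin

text \<open>
  Let \<open>R\<close> be the ring of scalars. A module over $R[y]/(y^l)$ is an $R$-module \<open>M\<close> with an
  endomorphism \<open>y\<close> such that $y^l = 0$; write $K_i = \ker y^i$ and $L_i = yK_{i+1} + K_{i-1}$. The proof
  rests on comparing $L_i(T)$ with $T \cap L_i(M)$ for submodules \<open>T\<close>. A submodule is called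
  saturated if the two agree for all $i$, that is, if $Q_i(T) \to Q_i(M)$ is injective.

  (a) Since \<open>S\<close> has finite index, $dM \subseteq S$ for some positive integer $d$. If
  $x \in S \cap L_i(M)$, then $dx \in L_i(S)$, and $Q_i(S)$ is torsion-free, being free over a domain of
  characteristic 0. So $x \in L_i(S)$, and \<open>S\<close> is saturated (\<open>saturatedI_torsion\<close>).

  (b) Let $k_i = [K_i(M) : K_i(S)]$ and $e_i = [L_i(M) : L_i(S)]$. Indices are multiplicative along
  homomorphisms (\<open>coset_index_hom\<close>). Applied to $K_i(M) \to Q_i(M)$ this gives $k_i = h_i e_i$; applied to
  $y^i$ on $K_{i+1}$ and $y^{i-1}$ on $L_i$, which have the same image, it gives
  $e_i k_i = k_{i+1} k_{i-1}$ (\<open>saturated_indices\<close>). So $a_i = k_i / k_{i-1}$ satisfies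
  $a_i = h_i a_{i+1}$ with $a_{l+1} = 1$. Hence $a_i = h_i \cdots h_l$, and $[M : S] = k_l = a_1 \cdots a_l$.

  (c) The submodules \<open>T\<close> to be counted are the saturated ones with $\overline{Q}_i(T) = \overline{Q}_i(S)$. Fix
  lifts $b_{ij} \in K_i(S)$ of bases of the $Q_i(S)$. Given $t_{ij} \in b_{ij} + L_i(M)$, the submodule
  generated by the $t_{ij}$ is one of these \<open>T\<close> (\<open>generated_saturated\<close>), and it is the only one that
  contains all $t_{ij}$ (\<open>saturated_minimal\<close>). On the other hand
  $T \cap (b_{ij} + L_i(M))$ is a coset of $L_i(T)$, whose index in $L_i(M)$ is $e_i$, the same for all \<open>T\<close> by
  (b). So each \<open>T\<close> accounts for the fraction $\prod_i e_i^{-r_i}$ of all choices of the $t_{ij}$, and there are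
  $\prod_i e_i^{r_i}$ submodules (\<open>card_saturated_same_layers\<close>). Finally
  $e_i = k_i / h_i = a_1 \cdots a_i / h_i$.
\<close>

section \<open>Subgroups of finitely generated free abelian groups\<close>

abbreviation int_power_group :: "nat \<Rightarrow> (nat \<Rightarrow> int) monoid" where
  "int_power_group n \<equiv> product_group {..<n} (\<lambda>_. integer_group)"

lemma (in comm_group) comm_group_subgroup:
  assumes "subgroup H G" shows "comm_group (G\<lparr>carrier := H\<rparr>)"
proof (rule group.group_comm_groupI)
  show "group (G\<lparr>carrier := H\<rparr>)" using assms is_group by (rule subgroup.subgroup_is_group)
qed (use subgroup.subset[OF assms] in \<open>auto intro: m_comm\<close>)

lemma int_power_group_pow:
  assumes "w \<in> carrier (int_power_group n)" "i < n"
  shows "(w [^]\<^bsub>int_power_group n\<^esub> (d::nat)) i = int d * w i"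
  using assms(2) by (induction d) (auto simp: algebra_simps nat_pow_def)

text \<open>The generator of the image is the least positive value of \<open>f\<close>: division with remainder by it
  yields values of \<open>f\<close> that are non-negative and smaller.\<close>
lemma hom_to_integer_group_cyclic_image:
  assumes G: "group G" and f: "f \<in> hom G integer_group" and "\<exists>x\<in>carrier G. f x \<noteq> 0"
  obtains t where "t \<in> carrier G" "f t > 0" "\<And>x. x \<in> carrier G \<Longrightarrow> f t dvd f x"
proof -
  interpret f: group_hom G integer_group f
    using G f by (simp add: group_hom_def group_hom_axioms_def)
  have f_inv: "f (inv\<^bsub>G\<^esub> x) = - f x" if "x \<in> carrier G" for x
    using f.hom_inv[OF that] by simp
  define good where "good n \<longleftrightarrow> (\<exists>x\<in>carrier G. f x = int n \<and> n > 0)" for n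
  obtain x where x: "x \<in> carrier G" "f x \<noteq> 0" using assms(3) by blast
  have "good (nat \<bar>f x\<bar>)"
  proof (cases "f x > 0")
    case True
    then show ?thesis unfolding good_def using x by (intro bexI[of _ x]) auto
  next
    case False
    then show ?thesis
      unfolding good_def using x f_inv[OF x(1)] by (intro bexI[of _ "inv\<^bsub>G\<^esub> x"]) auto
  qed
  then have "good (LEAST n. good n)" by (rule LeastI)
  then obtain t where t: "t \<in> carrier G" "f t = int (LEAST n. good n)" "f t > 0"
    by (auto simp: good_def)
  have "f t dvd f z" if z: "z \<in> carrier G" for z
  proof -
    let ?u = "z \<otimes>\<^bsub>G\<^esub> inv\<^bsub>G\<^esub> (t [^]\<^bsub>G\<^esub> (f z div f t))"
    have u: "?u \<in> carrier G" using z t by simp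
    have "f ?u = f z - f t * (f z div f t)"
      using z t f_inv[of "t [^]\<^bsub>G\<^esub> (f z div f t)"] by (simp add: f.hom_int_pow mult.commute)
    then have mod: "f ?u = f z mod f t" by (simp add: minus_mult_div_eq_mod)
    have "\<not> f ?u > 0"
    proof
      assume pos: "f ?u > 0"
      then have "good (nat (f ?u))" using u by (auto simp: good_def)
      then have "(LEAST n. good n) \<le> nat (f ?u)" by (rule Least_le)
      then have "f t \<le> f ?u" using t(2) pos by linarith
      then show False using mod pos_mod_bound[OF t(3), of "f z"] by linarith
    qed
    then have "f z mod f t = 0" using mod pos_mod_sign[OF t(3), of "f z"] by linarith
    then show ?thesis by (simp add: dvd_eq_mod_eq_0)
  qed
  then show thesis using that t by blast
qed

text \<open>An extension of a free abelian group by a subgroup of the integers splits: if \<open>f t\<close> generates the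
  image of \<open>f\<close>, then every \<open>x\<close> is uniquely a product of an element of the kernel and a power
  of \<open>t\<close>. The exponent of \<open>t\<close> serves as the additional coordinate.\<close>
lemma iso_int_power_group_extension:
  assumes G: "comm_group G" and f: "f \<in> hom G integer_group"
    and ker: "G\<lparr>carrier := kernel G integer_group f\<rparr> \<cong> int_power_group m"
  shows "\<exists>m. G \<cong> int_power_group m"
proof (cases "\<exists>x\<in>carrier G. f x \<noteq> 0")
  case False
  then have "kernel G integer_group f = carrier G" by (auto simp: kernel_def)
  then show ?thesis using ker by auto
next
  case True
  interpret G: comm_group G by fact
  interpret f: group_hom G integer_group f
    using G.is_group f by (simp add: group_hom_def group_hom_axioms_def)
  obtain t where t: "t \<in> carrier G" "f t > 0" "\<And>x. x \<in> carrier G \<Longrightarrow> f t dvd f x"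
    using hom_to_integer_group_cyclic_image[OF G.is_group f True] by blast
  let ?N = "kernel G integer_group f"
  obtain \<psi> where \<psi>: "\<psi> \<in> iso (G\<lparr>carrier := ?N\<rparr>) (int_power_group m)"
    using ker by (auto simp: is_iso_def)
  have \<psi>_mult: "\<psi> (x \<otimes>\<^bsub>G\<^esub> z) = (\<lambda>i\<in>{..<m}. \<psi> x i + \<psi> z i)" if "x \<in> ?N" "z \<in> ?N" for x z
    using \<psi> that by (auto simp: iso_def hom_def)
  have \<psi>_bij: "bij_betw \<psi> ?N (carrier (int_power_group m))" using \<psi> by (simp add: iso_def)
  \<comment> \<open>The coordinates of \<open>x\<close>: its exponent of \<open>t\<close> and its component in the kernel.\<close>
  define q where "q x = f x div f t" for x
  define p where "p x = x \<otimes>\<^bsub>G\<^esub> inv\<^bsub>G\<^esub> (t [^]\<^bsub>G\<^esub> q x)" for x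
  have fq: "f x = f t * q x" if "x \<in> carrier G" for x using t(3)[OF that] by (simp add: q_def)
  have q_mult: "q (x \<otimes>\<^bsub>G\<^esub> z) = q x + q z" if "x \<in> carrier G" "z \<in> carrier G" for x z
    using t(2,3) that by (simp add: q_def div_plus_div_distrib_dvd_left)
  have p_ker: "p x \<in> ?N" if "x \<in> carrier G" for x
    using that t fq[OF that] f.hom_inv[of "t [^]\<^bsub>G\<^esub> q x"]
    by (simp add: p_def kernel_def f.hom_int_pow)
  have p_mult: "p (x \<otimes>\<^bsub>G\<^esub> z) = p x \<otimes>\<^bsub>G\<^esub> p z" if "x \<in> carrier G" "z \<in> carrier G" for x z
    using that t by (simp add: p_def q_mult G.int_pow_mult G.inv_mult G.m_ac)
  have p_decomp: "p x \<otimes>\<^bsub>G\<^esub> t [^]\<^bsub>G\<^esub> q x = x" if "x \<in> carrier G" for x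
    using that t by (simp add: p_def G.m_assoc)
  define \<Psi> where "\<Psi> x = (\<lambda>i\<in>{..<Suc m}. if i < m then \<psi> (p x) i else q x)" for x
  have hom: "\<Psi> \<in> hom G (int_power_group (Suc m))"
    by (rule homI) (auto simp: \<Psi>_def p_mult q_mult \<psi>_mult p_ker fun_eq_iff)
  have "inj_on \<Psi> (carrier G)"
  proof (rule inj_onI)
    fix x z assume xz: "x \<in> carrier G" "z \<in> carrier G" and eq: "\<Psi> x = \<Psi> z"
    have "q x = q z" using fun_cong[OF eq, of m] by (simp add: \<Psi>_def)
    have "\<psi> (p x) i = \<psi> (p z) i" if "i < m" for i
      using fun_cong[OF eq, of i] that by (simp add: \<Psi>_def)
    moreover have "\<psi> (p x) \<in> carrier (int_power_group m)" "\<psi> (p z) \<in> carrier (int_power_group m)"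
      using \<psi>_bij p_ker xz by (auto simp: bij_betw_def)
    ultimately have "\<psi> (p x) = \<psi> (p z)" by (intro PiE_ext[of _ "{..<m}"]) auto
    then have "p x = p z"
      using bij_betw_imp_inj_on[OF \<psi>_bij] p_ker xz by (simp add: inj_on_def)
    then show "x = z" using p_decomp xz \<open>q x = q z\<close> by metis
  qed
  moreover have "\<Psi> ` carrier G = carrier (int_power_group (Suc m))"
  proof
    show "\<Psi> ` carrier G \<subseteq> carrier (int_power_group (Suc m))" using hom by (auto simp: hom_def)
    show "carrier (int_power_group (Suc m)) \<subseteq> \<Psi> ` carrier G"
    proof
      fix w assume w: "w \<in> carrier (int_power_group (Suc m))"
      have "restrict w {..<m} \<in> \<psi> ` ?N" using \<psi>_bij by (auto simp: bij_betw_def)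
      then obtain u where u: "u \<in> ?N" "\<psi> u = restrict w {..<m}" by auto
      have uG: "u \<in> carrier G" "f u = 0" using u by (auto simp: kernel_def)
      let ?x = "u \<otimes>\<^bsub>G\<^esub> t [^]\<^bsub>G\<^esub> w m"
      have x: "?x \<in> carrier G" using uG t by simp
      have q: "q ?x = w m" using uG t by (simp add: q_def f.hom_int_pow)
      have "p ?x = u" using uG t unfolding p_def q by (simp add: G.m_assoc)
      then have "w = \<Psi> ?x"
        using q u w by (auto simp: \<Psi>_def fun_eq_iff PiE_def extensional_def less_Suc_eq)
      then show "w \<in> \<Psi> ` carrier G" using x by (rule image_eqI)
    qed
  qed
  ultimately have "\<Psi> \<in> iso G (int_power_group (Suc m))" using hom by (simp add: iso_def bij_betw_def)
  then show ?thesis by (auto simp: is_iso_def)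
qed

text \<open>Induction on \<open>n\<close>, splitting off the last coordinate: on its kernel the remaining \<open>n - 1\<close>
  coordinates still separate points. This shows that submodules of integral modules are integral.\<close>
lemma iso_int_power_group_if_embeds:
  assumes "comm_group G" "g \<in> hom G (int_power_group n)" "inj_on g (carrier G)"
  shows "\<exists>m. G \<cong> int_power_group m"
  using assms
proof (induction n arbitrary: G g)
  case 0
  interpret comm_group G by fact
  have "g x = g z" if "x \<in> carrier G" "z \<in> carrier G" for x z
    using 0(2) that by (auto simp: hom_def Pi_iff)
  then have "x = \<one>\<^bsub>G\<^esub>" if "x \<in> carrier G" for x
    using inj_onD[OF 0(3)] that one_closed by blast
  then have "carrier G = {\<one>\<^bsub>G\<^esub>}" using one_closed by blast
  moreover have "carrier (int_power_group 0) = {\<lambda>_. undefined}" by auto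
  moreover have "g \<one>\<^bsub>G\<^esub> = (\<lambda>_. undefined)" using 0(2) by (auto simp: hom_def Pi_iff)
  ultimately have "g \<in> iso G (int_power_group 0)" using 0(2) by (simp add: iso_def bij_betw_def)
  then have "G \<cong> int_power_group 0" unfolding is_iso_def by blast
  then show ?case by blast
next
  case (Suc n)
  interpret G: comm_group G by fact
  define f where "f x = g x n" for x
  have g_mult: "g (x \<otimes>\<^bsub>G\<^esub> z) = (\<lambda>i\<in>{..<Suc n}. g x i + g z i)" if "x \<in> carrier G" "z \<in> carrier G" for x z
    using Suc.prems(2) that by (auto simp: hom_def)
  have g_mem: "g x \<in> carrier (int_power_group (Suc n))" if "x \<in> carrier G" for x
    using Suc.prems(2) that by (auto simp: hom_def)
  have f: "f \<in> hom G integer_group"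
    by (rule homI) (auto simp: f_def g_mult)
  interpret f: group_hom G integer_group f
    using G.is_group f by (simp add: group_hom_def group_hom_axioms_def)
  let ?N = "kernel G integer_group f"
  have N: "comm_group (G\<lparr>carrier := ?N\<rparr>)"
    using f.subgroup_kernel by (rule G.comm_group_subgroup)
  define g' where "g' x = restrict (g x) {..<n}" for x
  have "g' \<in> hom (G\<lparr>carrier := ?N\<rparr>) (int_power_group n)"
    by (rule homI) (auto simp: g'_def g_mult kernel_def fun_eq_iff)
  moreover have "inj_on g' ?N"
  proof (rule inj_onI)
    fix x z assume xz: "x \<in> ?N" "z \<in> ?N" and eq: "g' x = g' z"
    then have C: "x \<in> carrier G" "z \<in> carrier G" and n: "g x n = g z n"
      by (auto simp: kernel_def f_def)
    have "g x i = g z i" if "i < Suc n" for i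
      using fun_cong[OF eq, of i] n that by (cases "i = n") (auto simp: g'_def)
    then have "g x = g z" using g_mem C by (intro PiE_ext[of _ "{..<Suc n}"]) auto
    then show "x = z" using Suc.prems(3) C by (simp add: inj_on_def)
  qed
  ultimately obtain m where "G\<lparr>carrier := ?N\<rparr> \<cong> int_power_group m"
    using Suc.IH[OF N] by auto
  then show ?case using iso_int_power_group_extension[OF Suc.prems(1) f] by blast
qed

lemma subgroup_iso_int_power_group:
  assumes G: "comm_group G" "G \<cong> int_power_group n" and T: "subgroup T G"
  shows "\<exists>m. G\<lparr>carrier := T\<rparr> \<cong> int_power_group m"
proof -
  interpret comm_group G by fact
  obtain g where g: "g \<in> iso G (int_power_group n)" using G(2) by (auto simp: is_iso_def)
  have T': "T \<subseteq> carrier G" using T by (rule subgroup.subset)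
  have "g \<in> hom (G\<lparr>carrier := T\<rparr>) (int_power_group n)"
    using g T' by (auto simp: iso_def hom_def Pi_iff subset_iff)
  moreover have "inj_on g T" using g T' by (auto simp: iso_def bij_betw_def intro: inj_on_subset)
  ultimately show ?thesis
    using iso_int_power_group_if_embeds[OF comm_group_subgroup[OF T]] by simp
qed

text \<open>The coset of an element is determined by its coordinates modulo \<open>d\<close>.\<close>
lemma finite_quotient_by_powers:
  assumes G: "comm_group G" "G \<cong> int_power_group n" and d: "(d::nat) > 0"
    and H: "subgroup H G" "\<And>x. x \<in> carrier G \<Longrightarrow> x [^]\<^bsub>G\<^esub> d \<in> H"
  shows "finite ((\<lambda>a. H #>\<^bsub>G\<^esub> a) ` carrier G)"
proof -
  interpret G: comm_group G by fact
  obtain g where g: "g \<in> iso G (int_power_group n)" using G(2) by (auto simp: is_iso_def)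
  have P: "group (int_power_group n)" by simp
  interpret g: group_hom G "int_power_group n" g
    using g P G.is_group by (simp add: group_hom_def group_hom_axioms_def iso_def)
  have bij: "bij_betw g (carrier G) (carrier (int_power_group n))" using g by (simp add: iso_def)
  define residues where "residues x = (\<lambda>i\<in>{..<n}. g x i mod int d)" for x
  have "residues ` carrier G \<subseteq> (\<Pi>\<^sub>E i\<in>{..<n}. {0..<int d})"
    using d by (auto simp: residues_def)
  then have fin: "finite (residues ` carrier G)"
    by (rule finite_subset) (auto intro: finite_PiE)
  have same: "H #>\<^bsub>G\<^esub> a = H #>\<^bsub>G\<^esub> b"
    if ab: "a \<in> carrier G" "b \<in> carrier G" and eq: "residues a = residues b" for a b
  proof -
    \<comment> \<open>The difference of \<open>a\<close> and \<open>b\<close> is the \<open>d\<close>-th power of the element with coordinates \<open>w\<close>.\<close>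
    define w where "w = (\<lambda>i\<in>{..<n}. (g a i - g b i) div int d)"
    have "w \<in> carrier (int_power_group n)" by (simp add: w_def)
    then have "w \<in> g ` carrier G" using bij_betw_imp_surj_on[OF bij] by blast
    then obtain z where z: "z \<in> carrier G" "g z = w" by blast
    have w: "int d * w i = g a i - g b i" if "i < n" for i
    proof -
      have "g a i mod int d = g b i mod int d"
        using fun_cong[OF eq, of i] that by (simp add: residues_def)
      then have "int d dvd g a i - g b i" by (simp add: mod_eq_dvd_iff)
      then show ?thesis using that by (simp add: w_def)
    qed
    have "g (z [^]\<^bsub>G\<^esub> d) = g (a \<otimes>\<^bsub>G\<^esub> inv\<^bsub>G\<^esub> b)"
    proof (rule PiE_ext)
      show "g (z [^]\<^bsub>G\<^esub> d) \<in> (\<Pi>\<^sub>E i\<in>{..<n}. UNIV)" "g (a \<otimes>\<^bsub>G\<^esub> inv\<^bsub>G\<^esub> b) \<in> (\<Pi>\<^sub>E i\<in>{..<n}. UNIV)"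
        using g.hom_closed[of "z [^]\<^bsub>G\<^esub> d"] g.hom_closed[of "a \<otimes>\<^bsub>G\<^esub> inv\<^bsub>G\<^esub> b"] z ab by simp_all
      fix i assume i: "i \<in> {..<n}"
      have "g (z [^]\<^bsub>G\<^esub> d) i = int d * w i"
        using int_power_group_pow[of w n i d] z i g.hom_nat_pow[OF z(1), of d]
          g.hom_closed[OF z(1)] by simp
      also have "\<dots> = g a i - g b i" using w i by simp
      also have "\<dots> = g (a \<otimes>\<^bsub>G\<^esub> inv\<^bsub>G\<^esub> b) i"
        using ab i g.hom_closed[OF ab(2)] by (simp add: inv_product_group)
      finally show "g (z [^]\<^bsub>G\<^esub> d) i = g (a \<otimes>\<^bsub>G\<^esub> inv\<^bsub>G\<^esub> b) i" .
    qed
    then have "z [^]\<^bsub>G\<^esub> d = a \<otimes>\<^bsub>G\<^esub> inv\<^bsub>G\<^esub> b"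
      using bij_betw_imp_inj_on[OF bij] z ab by (simp add: inj_on_def)
    then have "a \<otimes>\<^bsub>G\<^esub> inv\<^bsub>G\<^esub> b \<in> H" using H(2)[OF z(1)] by simp
    then show ?thesis
      using subgroup.rcos_module[OF H(1) G.is_group ab(2,1)] G.repr_independence[OF _ ab(2) H(1)] by simp
  qed
  have "(\<lambda>a. H #>\<^bsub>G\<^esub> a) ` carrier G \<subseteq> (\<lambda>\<rho>. H #>\<^bsub>G\<^esub> inv_into (carrier G) residues \<rho>) ` residues ` carrier G"
  proof
    fix C assume "C \<in> (\<lambda>a. H #>\<^bsub>G\<^esub> a) ` carrier G"
    then obtain a where a: "a \<in> carrier G" "C = H #>\<^bsub>G\<^esub> a" by blast
    have "inv_into (carrier G) residues (residues a) \<in> carrier G"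
      "residues (inv_into (carrier G) residues (residues a)) = residues a"
      using a by (auto intro: inv_into_into f_inv_into_f)
    then have "C = H #>\<^bsub>G\<^esub> inv_into (carrier G) residues (residues a)"
      using same a by metis
    then show "C \<in> (\<lambda>\<rho>. H #>\<^bsub>G\<^esub> inv_into (carrier G) residues \<rho>) ` residues ` carrier G"
      using a by blast
  qed
  then show ?thesis using fin by (meson finite_imageI finite_subset)
qed

lemma pow_index_mem:
  assumes G: "comm_group G" and H: "subgroup H G" and x: "x \<in> carrier G"
  shows "x [^]\<^bsub>G\<^esub> card (rcosets\<^bsub>G\<^esub> H) \<in> H"
proof -
  interpret G: comm_group G by fact
  interpret n: normal H G using H by (rule G.subgroup_imp_normal)
  interpret Q: group "G Mod H" by (rule n.factorgroup_is_group)
  have c: "H #>\<^bsub>G\<^esub> x \<in> carrier (G Mod H)" using x by (auto simp: carrier_FactGroup)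
  have "(H #>\<^bsub>G\<^esub> x) [^]\<^bsub>G Mod H\<^esub> Coset.order (G Mod H) = H"
    using Q.pow_order_eq_1[OF c] by simp
  then have "H #>\<^bsub>G\<^esub> (x [^]\<^bsub>G\<^esub> card (rcosets\<^bsub>G\<^esub> H)) = H"
    using n.FactGroup_pow[OF x] by (simp add: Coset.order_def FactGroup_def)
  then show ?thesis using G.coset_join1 x H by blast
qed

section \<open>Indices of subgroups under homomorphisms\<close>

lemma card_image_eq_if_same_kernel:
  assumes "\<And>u v. u \<in> A \<Longrightarrow> v \<in> A \<Longrightarrow> g u = g v \<longleftrightarrow> h u = h v"
  shows "card (g ` A) = card (h ` A)"
proof -
  have "bij_betw (\<lambda>z. h (inv_into A g z)) (g ` A) (h ` A)"
  proof (rule bij_betw_imageI)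
    show "inj_on (\<lambda>z. h (inv_into A g z)) (g ` A)"
      by (rule inj_onI) (metis assms f_inv_into_f inv_into_into)
    have "h (inv_into A g (g a)) = h a" if "a \<in> A" for a
      using assms[of "inv_into A g (g a)" a] that by (simp add: f_inv_into_f inv_into_into)
    then show "(\<lambda>z. h (inv_into A g z)) ` g ` A = h ` A"
      by (force simp: image_image)
  qed
  then show ?thesis by (rule bij_betw_same_card)
qed

lemma (in group) rcos_eq_iff:
  assumes "subgroup B G" "a \<in> carrier G" "b \<in> carrier G"
  shows "B #> a = B #> b \<longleftrightarrow> a \<otimes> inv b \<in> B"
  using assms
  by (metis repr_independence repr_independenceD rcos_self subgroup.rcos_module is_group)

text \<open>The index $[A : B]$, counted as the number of cosets of \<open>B\<close> that are represented in \<open>A\<close>. Both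
  subgroups are arguments because the proof compares many pairs of subgroups of one group.\<close>
definition coset_index :: "('a, 'm) monoid_scheme \<Rightarrow> 'a set \<Rightarrow> 'a set \<Rightarrow> nat" where
  "coset_index G A B = card ((\<lambda>a. B #>\<^bsub>G\<^esub> a) ` A)"

lemma hom_image_rcos:
  assumes "f \<in> hom G H" "B \<subseteq> carrier G" "a \<in> carrier G"
  shows "f ` (B #>\<^bsub>G\<^esub> a) = f ` B #>\<^bsub>H\<^esub> f a"
  using assms by (simp add: r_coset_def image_UN hom_def Pi_iff subset_iff cong: SUP_cong_simp)

text \<open>The index is multiplicative along a homomorphism: $[G : B] = [f(G) : f(B)] \cdot [\ker f : B \cap \ker f]$.
  Indeed $f$ maps cosets of $B$ to cosets of $f(B)$, and the cosets of $B$ over the coset of $f(a)$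
  are the cosets $Bka$ with $k \in \ker f$. All relations between the indices below are instances.\<close>
lemma coset_index_hom:
  assumes G: "group G" and H: "group H" and f: "f \<in> hom G H" and B: "subgroup B G"
    and fin: "finite ((\<lambda>a. B #>\<^bsub>G\<^esub> a) ` carrier G)"
  shows "coset_index G (carrier G) B =
      coset_index H (f ` carrier G) (f ` B) *
      coset_index G (kernel G H f) (B \<inter> kernel G H f)"
proof -
  interpret f: group_hom G H f
    using G H f by (simp add: group_hom_def group_hom_axioms_def)
  interpret B: subgroup B G by fact
  let ?cs = "(\<lambda>a. B #>\<^bsub>G\<^esub> a) ` carrier G"
  let ?ker = "kernel G H f"
  have BK: "subgroup (B \<inter> ?ker) G"
    using B f.subgroup_kernel by (rule subgroup_Int)
  have fB: "subgroup (f ` B) H"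
    using B by (rule f.subgroup_img_is_subgroup)
  have img: "(\<lambda>h. f ` B #>\<^bsub>H\<^esub> h) ` f ` carrier G = image f ` ?cs"
    using hom_image_rcos[OF f B.subset] by (auto simp: image_image)
  have fibre: "card {C \<in> ?cs. f ` C = D} = coset_index G ?ker (B \<inter> ?ker)"
    if D0: "D \<in> image f ` ?cs" for D
  proof -
    obtain a where a: "a \<in> carrier G" and D: "D = f ` B #>\<^bsub>H\<^esub> f a"
      using D0 hom_image_rcos[OF f B.subset] by auto
    have "{C \<in> ?cs. f ` C = D} = (\<lambda>k. B #>\<^bsub>G\<^esub> (k \<otimes>\<^bsub>G\<^esub> a)) ` ?ker"
    proof (intro equalityI subsetI)
      fix C assume "C \<in> {C \<in> ?cs. f ` C = D}"
      then obtain c where c: "c \<in> carrier G" "C = B #>\<^bsub>G\<^esub> c" "f ` C = D" by auto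
      then have "f ` B #>\<^bsub>H\<^esub> f c = f ` B #>\<^bsub>H\<^esub> f a"
        using hom_image_rcos[OF f B.subset] D by auto
      then have "f c \<otimes>\<^bsub>H\<^esub> inv\<^bsub>H\<^esub> f a \<in> f ` B"
        using f.H.rcos_eq_iff[OF fB] a c by simp
      then obtain b where b: "b \<in> B" "f c \<otimes>\<^bsub>H\<^esub> inv\<^bsub>H\<^esub> f a = f b" by auto
      have bG: "b \<in> carrier G" using b B.subset by auto
      let ?k = "inv\<^bsub>G\<^esub> b \<otimes>\<^bsub>G\<^esub> (c \<otimes>\<^bsub>G\<^esub> inv\<^bsub>G\<^esub> a)"
      have "f ?k = \<one>\<^bsub>H\<^esub>" using a b bG c by simp
      then have "?k \<in> ?ker" using a bG c by (simp add: kernel_def)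
      moreover have "C = B #>\<^bsub>G\<^esub> (?k \<otimes>\<^bsub>G\<^esub> a)"
      proof -
        have "c \<otimes>\<^bsub>G\<^esub> inv\<^bsub>G\<^esub> (?k \<otimes>\<^bsub>G\<^esub> a) = b"
          using a bG c by (simp add: f.G.m_assoc f.G.inv_mult_group)
            (simp add: f.G.m_assoc[symmetric])
        then show ?thesis using f.G.rcos_eq_iff[OF B] a b bG c by simp
      qed
      ultimately show "C \<in> (\<lambda>k. B #>\<^bsub>G\<^esub> (k \<otimes>\<^bsub>G\<^esub> a)) ` ?ker" by blast
    next
      fix C assume "C \<in> (\<lambda>k. B #>\<^bsub>G\<^esub> (k \<otimes>\<^bsub>G\<^esub> a)) ` ?ker"
      then obtain k where k: "k \<in> carrier G" "f k = \<one>\<^bsub>H\<^esub>" "C = B #>\<^bsub>G\<^esub> (k \<otimes>\<^bsub>G\<^esub> a)"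
        by (auto simp: kernel_def)
      then show "C \<in> {C \<in> ?cs. f ` C = D}"
        using a D hom_image_rcos[OF f B.subset] by auto
    qed
    moreover have "B #>\<^bsub>G\<^esub> (k \<otimes>\<^bsub>G\<^esub> a) = B #>\<^bsub>G\<^esub> (k' \<otimes>\<^bsub>G\<^esub> a) \<longleftrightarrow>
        (B \<inter> ?ker) #>\<^bsub>G\<^esub> k = (B \<inter> ?ker) #>\<^bsub>G\<^esub> k'" if "k \<in> ?ker" "k' \<in> ?ker" for k k'
    proof -
      have kG: "k \<in> carrier G" "k' \<in> carrier G" and "f k = \<one>\<^bsub>H\<^esub>" "f k' = \<one>\<^bsub>H\<^esub>"
        using that by (auto simp: kernel_def)
      then have "k \<otimes>\<^bsub>G\<^esub> inv\<^bsub>G\<^esub> k' \<in> ?ker" by (simp add: kernel_def)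
      moreover have "(k \<otimes>\<^bsub>G\<^esub> a) \<otimes>\<^bsub>G\<^esub> inv\<^bsub>G\<^esub> (k' \<otimes>\<^bsub>G\<^esub> a) = k \<otimes>\<^bsub>G\<^esub> inv\<^bsub>G\<^esub> k'"
        using kG a by (simp add: f.G.m_assoc f.G.inv_mult_group)
          (simp add: f.G.m_assoc[symmetric])
      ultimately show ?thesis
        using f.G.rcos_eq_iff[OF B] f.G.rcos_eq_iff[OF BK] kG a by simp
    qed
    ultimately show ?thesis
      using card_image_eq_if_same_kernel[of ?ker "\<lambda>k. B #>\<^bsub>G\<^esub> (k \<otimes>\<^bsub>G\<^esub> a)"
        "\<lambda>k. (B \<inter> ?ker) #>\<^bsub>G\<^esub> k"] by (simp add: coset_index_def)
  qed
  have "card ?cs = (\<Sum>D\<in>image f ` ?cs. card {C \<in> ?cs. f ` C = D})"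
    using fin sum.image_gen[of ?cs "\<lambda>_. 1::nat" "image f"] by simp
  also have "\<dots> = card (image f ` ?cs) * coset_index G ?ker (B \<inter> ?ker)"
    using fibre by simp
  finally show ?thesis
    unfolding coset_index_def[of G "carrier G"] coset_index_def[of H] img .
qed

lemma coset_index_tower:
  assumes "comm_group G" "subgroup B G" "subgroup C G" "C \<subseteq> B"
    and fin: "finite ((\<lambda>a. C #>\<^bsub>G\<^esub> a) ` carrier G)"
  shows "coset_index G (carrier G) C = coset_index G (carrier G) B * coset_index G B C"
proof -
  interpret comm_group G by fact
  interpret B: normal B G using assms by (simp add: subgroup_imp_normal)
  interpret C: subgroup C G by fact
  let ?f = "\<lambda>a. B #>\<^bsub>G\<^esub> a"
  have "kernel G (G Mod B) ?f = B"
    using coset_join1[OF _ _ B.subgroup_axioms] coset_join2[OF _ B.subgroup_axioms] B.subset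
    by (auto simp: kernel_def)
  moreover have "?f ` C = {B}"
    using assms(4) B.subset coset_join2[OF _ B.subgroup_axioms] C.one_closed by blast
  moreover have "coset_index (G Mod B) (?f ` carrier G) {B} = coset_index G (carrier G) B"
  proof -
    have "r_coset (G Mod B) {B} Z = {Z}" if "Z \<in> ?f ` carrier G" for Z
      using that B.rcosets_mult_eq by (auto simp: r_coset_def RCOSETS_def)
    then have "(\<lambda>Z. r_coset (G Mod B) {B} Z) ` ?f ` carrier G = (\<lambda>Z. {Z}) ` ?f ` carrier G"
      by (auto simp: image_image)
    then show ?thesis by (simp add: coset_index_def card_image)
  qed
  moreover have "C \<inter> B = C" using assms(4) by blast
  ultimately show ?thesis
    using coset_index_hom[OF is_group B.factorgroup_is_group B.r_coset_hom_Mod assms(3) fin]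
    by simp
qed

section \<open>Quotients and bases of modules\<close>

lemma quotient_module_smult:
  assumes N: "module R N" and H: "submodule H R N" and r: "r \<in> carrier R" and x: "x \<in> carrier N"
  shows "r \<odot>\<^bsub>quotient_module N H\<^esub> (H +>\<^bsub>N\<^esub> x) = H +>\<^bsub>N\<^esub> (r \<odot>\<^bsub>N\<^esub> x)"
proof -
  interpret N: module R N by fact
  interpret H: submodule H R N by fact
  have "H +>\<^bsub>N\<^esub> (r \<odot>\<^bsub>N\<^esub> z) = H +>\<^bsub>N\<^esub> (r \<odot>\<^bsub>N\<^esub> x)" if z: "z \<in> H +>\<^bsub>N\<^esub> x" for z
  proof -
    obtain h where h: "h \<in> H" "z = h \<oplus>\<^bsub>N\<^esub> x" using z by (auto simp: a_r_coset_def')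
    have hC: "h \<in> carrier N" using h(1) H.subset by auto
    have "r \<odot>\<^bsub>N\<^esub> z = r \<odot>\<^bsub>N\<^esub> h \<oplus>\<^bsub>N\<^esub> r \<odot>\<^bsub>N\<^esub> x"
      using h hC r x by (simp add: N.smult_r_distr)
    also have "\<dots> \<in> H +>\<^bsub>N\<^esub> (r \<odot>\<^bsub>N\<^esub> x)"
      using H.smult_closed[OF r h(1)] by (auto simp: a_r_coset_def')
    finally show ?thesis
      using N.M.a_repr_independence[of "r \<odot>\<^bsub>N\<^esub> z" H "r \<odot>\<^bsub>N\<^esub> x"] r x H.subgroup_axioms
      by simp
  qed
  moreover have "x \<in> H +>\<^bsub>N\<^esub> x"
    using H.one_closed x by (auto simp: a_r_coset_def' intro!: bexI[of _ "\<zero>\<^bsub>N\<^esub>"])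
  ultimately have "(\<Union>z\<in>H +>\<^bsub>N\<^esub> x. H +>\<^bsub>N\<^esub> (r \<odot>\<^bsub>N\<^esub> z)) = H +>\<^bsub>N\<^esub> (r \<odot>\<^bsub>N\<^esub> x)" by blast
  then show ?thesis by (simp add: quotient_module_def)
qed

lemma quotient_module_carrier:
  "carrier (quotient_module N H) = (\<lambda>x. H +>\<^bsub>N\<^esub> x) ` carrier N"
  by (auto simp: quotient_module_def A_RCOSETS_def')

lemma quotient_module_add:
  assumes N: "module R N" and H: "submodule H R N" and "x \<in> carrier N" "z \<in> carrier N"
  shows "(H +>\<^bsub>N\<^esub> x) \<oplus>\<^bsub>quotient_module N H\<^esub> (H +>\<^bsub>N\<^esub> z) = H +>\<^bsub>N\<^esub> (x \<oplus>\<^bsub>N\<^esub> z)"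
proof -
  interpret N: module R N by fact
  interpret H: submodule H R N by fact
  interpret n: normal H "add_monoid N"
    using N.M.a_comm_group H.subgroup_axioms by (rule comm_group.subgroup_imp_normal)
  show ?thesis
    using n.rcos_sum[of x z] assms by (simp add: quotient_module_def a_r_coset_def set_add_def)
qed

lemma quotient_module_zero: "\<zero>\<^bsub>quotient_module N H\<^esub> = H"
  by (simp add: quotient_module_def)

lemma module_quotient_module:
  assumes N: "module R N" and H: "submodule H R N"
  shows "module R (quotient_module N H)"
proof -
  interpret N: module R N by fact
  interpret H: submodule H R N by fact
  note [simp] = quotient_module_smult[OF assms] quotient_module_add[OF assms]
  have zero: "\<zero>\<^bsub>quotient_module N H\<^esub> = H +>\<^bsub>N\<^esub> \<zero>\<^bsub>N\<^esub>"
    using N.M.a_coset_add_zero H.subset by (simp add: quotient_module_zero)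
  have "abelian_group (quotient_module N H)"
  proof (rule abelian_groupI)
    fix C assume "C \<in> carrier (quotient_module N H)"
    then obtain x where x: "x \<in> carrier N" "C = H +>\<^bsub>N\<^esub> x" by (auto simp: quotient_module_carrier)
    show "\<exists>C'\<in>carrier (quotient_module N H). C' \<oplus>\<^bsub>quotient_module N H\<^esub> C = \<zero>\<^bsub>quotient_module N H\<^esub>"
      using x by (intro bexI[of _ "H +>\<^bsub>N\<^esub> (\<ominus>\<^bsub>N\<^esub> x)"])
        (auto simp: zero quotient_module_carrier N.M.l_neg)
  qed (auto simp: zero quotient_module_carrier N.M.a_ac)
  then show ?thesis
    by (intro moduleI)
      (auto simp: quotient_module_carrier N.R.is_cring N.smult_l_distr N.smult_r_distr N.smult_assoc1)
qed

lemma quotient_map_mod_hom: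
  assumes N: "module R N" and H: "submodule H R N"
  shows "(\<lambda>x. H +>\<^bsub>N\<^esub> x) \<in> mod_hom R N (quotient_module N H)"
  using quotient_module_smult[OF assms] quotient_module_add[OF assms]
  by (auto simp: mod_hom_def hom_def quotient_module_carrier)

lemma mod_hom_finsum:
  assumes N: "module R N" and P: "module R P" and f: "f \<in> mod_hom R N P"
    and A: "finite A" "c \<in> A \<rightarrow> carrier R" "v \<in> A \<rightarrow> carrier N"
  shows "f (\<Oplus>\<^bsub>N\<^esub>a\<in>A. c a \<odot>\<^bsub>N\<^esub> v a) = (\<Oplus>\<^bsub>P\<^esub>a\<in>A. c a \<odot>\<^bsub>P\<^esub> f (v a))"
proof -
  interpret N: module R N by fact
  interpret P: module R P by fact
  have fC: "f x \<in> carrier P" if "x \<in> carrier N" for x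
    using f that by (auto simp: mod_hom_def hom_def)
  have fadd: "f (x \<oplus>\<^bsub>N\<^esub> z) = f x \<oplus>\<^bsub>P\<^esub> f z" if "x \<in> carrier N" "z \<in> carrier N" for x z
    using f that by (auto simp: mod_hom_def hom_def)
  have fsm: "f (r \<odot>\<^bsub>N\<^esub> x) = r \<odot>\<^bsub>P\<^esub> f x" if "r \<in> carrier R" "x \<in> carrier N" for r x
    using f that by (auto simp: mod_hom_def)
  have f0: "f \<zero>\<^bsub>N\<^esub> = \<zero>\<^bsub>P\<^esub>" using fsm[OF N.R.zero_closed N.M.zero_closed] fC by simp
  show ?thesis
    using A
  proof (induction rule: finite_induct)
    case (insert a A)
    have "(\<lambda>a. c a \<odot>\<^bsub>N\<^esub> v a) \<in> A \<rightarrow> carrier N" "c a \<odot>\<^bsub>N\<^esub> v a \<in> carrier N"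
      "(\<lambda>a. c a \<odot>\<^bsub>P\<^esub> f (v a)) \<in> A \<rightarrow> carrier P" "c a \<odot>\<^bsub>P\<^esub> f (v a) \<in> carrier P"
      using insert.prems fC by auto
    moreover have "c a \<in> carrier R" "v a \<in> carrier N" using insert.prems by auto
    ultimately show ?case
      using insert by (simp add: fadd fsm)
  qed (simp add: f0)
qed

text \<open>A bijective homomorphism identifies the finite linear relations of \<open>B\<close> with those of \<open>f ` B\<close>.\<close>
lemma module_basis_image:
  assumes N: "module R N" and P: "module R P" and f: "f \<in> mod_hom R N P"
    and bij: "bij_betw f (carrier N) (carrier P)" and B: "module_basis R N B"
  shows "module_basis R P (f ` B)"
proof -
  interpret N: module R N by fact
  interpret P: module R P by fact
  have BN: "B \<subseteq> carrier N" using B by (simp add: module_basis_def)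
  have injN: "inj_on f (carrier N)" using bij by (rule bij_betw_imp_inj_on)
  have fC: "f x \<in> carrier P" if "x \<in> carrier N" for x
    using bij that by (auto simp: bij_betw_def)
  have f0: "f \<zero>\<^bsub>N\<^esub> = \<zero>\<^bsub>P\<^esub>"
    using mod_hom_finsum[OF N P f, of "{}"] by simp
  have sum: "f (\<Oplus>\<^bsub>N\<^esub>a\<in>A. c (f a) \<odot>\<^bsub>N\<^esub> a) = (\<Oplus>\<^bsub>P\<^esub>b\<in>f ` A. c b \<odot>\<^bsub>P\<^esub> b)"
    if A: "finite A" "A \<subseteq> B" "c \<in> f ` A \<rightarrow> carrier R" for A c
  proof -
    have AN: "a \<in> carrier N" "c (f a) \<in> carrier R" if "a \<in> A" for a
      using A BN that by auto
    have "f (\<Oplus>\<^bsub>N\<^esub>a\<in>A. c (f a) \<odot>\<^bsub>N\<^esub> a) = (\<Oplus>\<^bsub>P\<^esub>a\<in>A. c (f a) \<odot>\<^bsub>P\<^esub> f a)"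
      using mod_hom_finsum[OF N P f, of A "\<lambda>a. c (f a)" "\<lambda>a. a"] A BN by auto
    also have "\<dots> = (\<Oplus>\<^bsub>P\<^esub>b\<in>f ` A. c b \<odot>\<^bsub>P\<^esub> b)"
      using AN fC inj_on_subset[OF injN, of A] A(3)
      by (intro P.M.finsum_reindex[symmetric]) auto
    finally show ?thesis .
  qed
  have sumN: "(\<Oplus>\<^bsub>N\<^esub>a\<in>A. c (f a) \<odot>\<^bsub>N\<^esub> a) \<in> carrier N"
    if "A \<subseteq> B" "c \<in> f ` A \<rightarrow> carrier R" for A c
    using that BN by (intro N.M.finsum_closed) auto
  show ?thesis
    unfolding module_basis_def
  proof (intro conjI ballI allI impI)
    show "f ` B \<subseteq> carrier P" using BN fC by blast
  next
    fix z assume "z \<in> carrier P"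
    then obtain x where x: "x \<in> carrier N" "z = f x" using bij by (auto simp: bij_betw_def)
    then obtain A c where A: "finite A" "A \<subseteq> B" "c \<in> A \<rightarrow> carrier R"
        "x = (\<Oplus>\<^bsub>N\<^esub>b\<in>A. c b \<odot>\<^bsub>N\<^esub> b)"
      using B unfolding module_basis_def by meson
    have inv: "inv_into (carrier N) f (f a) = a" if "a \<in> A" for a
      using that A(2) BN injN by (intro inv_into_f_f) auto
    define c' where "c' b = c (inv_into (carrier N) f b)" for b
    have c': "c' (f a) = c a" if "a \<in> A" for a using inv[OF that] by (simp add: c'_def)
    have "x = (\<Oplus>\<^bsub>N\<^esub>a\<in>A. c' (f a) \<odot>\<^bsub>N\<^esub> a)"
      unfolding A(4)
    proof (rule N.M.finsum_cong'[OF refl])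
      have "c a \<in> carrier R" "a \<in> carrier N" if "a \<in> A" for a using A BN that by auto
      then show "(\<lambda>a. c' (f a) \<odot>\<^bsub>N\<^esub> a) \<in> A \<rightarrow> carrier N" using c' by auto
    qed (simp add: c')
    moreover have "c' \<in> f ` A \<rightarrow> carrier R" using A(3) c' by auto
    ultimately have "z = (\<Oplus>\<^bsub>P\<^esub>b\<in>f ` A. c' b \<odot>\<^bsub>P\<^esub> b)"
      using sum[OF A(1,2), of c'] x(2) by simp
    then show "\<exists>A c. finite A \<and> A \<subseteq> f ` B \<and> c \<in> A \<rightarrow> carrier R \<and> z = (\<Oplus>\<^bsub>P\<^esub>b\<in>A. c b \<odot>\<^bsub>P\<^esub> b)"
      using A c' by (intro exI[of _ "f ` A"] exI[of _ c']) auto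
  next
    fix A' c b'
    assume A': "finite A' \<and> A' \<subseteq> f ` B \<and> c \<in> A' \<rightarrow> carrier R \<and>
        (\<Oplus>\<^bsub>P\<^esub>b\<in>A'. c b \<odot>\<^bsub>P\<^esub> b) = \<zero>\<^bsub>P\<^esub>" and b': "b' \<in> A'"
    then obtain A where A: "A \<subseteq> B" "A' = f ` A" "finite A"
      by (meson finite_subset_image)
    have c: "c \<in> f ` A \<rightarrow> carrier R" using A' A by auto
    have "f (\<Oplus>\<^bsub>N\<^esub>a\<in>A. c (f a) \<odot>\<^bsub>N\<^esub> a) = f \<zero>\<^bsub>N\<^esub>" using sum[OF A(3,1) c] A' A f0 by simp
    then have "(\<Oplus>\<^bsub>N\<^esub>a\<in>A. c (f a) \<odot>\<^bsub>N\<^esub> a) = \<zero>\<^bsub>N\<^esub>"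
      using injN sumN[OF A(1) c] by (simp add: inj_on_def)
    moreover have "(\<lambda>a. c (f a)) \<in> A \<rightarrow> carrier R" using c by auto
    ultimately have "\<forall>a\<in>A. c (f a) = \<zero>\<^bsub>R\<^esub>"
      using B A(1,3) unfolding module_basis_def by simp
    then show "c b' = \<zero>\<^bsub>R\<^esub>" using b' A by auto
  qed
qed

text \<open>Two submodules that embed into a common module with the same image are isomorphic, so freeness passes
  from one to the other.\<close>
lemma free_module_if_same_image:
  assumes N: "free_module R N" and P: "module R P" and Q: "module R Q"
    and f: "f \<in> mod_hom R N Q" "inj_on f (carrier N)"
    and g: "g \<in> mod_hom R P Q" "inj_on g (carrier P)"
    and image: "f ` carrier N = g ` carrier P"
  shows "free_module R P"
proof -
  have N': "module R N" using N by (simp add: free_module_def)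
  interpret N: module R N by fact
  interpret P: module R P by fact
  define h where "h x = inv_into (carrier P) g (f x)" for x
  have h: "h x \<in> carrier P" "g (h x) = f x" if "x \<in> carrier N" for x
  proof -
    have "f x \<in> g ` carrier P" using that image by blast
    then show "h x \<in> carrier P" "g (h x) = f x"
      by (simp_all add: h_def inv_into_into f_inv_into_f)
  qed
  have eqI: "u = v" if "u \<in> carrier P" "v \<in> carrier P" "g u = g v" for u v
    using g(2) that by (simp add: inj_on_def)
  have gadd: "g (u \<oplus>\<^bsub>P\<^esub> v) = g u \<oplus>\<^bsub>Q\<^esub> g v" if "u \<in> carrier P" "v \<in> carrier P" for u v
    using g(1) that by (auto simp: mod_hom_def hom_def)
  have gsm: "g (r \<odot>\<^bsub>P\<^esub> u) = r \<odot>\<^bsub>Q\<^esub> g u" if "r \<in> carrier R" "u \<in> carrier P" for r u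
    using g(1) that by (auto simp: mod_hom_def)
  have fadd: "f (u \<oplus>\<^bsub>N\<^esub> v) = f u \<oplus>\<^bsub>Q\<^esub> f v" if "u \<in> carrier N" "v \<in> carrier N" for u v
    using f(1) that by (auto simp: mod_hom_def hom_def)
  have fsm: "f (r \<odot>\<^bsub>N\<^esub> u) = r \<odot>\<^bsub>Q\<^esub> f u" if "r \<in> carrier R" "u \<in> carrier N" for r u
    using f(1) that by (auto simp: mod_hom_def)
  have "h \<in> mod_hom R N P"
    unfolding mod_hom_def hom_def
    by (auto intro!: eqI simp: h gadd gsm fadd fsm)
  moreover have "bij_betw h (carrier N) (carrier P)"
  proof (rule bij_betw_imageI)
    show "inj_on h (carrier N)" using f(2) h(2) by (metis inj_on_def)
    show "h ` carrier N = carrier P"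
    proof
      show "h ` carrier N \<subseteq> carrier P" using h by blast
      show "carrier P \<subseteq> h ` carrier N"
      proof
        fix u assume u: "u \<in> carrier P"
        then obtain x where x: "x \<in> carrier N" "g u = f x" using image by (metis imageE imageI)
        then have "u = h x" using h u by (intro eqI) auto
        then show "u \<in> h ` carrier N" using x by blast
      qed
    qed
  qed
  ultimately show ?thesis
    using module_basis_image[OF N' P] N P unfolding free_module_def by blast
qed

lemma free_module_torsion_free:
  assumes R: "domain R" and N: "free_module R N"
    and s: "s \<in> carrier R" "s \<noteq> \<zero>\<^bsub>R\<^esub>" and x: "x \<in> carrier N" "s \<odot>\<^bsub>N\<^esub> x = \<zero>\<^bsub>N\<^esub>"
  shows "x = \<zero>\<^bsub>N\<^esub>"
proof -
  interpret R: domain R by fact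
  obtain B where N': "module R N" and B: "module_basis R N B" using N by (auto simp: free_module_def)
  interpret N: module R N by fact
  have BN: "B \<subseteq> carrier N" using B by (simp add: module_basis_def)
  obtain A c where A: "finite A" "A \<subseteq> B" "c \<in> A \<rightarrow> carrier R" "x = (\<Oplus>\<^bsub>N\<^esub>b\<in>A. c b \<odot>\<^bsub>N\<^esub> b)"
    using B x(1) unfolding module_basis_def by meson
  have AN: "b \<in> carrier N" "c b \<in> carrier R" if "b \<in> A" for b
    using A BN that by auto
  have "(\<Oplus>\<^bsub>N\<^esub>b\<in>A. (s \<otimes>\<^bsub>R\<^esub> c b) \<odot>\<^bsub>N\<^esub> b) = (\<Oplus>\<^bsub>N\<^esub>b\<in>A. s \<odot>\<^bsub>N\<^esub> (c b \<odot>\<^bsub>N\<^esub> b))"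
    using AN s by (intro N.M.finsum_cong') (auto simp: N.smult_assoc1)
  also have "\<dots> = s \<odot>\<^bsub>N\<^esub> x"
    unfolding A(4) using A BN s by (intro N.finsum_smult_ldistr[symmetric]) auto
  finally have "(\<Oplus>\<^bsub>N\<^esub>b\<in>A. (s \<otimes>\<^bsub>R\<^esub> c b) \<odot>\<^bsub>N\<^esub> b) = \<zero>\<^bsub>N\<^esub>" using x by simp
  moreover have "(\<lambda>b. s \<otimes>\<^bsub>R\<^esub> c b) \<in> A \<rightarrow> carrier R" using A s by auto
  ultimately have "\<forall>b\<in>A. s \<otimes>\<^bsub>R\<^esub> c b = \<zero>\<^bsub>R\<^esub>"
    using B A(1,2) unfolding module_basis_def by blast
  then have "c b = \<zero>\<^bsub>R\<^esub>" if "b \<in> A" for b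
    using R.integral[of s "c b"] s A(3) that by auto
  then have "x = (\<Oplus>\<^bsub>N\<^esub>b\<in>A. \<zero>\<^bsub>N\<^esub>)"
    unfolding A(4) using A BN by (intro N.M.finsum_cong') auto
  then show ?thesis by simp
qed

text \<open>For a finite basis the finite subsets and coefficient functions of \<^const>\<open>module_basis\<close> can be
  replaced by coefficient vectors of length \<open>r\<close>, extended by zero.\<close>
lemma free_of_rank_indexed_basis:
  assumes "free_of_rank R N r"
  shows "\<exists>\<beta>. (\<forall>j<r. \<beta> j \<in> carrier N) \<and>
    (\<forall>x\<in>carrier N. \<exists>c\<in>{..<r} \<rightarrow> carrier R. x = (\<Oplus>\<^bsub>N\<^esub>j\<in>{..<r}. c j \<odot>\<^bsub>N\<^esub> \<beta> j)) \<and>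
    (\<forall>c\<in>{..<r} \<rightarrow> carrier R. (\<Oplus>\<^bsub>N\<^esub>j\<in>{..<r}. c j \<odot>\<^bsub>N\<^esub> \<beta> j) = \<zero>\<^bsub>N\<^esub> \<longrightarrow> (\<forall>j<r. c j = \<zero>\<^bsub>R\<^esub>))"
proof -
  obtain B where N: "module R N" and B: "module_basis R N B" "finite B" "card B = r"
    using assms by (auto simp: free_of_rank_def)
  interpret N: module R N by fact
  have BN: "B \<subseteq> carrier N" using B by (simp add: module_basis_def)
  obtain \<beta> where \<beta>: "bij_betw \<beta> {..<r} B"
    using ex_bij_betw_nat_finite[OF B(2)] B(3) by (auto simp: atLeast0LessThan)
  then have inj: "inj_on \<beta> {..<r}" and img: "\<beta> ` {..<r} = B" by (auto simp: bij_betw_def)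
  have \<beta>C: "\<beta> j \<in> carrier N" if "j < r" for j using img BN that by auto
  have reindex: "(\<Oplus>\<^bsub>N\<^esub>b\<in>B. c b \<odot>\<^bsub>N\<^esub> b) = (\<Oplus>\<^bsub>N\<^esub>j\<in>{..<r}. c (\<beta> j) \<odot>\<^bsub>N\<^esub> \<beta> j)"
    if "c \<in> B \<rightarrow> carrier R" for c
    unfolding img[symmetric] using inj that BN img
    by (intro N.M.finsum_reindex) auto
  show ?thesis
  proof (intro exI[of _ \<beta>] conjI ballI allI impI)
    show "\<beta> j \<in> carrier N" if "j < r" for j using \<beta>C that .
  next
    fix x assume "x \<in> carrier N"
    then obtain A c where A: "finite A" "A \<subseteq> B" "c \<in> A \<rightarrow> carrier R" "x = (\<Oplus>\<^bsub>N\<^esub>b\<in>A. c b \<odot>\<^bsub>N\<^esub> b)"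
      using B(1) unfolding module_basis_def by meson
    define c' where "c' b = (if b \<in> A then c b else \<zero>\<^bsub>R\<^esub>)" for b
    have c': "c' \<in> B \<rightarrow> carrier R" using A by (auto simp: c'_def)
    have "x = (\<Oplus>\<^bsub>N\<^esub>b\<in>B. c' b \<odot>\<^bsub>N\<^esub> b)"
      unfolding A(4)
    proof (rule N.M.add.finprod_mono_neutral_cong_left[OF B(2) A(2)])
      show "c b \<odot>\<^bsub>N\<^esub> b = c' b \<odot>\<^bsub>N\<^esub> b" if "b \<in> A" for b using that by (simp add: c'_def)
      have "c' b \<in> carrier R" "b \<in> carrier N" if "b \<in> B" for b using c' BN that by auto
      then show "(\<lambda>b. c' b \<odot>\<^bsub>N\<^esub> b) \<in> B \<rightarrow> carrier N" by auto
      show "c' b \<odot>\<^bsub>N\<^esub> b = \<zero>\<^bsub>N\<^esub>" if "b \<in> B - A" for b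
        using that BN by (auto simp: c'_def)
    qed
    then have "x = (\<Oplus>\<^bsub>N\<^esub>j\<in>{..<r}. c' (\<beta> j) \<odot>\<^bsub>N\<^esub> \<beta> j)" using reindex[OF c'] by simp
    then show "\<exists>c\<in>{..<r} \<rightarrow> carrier R. x = (\<Oplus>\<^bsub>N\<^esub>j\<in>{..<r}. c j \<odot>\<^bsub>N\<^esub> \<beta> j)"
      using c' img by (intro bexI[of _ "\<lambda>j. c' (\<beta> j)"]) auto
  next
    fix c j assume c: "c \<in> {..<r} \<rightarrow> carrier R" "(\<Oplus>\<^bsub>N\<^esub>j\<in>{..<r}. c j \<odot>\<^bsub>N\<^esub> \<beta> j) = \<zero>\<^bsub>N\<^esub>" and j: "j < r"
    define c' where "c' b = c (inv_into {..<r} \<beta> b)" for b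
    have c'\<beta>: "c' (\<beta> j) = c j" if "j < r" for j using inj that by (simp add: c'_def inv_into_f_f)
    then have c': "c' \<in> B \<rightarrow> carrier R" using c(1) img by auto
    have "(\<Oplus>\<^bsub>N\<^esub>b\<in>B. c' b \<odot>\<^bsub>N\<^esub> b) = \<zero>\<^bsub>N\<^esub>"
      unfolding reindex[OF c'] c(2)[symmetric]
      using c(1) \<beta>C c'\<beta> by (intro N.M.finsum_cong') auto
    then have "\<forall>b\<in>B. c' b = \<zero>\<^bsub>R\<^esub>"
      using B(1,2) c' unfolding module_basis_def by blast
    then show "c j = \<zero>\<^bsub>R\<^esub>" using c'\<beta>[OF j] img j by auto
  qed
qed

section \<open>Modules with a nilpotent endomorphism\<close>

no_notation Sum_Type.Plus (infixr \<open><+>\<close> 65)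

text \<open>A module over $R[y]/(y^l)$ is an $R$-module with an endomorphism \<open>y\<close> such that $y^l = 0$. This
  point of view keeps the truncated polynomial ring out of the main argument.\<close>
locale nilpotent_endomorphism = module R M
  for R :: "('r, 'q) ring_scheme" and M :: "('r, 'b, 'm) module_scheme" (structure) +
  fixes y :: "'b \<Rightarrow> 'b" and l :: nat
  assumes y_closed [simp, intro]: "x \<in> carrier M \<Longrightarrow> y x \<in> carrier M"
    and y_add: "\<lbrakk>u \<in> carrier M; v \<in> carrier M\<rbrakk> \<Longrightarrow> y (u \<oplus> v) = y u \<oplus> y v"
    and y_smult: "\<lbrakk>a \<in> carrier R; x \<in> carrier M\<rbrakk> \<Longrightarrow> y (a \<odot> x) = a \<odot> y x"
    and y_nilpotent: "x \<in> carrier M \<Longrightarrow> (y ^^ l) x = \<zero>"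
begin

definition K :: "nat \<Rightarrow> 'b set" where
  "K i = {x \<in> carrier M. (y ^^ i) x = \<zero>}"

text \<open>For a $y$-stable submodule \<open>T\<close> one has $K_i(T) = K_i(M) \cap T$, so \<open>K i \<inter> T\<close> takes the place of
  $K_i(T)$. In contrast, $L_i(T)$ may be smaller than $L_i(M) \cap T$ and needs \<open>T\<close> as a parameter.\<close>
definition L :: "'b set \<Rightarrow> nat \<Rightarrow> 'b set" where
  "L T i = y ` (K (Suc i) \<inter> T) <+> (K (i - 1) \<inter> T)"

definition y_submodule :: "'b set \<Rightarrow> bool" where
  "y_submodule T \<longleftrightarrow> submodule T R M \<and> y ` T \<subseteq> T"

text \<open>Equivalently, the maps $Q_i(T) \to Q_i(M)$ are injective.\<close>
definition saturated :: "'b set \<Rightarrow> bool" where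
  "saturated T \<longleftrightarrow> y_submodule T \<and> (\<forall>i\<in>{1..l}. T \<inter> L (carrier M) i \<subseteq> L T i)"

text \<open>The image $\overline{Q}_i(T)$ of $Q_i(T)$ in $Q_i(M)$, as a set of cosets of $L_i(M)$.\<close>
definition layer :: "'b set \<Rightarrow> nat \<Rightarrow> 'b set set" where
  "layer T i = (\<lambda>a. L (carrier M) i +> a) ` (K i \<inter> T)"

lemma mem_set_add: "x \<in> A <+> B \<longleftrightarrow> (\<exists>a\<in>A. \<exists>b\<in>B. x = a \<oplus> b)"
  by (auto simp: set_add_def')

lemma submodule_carrier: "submodule H R M \<Longrightarrow> H \<subseteq> carrier M"
  by (rule submoduleE)

lemma submodule_zero: "submodule H R M \<Longrightarrow> \<zero> \<in> H"
  using subgroup.one_closed[of H "add_monoid M"] by (simp add: submodule_def)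

lemma submodule_add: "\<lbrakk>submodule H R M; a \<in> H; b \<in> H\<rbrakk> \<Longrightarrow> a \<oplus> b \<in> H"
  by (rule submoduleE)

lemma submodule_diff: "\<lbrakk>submodule H R M; a \<in> H; b \<in> H\<rbrakk> \<Longrightarrow> a \<ominus> b \<in> H"
  using submoduleE(5)[of H a "\<ominus> b"] submoduleE(3)[of H b] by (simp add: M.minus_eq)

lemma submodule_smult: "\<lbrakk>submodule H R M; a \<in> carrier R; b \<in> H\<rbrakk> \<Longrightarrow> a \<odot> b \<in> H"
  by (rule submoduleE)

lemma submodule_subgroup: "submodule H R M \<Longrightarrow> subgroup H (add_monoid M)"
  by (simp add: submodule_def)

lemma diff_add_cancel: "\<lbrakk>a \<in> carrier M; b \<in> carrier M\<rbrakk> \<Longrightarrow> b \<oplus> (a \<ominus> b) = a"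
  by (simp add: M.minus_eq M.a_lcomm M.r_neg)

lemma add_diff_cancel: "\<lbrakk>a \<in> carrier M; b \<in> carrier M\<rbrakk> \<Longrightarrow> (b \<oplus> a) \<ominus> b = a"
  by (simp add: M.minus_eq M.a_ac M.r_neg)

lemma submodule_sum:
  assumes "submodule A R M" "submodule B R M"
  shows "submodule (A <+> B) R M"
proof (rule submoduleI)
  have AB: "\<And>a. a \<in> A \<Longrightarrow> a \<in> carrier M" "\<And>b. b \<in> B \<Longrightarrow> b \<in> carrier M"
    using assms submodule_carrier by auto
  show "A <+> B \<subseteq> carrier M" using AB by (auto simp: mem_set_add)
  show "\<zero> \<in> A <+> B"
    using submodule_zero[OF assms(1)] submodule_zero[OF assms(2)] M.l_zero[OF M.zero_closed]
    unfolding mem_set_add by metis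
  show "\<ominus> x \<in> A <+> B" if "x \<in> A <+> B" for x
    using that submoduleE(3)[OF assms(1)] submoduleE(3)[OF assms(2)] AB
    unfolding mem_set_add by (metis M.minus_add)
  show "x \<oplus> z \<in> A <+> B" if xz: "x \<in> A <+> B" "z \<in> A <+> B" for x z
  proof -
    obtain a b a' b' where ab: "a \<in> A" "b \<in> B" "x = a \<oplus> b" "a' \<in> A" "b' \<in> B" "z = a' \<oplus> b'"
      using xz unfolding mem_set_add by blast
    then have "x \<oplus> z = (a \<oplus> a') \<oplus> (b \<oplus> b')"
      using AB by (simp add: M.a_ac)
    then show ?thesis
      using ab submodule_add[OF assms(1)] submodule_add[OF assms(2)] unfolding mem_set_add by blast
  qed
  show "a \<odot> x \<in> A <+> B" if "a \<in> carrier R" "x \<in> A <+> B" for a x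
    using that submodule_smult[OF assms(1)] submodule_smult[OF assms(2)] AB
    unfolding mem_set_add by (metis smult_r_distr)
qed

lemma subset_sum_left: "submodule A R M \<Longrightarrow> submodule B R M \<Longrightarrow> A \<subseteq> A <+> B"
  using submodule_zero submodule_carrier by (force simp: mem_set_add)

lemma subset_sum_right: "submodule A R M \<Longrightarrow> submodule B R M \<Longrightarrow> B \<subseteq> A <+> B"
  using submodule_zero submodule_carrier by (force simp: mem_set_add)

lemma sum_subset:
  "submodule C R M \<Longrightarrow> A \<subseteq> C \<Longrightarrow> B \<subseteq> C \<Longrightarrow> A <+> B \<subseteq> C"
  unfolding subset_iff mem_set_add by (metis submodule_add)

lemma submodule_Int:
  "submodule A R M \<Longrightarrow> submodule B R M \<Longrightarrow> submodule (A \<inter> B) R M"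
  using submoduleE(1,3,4,5) submodule_zero by (intro submoduleI) auto

lemma submodule_singleton_zero: "submodule {\<zero>} R M"
  by (rule submoduleI) auto

lemma y_zero [simp]: "y \<zero> = \<zero>"
  using y_smult[OF R.zero_closed M.zero_closed] by simp

lemma y_minus: "x \<in> carrier M \<Longrightarrow> y (\<ominus> x) = \<ominus> y x"
  using y_smult[of "\<ominus>\<^bsub>R\<^esub> \<one>\<^bsub>R\<^esub>" x] by (simp add: smult_l_minus)

lemma y_pow_closed [simp, intro]: "x \<in> carrier M \<Longrightarrow> (y ^^ i) x \<in> carrier M"
  by (induction i) auto

lemma y_pow_add:
  "u \<in> carrier M \<Longrightarrow> v \<in> carrier M \<Longrightarrow> (y ^^ i) (u \<oplus> v) = (y ^^ i) u \<oplus> (y ^^ i) v"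
  by (induction i) (auto simp: y_add)

lemma y_pow_smult:
  "a \<in> carrier R \<Longrightarrow> x \<in> carrier M \<Longrightarrow> (y ^^ i) (a \<odot> x) = a \<odot> (y ^^ i) x"
  by (induction i) (auto simp: y_smult)

lemma y_pow_zero [simp]: "(y ^^ i) \<zero> = \<zero>"
  by (induction i) auto

lemma y_pow_minus: "x \<in> carrier M \<Longrightarrow> (y ^^ i) (\<ominus> x) = \<ominus> (y ^^ i) x"
  by (induction i) (auto simp: y_minus)

lemma submodule_image_y:
  assumes "submodule A R M" shows "submodule (y ` A) R M"
proof (rule submoduleI)
  note A = submodule_carrier[OF assms]
  show "y ` A \<subseteq> carrier M" using A by auto
  show "\<zero> \<in> y ` A" using submodule_zero[OF assms] y_zero by (metis image_eqI)
  show "\<ominus> x \<in> y ` A" if "x \<in> y ` A" for x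
    using that A submoduleE(3)[OF assms] by (auto simp: y_minus[symmetric] subset_iff)
  show "u \<oplus> v \<in> y ` A" if "u \<in> y ` A" "v \<in> y ` A" for u v
    using that A submodule_add[OF assms] by (auto simp: y_add[symmetric] subset_iff)
  show "a \<odot> x \<in> y ` A" if "a \<in> carrier R" "x \<in> y ` A" for a x
    using that A submodule_smult[OF assms] by (auto simp: y_smult[symmetric] subset_iff)
qed

lemma K_submodule: "submodule (K i) R M"
  unfolding K_def by (rule submoduleI) (auto simp: y_pow_add y_pow_smult y_pow_minus)

lemma K_carrier: "K i \<subseteq> carrier M"
  by (auto simp: K_def)

lemma K_memD: "x \<in> K i \<Longrightarrow> x \<in> carrier M"
  by (simp add: K_def)

lemma y_mem_K_iff: "x \<in> carrier M \<Longrightarrow> y x \<in> K i \<longleftrightarrow> x \<in> K (Suc i)"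
  by (simp add: K_def funpow_swap1)

lemma K_mono: "i \<le> j \<Longrightarrow> K i \<subseteq> K j"
proof (induction rule: dec_induct)
  case (step n)
  have "K n \<subseteq> K (Suc n)" by (auto simp: K_def)
  with step show ?case by blast
qed simp

lemma K_0: "K 0 = {\<zero>}"
  by (auto simp: K_def)

lemma K_top: "l \<le> i \<Longrightarrow> K i = carrier M"
  using K_mono[of l i] y_nilpotent by (auto simp: K_def)

lemma y_K: "x \<in> K (Suc i) \<Longrightarrow> y x \<in> K i"
  using y_mem_K_iff K_carrier by blast

lemma y_submodule_submodule: "y_submodule T \<Longrightarrow> submodule T R M"
  by (simp add: y_submodule_def)

lemma y_submodule_carrier: "y_submodule (carrier M)"
  using carrier_is_submodule by (auto simp: y_submodule_def)

lemma y_submodule_Int: "y_submodule A \<Longrightarrow> y_submodule B \<Longrightarrow> y_submodule (A \<inter> B)"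
  using submodule_Int by (auto simp: y_submodule_def)

lemma K_Int_submodule: "y_submodule T \<Longrightarrow> submodule (K i \<inter> T) R M"
  using K_submodule submodule_Int y_submodule_submodule by blast

lemma L_submodule: "y_submodule T \<Longrightarrow> submodule (L T i) R M"
  unfolding L_def by (intro submodule_sum submodule_image_y K_Int_submodule)

lemma LM_submodule: "submodule (L (carrier M) i) R M"
  by (rule L_submodule[OF y_submodule_carrier])

lemma L_mono: "T \<subseteq> T' \<Longrightarrow> L T i \<subseteq> L T' i"
  unfolding L_def mem_set_add subset_iff by blast

lemma L_subset:
  assumes T: "y_submodule T" and i: "1 \<le> i"
  shows "L T i \<subseteq> K i \<inter> T"
  unfolding L_def
proof (rule sum_subset[OF K_Int_submodule[OF T]])
  show "y ` (K (Suc i) \<inter> T) \<subseteq> K i \<inter> T"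
    using T y_K by (auto simp: y_submodule_def)
  show "K (i - 1) \<inter> T \<subseteq> K i \<inter> T"
    using K_mono[of "i - 1" i] i by auto
qed

lemma y_L: "y_submodule T \<Longrightarrow> x \<in> K (Suc i) \<Longrightarrow> x \<in> T \<Longrightarrow> y x \<in> L T i"
  using subset_sum_left[OF submodule_image_y[OF K_Int_submodule] K_Int_submodule]
  unfolding L_def by blast

lemma K_L: "y_submodule T \<Longrightarrow> x \<in> K (i - 1) \<Longrightarrow> x \<in> T \<Longrightarrow> x \<in> L T i"
  using subset_sum_right[OF submodule_image_y[OF K_Int_submodule] K_Int_submodule]
  unfolding L_def by blast

lemma L_cases:
  assumes "x \<in> L T i"
  obtains u v where "u \<in> K (Suc i)" "u \<in> T" "v \<in> K (i - 1)" "v \<in> T" "x = y u \<oplus> v"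
  using assms unfolding L_def mem_set_add by blast

lemma coset_eq_iff:
  assumes "submodule H R M" "a \<in> carrier M" "b \<in> carrier M"
  shows "H +> a = H +> b \<longleftrightarrow> a \<ominus> b \<in> H"
  using group.rcos_eq_iff[OF M.a_group submodule_subgroup[OF assms(1)]] assms
  by (simp add: a_r_coset_def a_minus_def a_inv_def)

lemma layer_subsetD:
  assumes "layer T i \<subseteq> layer T' i" "x \<in> K i" "x \<in> T"
  obtains b where "b \<in> K i" "b \<in> T'" "x \<ominus> b \<in> L (carrier M) i"
proof -
  have "L (carrier M) i +> x \<in> layer T' i" using assms by (auto simp: layer_def)
  then obtain b where "b \<in> K i" "b \<in> T'" "L (carrier M) i +> x = L (carrier M) i +> b"
    by (auto simp: layer_def)
  then show thesis
    using that coset_eq_iff[OF LM_submodule] assms K_carrier by blast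
qed

text \<open>If $x \in T$ has the form $yu + v$ with $u \in K_{i+1}(M)$ and $v \in K_{i-1}(M)$, then
  $sx = y(su) + sv$ lies in $L_i(T)$ because $su$ and $sv$ lie in \<open>T\<close>. When $Q_i(T)$ has no
  \<open>s\<close>-torsion, already \<open>x\<close> lies in $L_i(T)$.\<close>
lemma saturatedI_torsion:
  assumes T: "y_submodule T" and s: "s \<in> carrier R" "\<And>x. x \<in> carrier M \<Longrightarrow> s \<odot> x \<in> T"
    and tf: "\<And>i x. \<lbrakk>i \<in> {1..l}; x \<in> K i \<inter> T; s \<odot> x \<in> L T i\<rbrakk> \<Longrightarrow> x \<in> L T i"
  shows "saturated T"
  unfolding saturated_def
proof (intro conjI ballI subsetI T)
  fix i x assume i: "i \<in> {1..l}" and x: "x \<in> T \<inter> L (carrier M) i"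
  then obtain u v where uv: "u \<in> K (Suc i)" "v \<in> K (i - 1)" "x = y u \<oplus> v"
    by (auto elim: L_cases)
  have C: "u \<in> carrier M" "v \<in> carrier M" using uv K_memD by blast+
  have "y (s \<odot> u) \<in> L T i"
    using y_L[OF T submodule_smult[OF K_submodule]] s uv C by blast
  moreover have "s \<odot> v \<in> L T i"
    using K_L[OF T submodule_smult[OF K_submodule]] s uv C by blast
  moreover have "s \<odot> x = y (s \<odot> u) \<oplus> s \<odot> v"
    using uv C s by (simp add: y_smult smult_r_distr)
  ultimately have "s \<odot> x \<in> L T i"
    using submodule_add[OF L_submodule[OF T]] by simp
  moreover have "x \<in> K i \<inter> T"
    using x L_subset[OF y_submodule_carrier] i by auto
  ultimately show "x \<in> L T i" using tf i by blast
qed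

text \<open>A submodule whose layers contain those of \<open>S\<close> contains a multiple of \<open>M\<close> by a scalar that does not depend
  on the submodule. From $sK_i(M) \subseteq K_i(S) \subseteq K_i(T) + yK_{i+1}(M) + K_{i-1}(M)$,
  descending induction on $i$ gives $s^{l+1-i} K_i(M) \subseteq T + K_{i-1}(M)$: the summand
  $yK_{i+1}(M)$ is moved into $T + yK_i(M)$ by the previous step. Hence $s^l K_i(M) \subseteq T + K_{i-1}(M)$
  for all $i$, and ascending induction gives $s^{li} K_i(M) \subseteq T$.\<close>
lemma layers_exponent:
  assumes T: "y_submodule T" and s: "s \<in> carrier R" "\<And>x. x \<in> carrier M \<Longrightarrow> s \<odot> x \<in> S"
    and layers: "\<And>i. i \<in> {1..l} \<Longrightarrow> layer S i \<subseteq> layer T i"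
    and x: "x \<in> carrier M"
  shows "(s [^]\<^bsub>R\<^esub> (l * l)) \<odot> x \<in> T"
proof -
  note Ts = y_submodule_submodule[OF T]
  have sp: "s [^]\<^bsub>R\<^esub> (n::nat) \<in> carrier R" for n using s by simp
  have A: "s [^]\<^bsub>R\<^esub> j \<odot> x \<in> T <+> K (l - j)" if "j \<le> l" "x \<in> K (Suc l - j)" for j x
    using that
  proof (induction j arbitrary: x)
    case 0
    then have "x \<in> K l" using K_top[of l] K_memD by auto
    then show ?case
      using subset_sum_right[OF Ts K_submodule, of l] smult_one[of x] K_memD by (simp add: subset_iff)
  next
    case (Suc j)
    define i where "i = l - j"
    have i: "i \<in> {1..l}" "Suc l - Suc j = i" "Suc l - j = Suc i" "l - Suc j = i - 1"
      using Suc.prems by (auto simp: i_def)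
    let ?N = "T <+> K (i - 1)"
    have N: "submodule ?N R M" by (intro submodule_sum Ts K_submodule)
    have TN: "T \<subseteq> ?N" and KN: "K (i - 1) \<subseteq> ?N"
      using subset_sum_left[OF Ts K_submodule] subset_sum_right[OF Ts K_submodule] by auto
    have xC: "x \<in> carrier M" and xK: "x \<in> K i" using Suc.prems i K_memD by blast+
    obtain b where b: "b \<in> K i" "b \<in> T" "s \<odot> x \<ominus> b \<in> L (carrier M) i"
      using layer_subsetD[OF layers[OF i(1)] submodule_smult[OF K_submodule s(1) xK] s(2)[OF xC]] .
    obtain u v where uv: "u \<in> K (Suc i)" "v \<in> K (i - 1)" "s \<odot> x \<ominus> b = y u \<oplus> v"
      using b(3) by (auto elim: L_cases)
    have C: "b \<in> carrier M" "u \<in> carrier M" "v \<in> carrier M" using uv b K_memD by blast+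
    have "u \<in> K (Suc l - j)" using uv(1) i(3) by simp
    then have "s [^]\<^bsub>R\<^esub> j \<odot> u \<in> T <+> K i"
      using Suc.IH[of u] Suc.prems(1) unfolding i_def by simp
    then obtain t q where tq: "t \<in> T" "q \<in> K i" "s [^]\<^bsub>R\<^esub> j \<odot> u = t \<oplus> q"
      by (auto simp: mem_set_add)
    have tqC: "t \<in> carrier M" "q \<in> carrier M" using tq submodule_carrier[OF Ts] K_memD by blast+
    have "y t \<in> ?N" using tq T TN by (auto simp: y_submodule_def)
    moreover have "y q \<in> ?N"
      using y_K[of q "i - 1"] tq i KN by auto
    ultimately have "s [^]\<^bsub>R\<^esub> j \<odot> y u \<in> ?N"
      using submodule_add[OF N] y_smult[OF sp C(2), symmetric] tq(3) y_add[OF tqC] by simp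
    moreover have "s [^]\<^bsub>R\<^esub> j \<odot> v \<in> ?N"
      using submodule_smult[OF N sp] uv KN by blast
    moreover have "s [^]\<^bsub>R\<^esub> j \<odot> b \<in> ?N"
      using submodule_smult[OF N sp] b TN by blast
    moreover have "s [^]\<^bsub>R\<^esub> Suc j \<odot> x = s [^]\<^bsub>R\<^esub> j \<odot> b \<oplus> (s [^]\<^bsub>R\<^esub> j \<odot> y u \<oplus> s [^]\<^bsub>R\<^esub> j \<odot> v)"
    proof -
      have "s \<odot> x = b \<oplus> (y u \<oplus> v)"
        using diff_add_cancel[of "s \<odot> x" b] uv(3) C s xC by simp
      then show ?thesis
        using sp s xC C by (simp add: smult_assoc1 smult_r_distr)
    qed
    ultimately show ?case using submodule_add[OF N] i by simp
  qed
  have A': "s [^]\<^bsub>R\<^esub> l \<odot> x \<in> T <+> K i" if "Suc i \<le> l" "x \<in> K (Suc i)" for i x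
  proof -
    have xC: "x \<in> carrier M" using that K_memD by blast+
    have "l = i + (l - i)" using that by simp
    then have "s [^]\<^bsub>R\<^esub> l = s [^]\<^bsub>R\<^esub> i \<otimes>\<^bsub>R\<^esub> s [^]\<^bsub>R\<^esub> (l - i)"
      using R.nat_pow_mult[OF s(1), of i "l - i"] by simp
    then have "s [^]\<^bsub>R\<^esub> l \<odot> x = s [^]\<^bsub>R\<^esub> i \<odot> (s [^]\<^bsub>R\<^esub> (l - i) \<odot> x)"
      using smult_assoc1[OF sp sp xC] by simp
    moreover have "s [^]\<^bsub>R\<^esub> (l - i) \<odot> x \<in> T <+> K i"
      using A[of "l - i" x] that by (simp add: Suc_diff_le)
    ultimately show ?thesis
      using submodule_smult[OF submodule_sum[OF Ts K_submodule] sp] by simp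
  qed
  have B: "s [^]\<^bsub>R\<^esub> (l * i) \<odot> x \<in> T" if "i \<le> l" "x \<in> K i" for i x
    using that
  proof (induction i arbitrary: x)
    case 0
    then show ?case using submodule_zero[OF Ts] by (simp add: K_0)
  next
    case (Suc i)
    obtain t q where tq: "t \<in> T" "q \<in> K i" "s [^]\<^bsub>R\<^esub> l \<odot> x = t \<oplus> q"
      using A'[OF Suc.prems] by (auto simp: mem_set_add)
    have C: "t \<in> carrier M" "q \<in> carrier M" "x \<in> carrier M"
      using tq Suc.prems submodule_carrier[OF Ts] K_memD by blast+
    have "s [^]\<^bsub>R\<^esub> (l * Suc i) = s [^]\<^bsub>R\<^esub> (l * i) \<otimes>\<^bsub>R\<^esub> s [^]\<^bsub>R\<^esub> l"
      using R.nat_pow_mult[OF s(1), of "l * i" l] by (simp add: add.commute)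
    then have "s [^]\<^bsub>R\<^esub> (l * Suc i) \<odot> x = s [^]\<^bsub>R\<^esub> (l * i) \<odot> t \<oplus> s [^]\<^bsub>R\<^esub> (l * i) \<odot> q"
      using tq C sp by (simp add: smult_assoc1 smult_r_distr)
    then show ?case
      using Suc.IH[OF _ tq(2)] Suc.prems submodule_smult[OF Ts sp tq(1)] submodule_add[OF Ts]
      by simp
  qed
  show ?thesis using B[of l x] x K_top by simp
qed

text \<open>A version of Nakayama's lemma. For saturated \<open>T\<close> the assumption says
  $K_i(T) \subseteq T' + yK_{i+1}(T) + K_{i-1}(T)$. Descending induction on $i$ replaces $K_{i+1}(T)$ by
  $T' + K_i(T)$ and yields $K_i(T) \subseteq T' + K_{i-1}(T)$; ascending induction then yields
  $K_i(T) \subseteq T'$, and $K_l(T) = T$.\<close>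
lemma saturated_minimal:
  assumes T: "saturated T" and T': "y_submodule T'" "T' \<subseteq> T"
    and layers: "\<And>i. i \<in> {1..l} \<Longrightarrow> layer T i \<subseteq> layer T' i"
  shows "T' = T"
proof
  note Ts = y_submodule_submodule[OF T'(1)]
  have yT: "y_submodule T" using T by (simp add: saturated_def)
  have A: "K (Suc l - j) \<inter> T \<subseteq> T' <+> K (l - j)" if "j \<le> l" for j
    using that
  proof (induction j)
    case 0
    have "K (Suc l) \<inter> T \<subseteq> K l" using K_top[of l] K_memD by auto
    also have "\<dots> \<subseteq> T' <+> K l" by (rule subset_sum_right[OF Ts K_submodule])
    finally show ?case by simp
  next
    case (Suc j)
    define i where "i = l - j"
    have i: "i \<in> {1..l}" "Suc l - Suc j = i" "Suc l - j = Suc i" "l - Suc j = i - 1"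
      using Suc.prems by (auto simp: i_def)
    let ?N = "T' <+> K (i - 1)"
    have N: "submodule ?N R M" by (intro submodule_sum Ts K_submodule)
    have TN: "T' \<subseteq> ?N" and KN: "K (i - 1) \<subseteq> ?N"
      using subset_sum_left[OF Ts K_submodule] subset_sum_right[OF Ts K_submodule] by auto
    show ?case
    proof
      fix x assume "x \<in> K (Suc l - Suc j) \<inter> T"
      then have x: "x \<in> K i" "x \<in> T" using i by auto
      obtain b where b: "b \<in> K i" "b \<in> T'" "x \<ominus> b \<in> L (carrier M) i"
        using layer_subsetD[OF layers[OF i(1)] x] .
      have C: "x \<in> carrier M" "b \<in> carrier M" using x b K_memD by blast+
      have "x \<ominus> b \<in> T"
        using submodule_diff[OF y_submodule_submodule[OF yT]] x b T' by blast
      then have "x \<ominus> b \<in> L T i" using T b i by (auto simp: saturated_def)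
      then obtain u v where uv: "u \<in> K (Suc i)" "u \<in> T" "v \<in> K (i - 1)" "x \<ominus> b = y u \<oplus> v"
        by (auto elim: L_cases)
      have "u \<in> K (Suc l - j)" using uv(1) i(3) by simp
      then have "u \<in> T' <+> K i" using Suc.IH Suc.prems(1) uv(2) unfolding i_def by auto
      then obtain t q where tq: "t \<in> T'" "q \<in> K i" "u = t \<oplus> q" by (auto simp: mem_set_add)
      have tqC: "t \<in> carrier M" "q \<in> carrier M" using tq submodule_carrier[OF Ts] K_memD by blast+
      have "y t \<in> ?N" using tq T' TN by (auto simp: y_submodule_def)
      moreover have "y q \<in> ?N" using y_K[of q "i - 1"] tq i KN by auto
      ultimately have "y u \<in> ?N" using submodule_add[OF N] tq(3) y_add[OF tqC] by simp
      then have "x \<ominus> b \<in> ?N" using uv KN submodule_add[OF N] by auto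
      then have "b \<oplus> (x \<ominus> b) \<in> ?N" using b TN submodule_add[OF N] by auto
      then show "x \<in> T' <+> K (l - Suc j)" using diff_add_cancel C i by simp
    qed
  qed
  have B: "K i \<inter> T \<subseteq> T'" if "i \<le> l" for i
    using that
  proof (induction i)
    case 0
    then show ?case using submodule_zero[OF Ts] by (auto simp: K_0)
  next
    case (Suc i)
    show ?case
    proof
      fix x assume x: "x \<in> K (Suc i) \<inter> T"
      then have "x \<in> T' <+> K i" using A[of "l - i"] Suc.prems by (auto simp: Suc_diff_le)
      then obtain t q where tq: "t \<in> T'" "q \<in> K i" "x = t \<oplus> q" by (auto simp: mem_set_add)
      have C: "t \<in> carrier M" "q \<in> carrier M" using tq submodule_carrier[OF Ts] K_memD by blast+
      have "x \<ominus> t \<in> T"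
        using submodule_diff[OF y_submodule_submodule[OF yT]] x tq T' by blast
      then have "q \<in> K i \<inter> T" using tq C by (simp add: add_diff_cancel)
      then show "x \<in> T'" using Suc tq submodule_add[OF Ts] by auto
    qed
  qed
  show "T \<subseteq> T'"
    using B[of l] K_top[of l] submodule_carrier[OF y_submodule_submodule[OF yT]] by auto
qed (use T' in blast)

text \<open>Given submodules $W_i \subseteq K_i(M)$, put $U_{l+1} = 0$ and $U_i = W_i + yU_{i+1}$, the sum of all
  $y^k W_{i+k}$. The recursion descends from $l + 1$, so \<open>generated_layer W j\<close> is $U_{l+1-j}$.
  The sum $U_1 + \dots + U_i$ is \<open>generated W i\<close>, and \<open>generated W l\<close> is the $y$-stable submodule
  generated by all $W_i$.\<close>
primrec generated_layer :: "(nat \<Rightarrow> 'b set) \<Rightarrow> nat \<Rightarrow> 'b set" where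
  "generated_layer W 0 = {\<zero>}"
| "generated_layer W (Suc j) = W (l - j) <+> y ` generated_layer W j"

primrec generated :: "(nat \<Rightarrow> 'b set) \<Rightarrow> nat \<Rightarrow> 'b set" where
  "generated W 0 = {\<zero>}"
| "generated W (Suc i) = generated_layer W (l - i) <+> generated W i"

text \<open>The key point is $U_i \cap K_{i-1}(M) = 0$, by descending induction on $i$: if $w + yu \in K_{i-1}(M)$ with
  $w \in W_i$ and $u \in U_{i+1}$, then $w \in L_i(M)$, so $w = 0$; then $yu \in K_{i-1}(M)$ forces
  $u \in U_{i+1} \cap K_i(M) = 0$. Therefore the elements of \<open>T\<close> that lie in $K_i(M)$ are just
  those of $U_1 + \dots + U_i$, hence of $W_i + L_i(T)$. This determines the layers of \<open>T\<close>, and \<open>T\<close> is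
  saturated because $W_i \cap L_i(M) = 0$.\<close>
lemma generated_saturated:
  assumes W: "\<And>i. i \<in> {1..l} \<Longrightarrow> submodule (W i) R M" "\<And>i. i \<in> {1..l} \<Longrightarrow> W i \<subseteq> K i"
    "\<And>i. i \<in> {1..l} \<Longrightarrow> W i \<inter> L (carrier M) i \<subseteq> {\<zero>}"
  defines "T \<equiv> generated W l"
  shows "saturated T" "\<And>i. i \<in> {1..l} \<Longrightarrow> W i \<subseteq> T"
    "\<And>i. i \<in> {1..l} \<Longrightarrow> layer T i = (\<lambda>a. L (carrier M) i +> a) ` W i"
proof -
  define U where "U i = generated_layer W (Suc l - i)" for i
  have U_top: "U (Suc l) = {\<zero>}" by (simp add: U_def)
  have U: "U i = W i <+> y ` U (Suc i)" if "i \<in> {1..l}" for i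
  proof -
    have "Suc l - i = Suc (l - i)" "l - (l - i) = i" using that by auto
    then show ?thesis by (simp add: U_def)
  qed
  have gen_Suc: "generated W (Suc i) = U (Suc i) <+> generated W i" for i
    by (simp add: U_def)
  have "submodule (U (Suc l - j)) R M \<and> U (Suc l - j) \<subseteq> K (Suc l - j) \<and>
      U (Suc l - j) \<inter> K (l - j) \<subseteq> {\<zero>}" if "j \<le> l" for j
    using that
  proof (induction j)
    case 0
    then show ?case using submodule_singleton_zero K_top[of "Suc l"] by (simp add: U_top)
  next
    case (Suc j)
    define i where "i = l - j"
    have i: "i \<in> {1..l}" "Suc l - Suc j = i" "Suc l - j = Suc i" "l - Suc j = i - 1"
      using Suc.prems by (auto simp: i_def)
    have IH: "submodule (U (Suc i)) R M" "U (Suc i) \<subseteq> K (Suc i)" "U (Suc i) \<inter> K i \<subseteq> {\<zero>}"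
      using Suc.IH Suc.prems unfolding i(3) i_def by auto
    have "submodule (U i) R M"
      using U[OF i(1)] W(1)[OF i(1)] submodule_sum submodule_image_y IH(1) by simp
    moreover have "U i \<subseteq> K i"
      unfolding U[OF i(1)] using W(2)[OF i(1)] IH(2) y_K by (intro sum_subset[OF K_submodule]) auto
    moreover have "U i \<inter> K (i - 1) \<subseteq> {\<zero>}"
    proof
      fix x assume x: "x \<in> U i \<inter> K (i - 1)"
      then obtain w u where wu: "w \<in> W i" "u \<in> U (Suc i)" "x = w \<oplus> y u"
        using U[OF i(1)] by (auto simp: mem_set_add)
      have C: "w \<in> carrier M" "u \<in> carrier M" "x \<in> carrier M"
        using wu x W(2)[OF i(1)] IH K_memD by blast+
      have "w = x \<ominus> y u"
        using wu C by (simp add: M.minus_eq M.a_assoc M.r_neg)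
      moreover have "x \<in> L (carrier M) i"
        using K_L[OF y_submodule_carrier] x C by blast
      moreover have "y u \<in> L (carrier M) i"
        using y_L[OF y_submodule_carrier] wu IH C by blast
      ultimately have "w \<in> L (carrier M) i" using submodule_diff[OF LM_submodule] by simp
      then have w0: "w = \<zero>" using W(3)[OF i(1)] wu by auto
      then have "y u \<in> K (i - 1)" using wu C x by simp
      then have "u \<in> K i" using y_mem_K_iff[of u "i - 1"] C i by simp
      then have "u = \<zero>" using IH wu by auto
      then show "x \<in> {\<zero>}" using w0 wu by simp
    qed
    ultimately show ?case using i by simp
  qed
  note U_all = this
  have U_sub: "submodule (U i) R M" and U_K: "U i \<subseteq> K i" and U_Int: "U i \<inter> K (i - 1) \<subseteq> {\<zero>}"
    if "i \<in> {1..Suc l}" for i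
  proof -
    have "Suc l - i \<le> l" "Suc l - (Suc l - i) = i" "l - (Suc l - i) = i - 1" using that by auto
    then show "submodule (U i) R M" "U i \<subseteq> K i" "U i \<inter> K (i - 1) \<subseteq> {\<zero>}"
      using U_all[of "Suc l - i"] by metis+
  qed
  have gen_sub: "submodule (generated W i) R M" if "i \<le> l" for i
    using that
  proof (induction i)
    case (Suc i)
    then show ?case unfolding gen_Suc using U_sub submodule_sum by simp
  qed (simp add: submodule_singleton_zero)
  have gen_K: "generated W i \<subseteq> K i" if "i \<le> l" for i
    using that
  proof (induction i)
    case (Suc i)
    then show ?case unfolding gen_Suc
      using U_K[of "Suc i"] K_mono[of i "Suc i"] by (intro sum_subset[OF K_submodule]) auto
  qed (simp add: K_0)
  have U_C: "u \<in> carrier M" if "i \<in> {1..Suc l}" "u \<in> U i" for i u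
    using U_K[of i] that K_memD by blast
  have gen_C: "t \<in> carrier M" if "i \<le> l" "t \<in> generated W i" for i t
    using gen_K[of i] that K_memD by blast
  have gen_mono: "generated W i \<subseteq> generated W j" if "i \<le> j" "j \<le> l" for i j
    using that
  proof (induction rule: dec_induct)
    case (step n)
    have "generated W n \<subseteq> generated W (Suc n)"
      unfolding gen_Suc using step subset_sum_right[OF U_sub gen_sub] by simp
    with step show ?case by simp
  qed simp
  have gen_Int: "generated W j \<inter> K i = generated W i" if "i \<le> j" "j \<le> l" for i j
    using that
  proof (induction rule: dec_induct)
    case base
    then show ?case using gen_K by blast
  next
    case (step n)
    have "generated W (Suc n) \<inter> K n \<subseteq> generated W n"
    proof
      fix x assume x: "x \<in> generated W (Suc n) \<inter> K n"
      then obtain u t where ut: "u \<in> U (Suc n)" "t \<in> generated W n" "x = u \<oplus> t"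
        unfolding gen_Suc by (auto simp: mem_set_add)
      have "t \<in> K n" using ut(2) gen_K[of n] step.prems by auto
      then have "x \<ominus> t \<in> K n" using x submodule_diff[OF K_submodule] by blast
      moreover have C: "u \<in> carrier M" "t \<in> carrier M"
        using ut(1,2) U_C[of "Suc n" u] gen_C[of n t] step.prems by simp_all
      moreover have "x \<ominus> t = u" using ut C by (simp add: M.minus_eq M.a_assoc M.r_neg)
      ultimately have "u = \<zero>" using U_Int[of "Suc n"] ut step by auto
      then show "x \<in> generated W n" using ut C by simp
    qed
    then have "generated W (Suc n) \<inter> K n = generated W n"
      using gen_mono[of n "Suc n"] gen_K[of n] step by auto
    then show ?case using step K_mono[of i n] by auto
  qed
  have KT: "K i \<inter> T = generated W i" if "i \<le> l" for i
    using gen_Int[of i l] that by (auto simp: T_def)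
  have T_sub: "submodule T R M" using gen_sub by (simp add: T_def)
  have U_T: "U i \<subseteq> T" if "i \<in> {1..Suc l}" for i
  proof (cases "i = Suc l")
    case True
    then show ?thesis using submodule_zero[OF T_sub] by (simp add: U_top)
  next
    case False
    then obtain n where n: "i = Suc n" "Suc n \<le> l" using False \<open>i \<in> {1..Suc l}\<close> by (cases i) auto
    have "U (Suc n) \<subseteq> generated W (Suc n)"
      unfolding gen_Suc using subset_sum_left[OF U_sub gen_sub] n by simp
    then show ?thesis using gen_mono[of "Suc n" l] n by (auto simp: T_def)
  qed
  have yU: "y ` U i \<subseteq> T" if "i \<in> {1..l}" for i
  proof (cases "i = 1")
    case True
    then have "y ` U i \<subseteq> {\<zero>}" using U_K[of i] that y_K[of _ 0] by (auto simp: K_0)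
    then show ?thesis using submodule_zero[OF T_sub] by auto
  next
    case False
    then obtain n where n: "i = Suc n" "n \<in> {1..l}" using False \<open>i \<in> {1..l}\<close> by (cases i) auto
    then have "y ` U i \<subseteq> U n"
      using U[OF n(2)] subset_sum_right[OF W(1)[OF n(2)] submodule_image_y[OF U_sub]] by auto
    then show ?thesis using U_T[of n] n by auto
  qed
  have "y ` generated W i \<subseteq> T" if "i \<le> l" for i
    using that
  proof (induction i)
    case 0
    then show ?case using submodule_zero[OF T_sub] by simp
  next
    case (Suc i)
    show ?case
    proof
      fix x assume "x \<in> y ` generated W (Suc i)"
      then obtain u t where ut: "u \<in> U (Suc i)" "t \<in> generated W i" "x = y (u \<oplus> t)"
        unfolding gen_Suc by (auto simp: mem_set_add)
      have C: "u \<in> carrier M" "t \<in> carrier M"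
        using ut(1,2) U_C[of "Suc i" u] gen_C[of i t] Suc.prems by simp_all
      have "y u \<in> T" "y t \<in> T" using ut yU[of "Suc i"] Suc by auto
      then show "x \<in> T" using ut y_add[OF C] submodule_add[OF T_sub] by simp
    qed
  qed
  then have T: "y_submodule T" using T_sub by (simp add: y_submodule_def T_def)
  have W_U: "W i \<subseteq> U i" if "i \<in> {1..l}" for i
    using U[OF that] subset_sum_left[OF W(1)[OF that] submodule_image_y[OF U_sub]] that by auto
  then show WT: "W i \<subseteq> T" if "i \<in> {1..l}" for i
    using U_T[of i] that by auto
  have decomp: "\<exists>w\<in>W i. \<exists>z\<in>L T i. x = w \<oplus> z" if i: "i \<in> {1..l}" and x: "x \<in> K i" "x \<in> T" for i x
  proof -
    obtain n where n: "i = Suc n" using i by (cases i) auto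
    have "x \<in> U i <+> generated W n" using KT[of i] x i gen_Suc[of n] n by auto
    then obtain u t where ut: "u \<in> U i" "t \<in> generated W n" "x = u \<oplus> t"
      by (auto simp: mem_set_add)
    obtain w u' where wu: "w \<in> W i" "u' \<in> U (Suc i)" "u = w \<oplus> y u'"
      using ut U[OF i] by (auto simp: mem_set_add)
    have C: "w \<in> carrier M" "u' \<in> carrier M" "t \<in> carrier M"
      using wu(1,2) ut(2) subsetD[OF W(2)[OF i]] U_C[of "Suc i" u'] gen_C[of n t] i n K_memD
      by auto
    have "y u' \<in> L T i" using y_L[OF T] wu U_K[of "Suc i"] U_T[of "Suc i"] i by auto
    moreover have "t \<in> L T i" using K_L[OF T, of t i] KT[of n] ut(2) n i by auto
    ultimately have "y u' \<oplus> t \<in> L T i" using submodule_add[OF L_submodule[OF T]] by blast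
    moreover have "x = w \<oplus> (y u' \<oplus> t)" using ut wu C by (simp add: M.a_assoc)
    ultimately show ?thesis using wu by blast
  qed
  show "saturated T"
    unfolding saturated_def
  proof (intro conjI ballI subsetI T)
    fix i x assume i: "i \<in> {1..l}" and x: "x \<in> T \<inter> L (carrier M) i"
    have "x \<in> K i" using x L_subset[OF y_submodule_carrier] i by auto
    then obtain w z where wz: "w \<in> W i" "z \<in> L T i" "x = w \<oplus> z" using decomp i x by blast
    have zM: "z \<in> L (carrier M) i"
      using wz L_mono[of T "carrier M"] submodule_carrier[OF T_sub] by blast
    have C: "w \<in> carrier M" "z \<in> carrier M"
      using wz W(2)[OF i] zM K_memD submodule_carrier[OF LM_submodule] by blast+
    have "x \<ominus> z = w" using wz C by (simp add: M.minus_eq M.a_assoc M.r_neg)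
    then have "w \<in> L (carrier M) i" using submodule_diff[OF LM_submodule, of x i z] x zM by simp
    then have "w = \<zero>" using W(3)[OF i] wz by auto
    then show "x \<in> L T i" using wz C by simp
  qed
  show "layer T i = (\<lambda>a. L (carrier M) i +> a) ` W i" if i: "i \<in> {1..l}" for i
  proof
    show "(\<lambda>a. L (carrier M) i +> a) ` W i \<subseteq> layer T i"
      using WT[OF i] W(2)[OF i] by (auto simp: layer_def)
    show "layer T i \<subseteq> (\<lambda>a. L (carrier M) i +> a) ` W i"
    proof
      fix C assume "C \<in> layer T i"
      then obtain x where x: "x \<in> K i" "x \<in> T" "C = L (carrier M) i +> x"
        by (auto simp: layer_def)
      obtain w z where wz: "w \<in> W i" "z \<in> L T i" "x = w \<oplus> z" using decomp[OF i x(1,2)] by blast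
      have zM: "z \<in> L (carrier M) i"
        using wz L_mono[of T "carrier M"] submodule_carrier[OF T_sub] by blast
      have c: "w \<in> carrier M" "z \<in> carrier M" "x \<in> carrier M"
        using wz W(2)[OF i] zM x K_memD submodule_carrier[OF LM_submodule] by blast+
      have "x \<ominus> w = z" using wz c by (simp add: add_diff_cancel)
      then have "C = L (carrier M) i +> w"
        using x coset_eq_iff[OF LM_submodule] c zM by simp
      then show "C \<in> (\<lambda>a. L (carrier M) i +> a) ` W i" using wz by blast
    qed
  qed
qed

end

section \<open>Indices of a saturated submodule\<close>

text \<open>The ratios $a_i = k_i / k_{i-1}$ satisfy $a_i = h_i a_{i+1}$ and $a_{l+1} = 1$, hence
  $a_i = h_i \cdots h_l$.\<close>
lemma index_recurrence_solution:
  fixes k h e :: "nat \<Rightarrow> nat"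
  assumes k: "\<And>i. i \<in> {1..l} \<Longrightarrow> k i = h i * e i"
    and e: "\<And>i. i \<in> {1..l} \<Longrightarrow> e i * k i = k (Suc i) * k (i - 1)"
    and "k 0 = 1" "k (Suc l) = k l" and pos: "\<And>i. k i > 0"
    and "i \<le> l"
  shows "k i = (\<Prod>j=1..i. \<Prod>m=j..l. h m)"
proof -
  define a where "a j = (\<Prod>m=j..l. h m)" for j
  have a_Suc: "a j = h j * a (Suc j)" if "j \<le> l" for j
    unfolding a_def by (rule prod.atLeast_Suc_atMost[OF that])
  have ratio: "k (Suc l - n) = a (Suc l - n) * k (l - n)" if "n \<le> l" for n
    using that
  proof (induction n)
    case 0
    then show ?case using assms by (simp add: a_def)
  next
    case (Suc n)
    define j where "j = l - n"
    have j: "j \<in> {1..l}" using Suc.prems by (auto simp: j_def)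
    have IH: "k (Suc j) = a (Suc j) * k j"
      using Suc.IH Suc.prems by (simp add: j_def Suc_diff_le)
    have "k j * k j = h j * (e j * k j)" using k[OF j] by simp
    also have "\<dots> = (a j * k (j - 1)) * k j"
      using e[OF j] IH a_Suc[of j] j by simp
    finally have "k j = a j * k (j - 1)" using pos[of j] by simp
    then show ?case using Suc.prems by (simp add: j_def)
  qed
  have step: "k (Suc n) = a (Suc n) * k n" if "n < l" for n
    using ratio[of "l - n"] that by (simp add: Suc_diff_le)
  have "k i = (\<Prod>j=1..i. a j)"
    using assms(6)
  proof (induction i)
    case (Suc i)
    then show ?case using step[of i] by (simp add: prod.nat_ivl_Suc')
  qed (simp add: assms)
  then show ?thesis by (simp add: a_def)
qed

lemma prod_triangle:
  fixes h :: "nat \<Rightarrow> nat"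
  shows "(\<Prod>j=1..l. \<Prod>m=j..l. h m) = (\<Prod>m=1..l. h m ^ m)"
proof -
  have "(\<Prod>j=1..l. \<Prod>m=j..l. h m) = (\<Prod>(j, m)\<in>(SIGMA j:{1..l}. {j..l}). h m)"
    by (simp add: prod.Sigma)
  also have "\<dots> = (\<Prod>(m, j)\<in>(SIGMA m:{1..l}. {1..m}). h m)"
    by (rule prod.reindex_bij_witness[where i = prod.swap and j = prod.swap]) auto
  also have "\<dots> = (\<Prod>m=1..l. \<Prod>j=1..m. h m)"
    by (rule prod.Sigma[symmetric]) auto
  finally show ?thesis by simp
qed

lemma prod_partial_products_power:
  fixes a r :: "nat \<Rightarrow> nat"
  shows "(\<Prod>i=1..l. (\<Prod>j=1..i. a j) ^ r i) = (\<Prod>j=1..l. a j ^ (\<Sum>i=j..l. r i))"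
proof -
  have "(\<Prod>i=1..l. (\<Prod>j=1..i. a j) ^ r i) = (\<Prod>i=1..l. \<Prod>j=1..i. a j ^ r i)"
    by (simp add: prod_power_distrib)
  also have "\<dots> = (\<Prod>(i, j)\<in>(SIGMA i:{1..l}. {1..i}). a j ^ r i)"
    by (rule prod.Sigma) auto
  also have "\<dots> = (\<Prod>(j, i)\<in>(SIGMA j:{1..l}. {j..l}). a j ^ r i)"
    by (rule prod.reindex_bij_witness[where i = prod.swap and j = prod.swap]) auto
  also have "\<dots> = (\<Prod>j=1..l. \<Prod>i=j..l. a j ^ r i)"
    by (rule prod.Sigma[symmetric]) auto
  finally show ?thesis by (simp add: power_sum)
qed

context nilpotent_endomorphism
begin

abbreviation module_index :: "'b set \<Rightarrow> 'b set \<Rightarrow> nat" where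
  "module_index A B \<equiv> coset_index (add_monoid M) A B"

definition layer_group :: "nat \<Rightarrow> 'b set monoid" where
  "layer_group i = (add_monoid M)\<lparr>carrier := K i\<rparr> Mod L (carrier M) i"

lemma diff_zero: "a \<in> carrier M \<Longrightarrow> a \<ominus> \<zero> = a"
  using diff_add_cancel[of a \<zero>] by simp

lemma add_diff_add_right:
  assumes "u \<in> carrier M" "v \<in> carrier M" "t \<in> carrier M"
  shows "(u \<oplus> t) \<ominus> (v \<oplus> t) = u \<ominus> v"
proof -
  have "u \<oplus> t = (v \<oplus> t) \<oplus> (u \<ominus> v)"
    using assms by (simp add: M.minus_eq M.a_ac M.r_neg M.r_neg1 M.r_neg2)
  then show ?thesis using assms add_diff_cancel[of "u \<ominus> v" "v \<oplus> t"] by simp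
qed

text \<open>Finiteness of all indices below is inherited from one submodule \<open>D\<close> of finite index.\<close>
lemma finite_cosets_mono:
  assumes "submodule D R M" "submodule A R M" "submodule B R M" "D \<inter> A \<subseteq> B"
    and fin: "finite ((\<lambda>a. D +> a) ` carrier M)"
  shows "finite ((\<lambda>a. B +> a) ` A)"
proof -
  have A: "A \<subseteq> carrier M" using assms submodule_carrier by blast
  have "B +> a = B +> a'" if "a \<in> A" "a' \<in> A" "D +> a = D +> a'" for a a'
    using that A assms coset_eq_iff[of D a a'] coset_eq_iff[of B a a'] submodule_diff[of A a a']
    by blast
  then have "B +> a = B +> inv_into A (\<lambda>a. D +> a) (D +> a)" if "a \<in> A" for a
    using that by (metis (mono_tags, lifting) f_inv_into_f image_eqI inv_into_into)
  then have "(\<lambda>a. B +> a) ` A \<subseteq> (\<lambda>C. B +> inv_into A (\<lambda>a. D +> a) C) ` (\<lambda>a. D +> a) ` carrier M"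
    using A by blast
  then show ?thesis using fin finite_surj by blast
qed

lemma module_index_hom:
  assumes A: "submodule A R M" and B: "submodule B R M" "B \<subseteq> A"
    and H: "group H" and f: "f \<in> hom ((add_monoid M)\<lparr>carrier := A\<rparr>) H"
    and fin: "finite ((\<lambda>a. B +> a) ` A)"
  shows "module_index A B = coset_index H (f ` A) (f ` B) *
    module_index {a \<in> A. f a = \<one>\<^bsub>H\<^esub>} (B \<inter> {a \<in> A. f a = \<one>\<^bsub>H\<^esub>})"
proof -
  let ?G = "(add_monoid M)\<lparr>carrier := A\<rparr>"
  have G: "group ?G"
    by (rule subgroup.subgroup_is_group[OF submodule_subgroup[OF A] M.a_group])
  have "subgroup B ?G"
    using group.subgroup_incl[OF M.a_group submodule_subgroup[OF B(1)] submodule_subgroup[OF A] B(2)] .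
  moreover have "coset_index ?G U V = module_index U V" for U V
    by (simp add: coset_index_def r_coset_def)
  moreover have "kernel ?G H f = {a \<in> A. f a = \<one>\<^bsub>H\<^esub>}" by (simp add: kernel_def)
  ultimately show ?thesis
    using coset_index_hom[OF G H f, of B] fin by (simp add: a_r_coset_def r_coset_def)
qed

lemma module_index_tower:
  assumes A: "submodule A R M" and B: "submodule B R M" "B \<subseteq> A"
    and C: "submodule C R M" "C \<subseteq> B"
    and fin: "finite ((\<lambda>a. C +> a) ` A)"
  shows "module_index A C = module_index A B * module_index B C"
proof -
  let ?G = "(add_monoid M)\<lparr>carrier := A\<rparr>"
  have G: "comm_group ?G"
    using submodule.submodule_is_module[OF A module_axioms] by (simp add: module_def abelian_group_def
      abelian_group_axioms_def)
  have "subgroup B ?G" "subgroup C ?G"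
    using group.subgroup_incl[OF M.a_group] submodule_subgroup A B C by blast+
  moreover have "coset_index ?G U V = module_index U V" for U V
    by (simp add: coset_index_def r_coset_def)
  ultimately show ?thesis
    using coset_index_tower[OF G, of B C] C(2) fin by (simp add: a_r_coset_def r_coset_def)
qed

lemma layer_group_normal:
  assumes "i \<in> {1..l}"
  shows "normal (L (carrier M) i) ((add_monoid M)\<lparr>carrier := K i\<rparr>)"
proof -
  have "comm_group ((add_monoid M)\<lparr>carrier := K i\<rparr>)"
    using submodule.submodule_is_module[OF K_submodule module_axioms]
    by (simp add: module_def abelian_group_def abelian_group_axioms_def)
  moreover have "subgroup (L (carrier M) i) ((add_monoid M)\<lparr>carrier := K i\<rparr>)"
    using group.subgroup_incl[OF M.a_group submodule_subgroup[OF LM_submodule]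
        submodule_subgroup[OF K_submodule]] L_subset[OF y_submodule_carrier, of i] assms by auto
  ultimately show ?thesis by (rule comm_group.subgroup_imp_normal)
qed

text \<open>With $k_i = [K_i(M) : K_i(T)]$ and $e_i = [L_i(M) : L_i(T)]$, the projection $K_i(M) \to Q_i(M)$ gives
  $k_i = [Q_i(M) : \overline{Q}_i(T)] \cdot e_i$, since \<open>T\<close> is saturated. The map $y^i$ on $K_{i+1}$
  has kernel $K_i$, and $y^{i-1}$ on $L_i = yK_{i+1} + K_{i-1}$ has kernel $K_{i-1}$. Both have the
  image $y^i K_{i+1}$, for \<open>M\<close> as well as for \<open>T\<close>, so that $k_{i+1} / k_i = e_i / k_{i-1}$.\<close>
lemma saturated_indices:
  assumes T: "saturated T" and D: "submodule D R M" "D \<subseteq> T"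
    and fin: "finite ((\<lambda>a. D +> a) ` carrier M)"
  defines "k \<equiv> \<lambda>i. module_index (K i) (K i \<inter> T)"
    and "e \<equiv> \<lambda>i. module_index (L (carrier M) i) (L T i)"
  shows "\<And>i. i \<in> {1..l} \<Longrightarrow> k i =
      coset_index (layer_group i) ((\<lambda>a. L (carrier M) i +> a) ` K i) (layer T i) * e i"
    and "\<And>i. i \<in> {1..l} \<Longrightarrow> e i * k i = k (Suc i) * k (i - 1)"
    and "k 0 = 1" and "k (Suc l) = k l" and "\<And>i. k i > 0"
proof -
  have yT: "y_submodule T" using T by (simp add: saturated_def)
  note Ts = y_submodule_submodule[OF yT]
  have LT: "L (carrier M) i \<inter> T = L T i" if "i \<in> {1..l}" for i
    using T that L_mono[of T "carrier M" i] submodule_carrier[OF Ts] L_subset[OF yT, of i]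
    by (auto simp: saturated_def)
  have finK: "finite ((\<lambda>a. (K i \<inter> T) +> a) ` K i)" for i
    using finite_cosets_mono[OF D(1) K_submodule K_Int_submodule[OF yT] _ fin] D(2) by blast
  have finL: "finite ((\<lambda>a. L T i +> a) ` L (carrier M) i)" if "i \<in> {1..l}" for i
    using finite_cosets_mono[OF D(1) LM_submodule L_submodule[OF yT] _ fin] D(2) LT[OF that] by blast
  show "k i = coset_index (layer_group i) ((\<lambda>a. L (carrier M) i +> a) ` K i) (layer T i) * e i"
    if i: "i \<in> {1..l}" for i
  proof -
    interpret n: normal "L (carrier M) i" "(add_monoid M)\<lparr>carrier := K i\<rparr>"
      by (rule layer_group_normal[OF i])
    let ?f = "\<lambda>a. L (carrier M) i +> a"
    have f: "?f \<in> hom ((add_monoid M)\<lparr>carrier := K i\<rparr>) (layer_group i)"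
      using n.r_coset_hom_Mod unfolding layer_group_def by (simp add: a_r_coset_def r_coset_def)
    have one: "\<one>\<^bsub>layer_group i\<^esub> = L (carrier M) i" by (simp add: layer_group_def)
    have LK: "L (carrier M) i \<subseteq> K i" using L_subset[OF y_submodule_carrier, of i] i by auto
    have "?f a = L (carrier M) i \<longleftrightarrow> a \<in> L (carrier M) i" if "a \<in> K i" for a
      using coset_eq_iff[OF LM_submodule, of a \<zero> i] K_memD[OF that] submodule_carrier[OF LM_submodule]
      by (simp add: diff_zero)
    then have "{a \<in> K i. ?f a = \<one>\<^bsub>layer_group i\<^esub>} = L (carrier M) i"
      using LK unfolding one by blast
    moreover have "K i \<inter> T \<inter> L (carrier M) i = L T i" using LT[OF i] LK by blast
    moreover have "group (layer_group i)"
      unfolding layer_group_def by (rule n.factorgroup_is_group)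
    ultimately show ?thesis
      using module_index_hom[OF K_submodule K_Int_submodule[OF yT] Int_lower1 _ f finK]
      by (simp add: k_def e_def layer_def)
  qed
  have y_pow_hom: "(y ^^ i) \<in> hom ((add_monoid M)\<lparr>carrier := A\<rparr>) (add_monoid M)"
    if "A \<subseteq> carrier M" for i A
    using that by (auto simp: hom_def y_pow_add subset_iff)
  show "e i * k i = k (Suc i) * k (i - 1)" if i: "i \<in> {1..l}" for i
  proof -
    \<comment> \<open>Both powers of \<open>y\<close> have the same image; this is used for \<open>A = carrier M\<close> and \<open>A = T\<close>.\<close>
    have image: "(y ^^ (i - 1)) ` L A i = (y ^^ i) ` (K (Suc i) \<inter> A)" if A: "y_submodule A" for A
    proof -
      have A0: "\<zero> \<in> K (i - 1) \<inter> A" using submodule_zero[OF K_Int_submodule[OF A]] .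
      have Suc_i: "Suc (i - 1) = i" using i by simp
      have eq: "(y ^^ (i - 1)) (y u \<oplus> v) = (y ^^ i) u" if "u \<in> K (Suc i)" "v \<in> K (i - 1)" for u v
      proof -
        have "(y ^^ (i - 1)) (y u \<oplus> v) = (y ^^ (i - 1)) (y u) \<oplus> \<zero>"
          using that K_memD[of u] K_memD[of v] by (simp add: y_pow_add K_def)
        also have "\<dots> = (y ^^ Suc (i - 1)) u"
          using K_memD[of u] that by (simp add: funpow_swap1)
        finally show ?thesis unfolding Suc_i .
      qed
      show ?thesis
      proof
        show "(y ^^ (i - 1)) ` L A i \<subseteq> (y ^^ i) ` (K (Suc i) \<inter> A)"
          using eq by (auto elim!: L_cases)
        show "(y ^^ i) ` (K (Suc i) \<inter> A) \<subseteq> (y ^^ (i - 1)) ` L A i"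
        proof
          fix x assume "x \<in> (y ^^ i) ` (K (Suc i) \<inter> A)"
          then obtain u where u: "u \<in> K (Suc i)" "u \<in> A" "x = (y ^^ i) u" by auto
          then have "x = (y ^^ (i - 1)) (y u \<oplus> \<zero>)" using eq[of u \<zero>] A0 by simp
          moreover have "y u \<oplus> \<zero> \<in> L A i" using y_L[OF A u(1,2)] K_memD[OF u(1)] by simp
          ultimately show "x \<in> (y ^^ (i - 1)) ` L A i" by blast
        qed
      qed
    qed
    have imageM: "(y ^^ (i - 1)) ` L (carrier M) i = (y ^^ i) ` K (Suc i)"
      using image[OF y_submodule_carrier] K_carrier[of "Suc i"] by (simp add: Int_absorb2)
    have "{a \<in> L (carrier M) i. (y ^^ (i - 1)) a = \<zero>} = K (i - 1)"
    proof
      show "{a \<in> L (carrier M) i. (y ^^ (i - 1)) a = \<zero>} \<subseteq> K (i - 1)"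
        using submodule_carrier[OF LM_submodule] unfolding K_def by blast
      have "a \<in> L (carrier M) i" if "a \<in> K (i - 1)" for a
        using K_L[OF y_submodule_carrier that] K_memD[OF that] by blast
      then show "K (i - 1) \<subseteq> {a \<in> L (carrier M) i. (y ^^ (i - 1)) a = \<zero>}"
        unfolding K_def by blast
    qed
    moreover have "L T i \<inter> K (i - 1) = K (i - 1) \<inter> T"
      using K_L[OF yT] L_subset[OF yT, of i] i by fastforce
    moreover have "e i = module_index ((y ^^ (i - 1)) ` L (carrier M) i) ((y ^^ (i - 1)) ` L T i) *
        module_index {a \<in> L (carrier M) i. (y ^^ (i - 1)) a = \<one>\<^bsub>add_monoid M\<^esub>}
          (L T i \<inter> {a \<in> L (carrier M) i. (y ^^ (i - 1)) a = \<one>\<^bsub>add_monoid M\<^esub>})"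
      unfolding e_def
      by (rule module_index_hom[OF LM_submodule L_submodule[OF yT]
            L_mono[OF submodule_carrier[OF Ts]] M.a_group
            y_pow_hom[OF submodule_carrier[OF LM_submodule]] finL[OF i]])
    ultimately have l: "e i =
        module_index ((y ^^ i) ` K (Suc i)) ((y ^^ i) ` (K (Suc i) \<inter> T)) * k (i - 1)"
      by (simp add: image[OF yT, simplified] imageM[simplified] k_def)
    have "{a \<in> K (Suc i). (y ^^ i) a = \<zero>} = K i"
      using K_mono[of i "Suc i"] by (auto simp: K_def)
    moreover have "K (Suc i) \<inter> T \<inter> K i = K i \<inter> T" using K_mono[of i "Suc i"] by auto
    moreover have "k (Suc i) = module_index ((y ^^ i) ` K (Suc i)) ((y ^^ i) ` (K (Suc i) \<inter> T)) *
        module_index {a \<in> K (Suc i). (y ^^ i) a = \<one>\<^bsub>add_monoid M\<^esub>}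
          (K (Suc i) \<inter> T \<inter> {a \<in> K (Suc i). (y ^^ i) a = \<one>\<^bsub>add_monoid M\<^esub>})"
      unfolding k_def
      by (rule module_index_hom[OF K_submodule K_Int_submodule[OF yT] Int_lower1 M.a_group
            y_pow_hom[OF K_carrier] finK])
    ultimately have "k (Suc i) =
        module_index ((y ^^ i) ` K (Suc i)) ((y ^^ i) ` (K (Suc i) \<inter> T)) * k i"
      by (simp add: k_def)
    then show ?thesis using l by simp
  qed
  show "k 0 = 1" by (simp add: k_def K_0 coset_index_def)
  show "k (Suc l) = k l" by (simp add: k_def K_top)
  show "k i > 0" for i
  proof -
    have "(\<lambda>a. (K i \<inter> T) +> a) ` K i \<noteq> {}" using submodule_zero[OF K_submodule] by blast
    then show ?thesis using finK[of i] by (simp add: k_def coset_index_def a_r_coset_def card_gt_0_iff)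
  qed
qed

section \<open>Counting by lifts of bases\<close>

definition lin_comb :: "(nat \<Rightarrow> 'r) \<Rightarrow> (nat \<Rightarrow> 'b) \<Rightarrow> nat \<Rightarrow> 'b" where
  "lin_comb c v n = (\<Oplus>j\<in>{..<n}. c j \<odot> v j)"

definition lin_span :: "(nat \<Rightarrow> 'b) \<Rightarrow> nat \<Rightarrow> 'b set" where
  "lin_span v n = (\<lambda>c. lin_comb c v n) ` ({..<n} \<rightarrow> carrier R)"

lemma lin_comb_0 [simp]: "lin_comb c v 0 = \<zero>"
  by (simp add: lin_comb_def)

lemma lin_comb_Suc:
  assumes "\<And>j. j \<le> n \<Longrightarrow> c j \<in> carrier R" "\<And>j. j \<le> n \<Longrightarrow> v j \<in> carrier M"
  shows "lin_comb c v (Suc n) = lin_comb c v n \<oplus> c n \<odot> v n"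
proof -
  have "lin_comb c v (Suc n) = c n \<odot> v n \<oplus> lin_comb c v n"
    unfolding lin_comb_def lessThan_Suc using assms by (intro M.finsum_insert) auto
  also have "\<dots> = lin_comb c v n \<oplus> c n \<odot> v n"
    using assms unfolding lin_comb_def by (intro M.a_comm M.finsum_closed) auto
  finally show ?thesis .
qed

lemma lin_comb_mem:
  assumes H: "submodule H R M"
    and "\<And>j. j < n \<Longrightarrow> c j \<in> carrier R" "\<And>j. j < n \<Longrightarrow> v j \<in> H"
  shows "lin_comb c v n \<in> H"
  using assms(2,3)
proof (induction n)
  case 0
  then show ?case using submodule_zero[OF H] by simp
next
  case (Suc n)
  then show ?case
    using submodule_carrier[OF H] submodule_add[OF H] submodule_smult[OF H]
    by (subst lin_comb_Suc) (auto simp: less_Suc_eq_le)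
qed

lemmas lin_comb_closed = lin_comb_mem[OF carrier_is_submodule]

lemma lin_comb_cong_mod:
  assumes H: "submodule H R M"
    and "\<And>j. j < n \<Longrightarrow> c j \<in> carrier R"
    and "\<And>j. j < n \<Longrightarrow> v j \<in> carrier M" "\<And>j. j < n \<Longrightarrow> w j \<in> carrier M"
    and "\<And>j. j < n \<Longrightarrow> v j \<ominus> w j \<in> H"
  shows "lin_comb c v n \<ominus> lin_comb c w n \<in> H"
  using assms(2-)
proof (induction n)
  case 0
  then show ?case using submodule_diff[OF H submodule_zero[OF H] submodule_zero[OF H]] by simp
next
  case (Suc n)
  have C: "lin_comb c v n \<in> carrier M" "lin_comb c w n \<in> carrier M"
    using Suc.prems by (auto intro!: lin_comb_closed)
  have c: "c n \<in> carrier R" "v n \<in> carrier M" "w n \<in> carrier M" "v n \<ominus> w n \<in> H"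
    using Suc.prems by auto
  have e: "lin_comb c v (Suc n) = lin_comb c v n \<oplus> c n \<odot> v n"
    "lin_comb c w (Suc n) = lin_comb c w n \<oplus> c n \<odot> w n"
    using Suc.prems by (auto intro!: lin_comb_Suc simp: less_Suc_eq_le)
  have "lin_comb c v (Suc n) \<ominus> lin_comb c w (Suc n) =
      (lin_comb c v n \<ominus> lin_comb c w n) \<oplus> c n \<odot> (v n \<ominus> w n)"
    unfolding e using C c
    by (simp add: M.minus_eq M.minus_add M.a_ac smult_r_distr smult_r_minus)
  moreover have "lin_comb c v n \<ominus> lin_comb c w n \<in> H" using Suc by auto
  moreover have "c n \<odot> (v n \<ominus> w n) \<in> H" using c submodule_smult[OF H] by blast
  ultimately show ?case using submodule_add[OF H] by simp
qed

lemma lin_comb_add: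
  assumes "\<And>j. j < n \<Longrightarrow> c j \<in> carrier R" "\<And>j. j < n \<Longrightarrow> d j \<in> carrier R"
    and "\<And>j. j < n \<Longrightarrow> v j \<in> carrier M"
  shows "lin_comb (\<lambda>j. c j \<oplus>\<^bsub>R\<^esub> d j) v n = lin_comb c v n \<oplus> lin_comb d v n"
proof -
  have "lin_comb (\<lambda>j. c j \<oplus>\<^bsub>R\<^esub> d j) v n = (\<Oplus>j\<in>{..<n}. c j \<odot> v j \<oplus> d j \<odot> v j)"
    unfolding lin_comb_def using assms by (intro M.finsum_cong') (auto simp: smult_l_distr)
  also have "\<dots> = lin_comb c v n \<oplus> lin_comb d v n"
    unfolding lin_comb_def using assms by (intro M.finsum_addf) auto
  finally show ?thesis .
qed

lemma lin_comb_smult: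
  assumes "a \<in> carrier R" "\<And>j. j < n \<Longrightarrow> c j \<in> carrier R" "\<And>j. j < n \<Longrightarrow> v j \<in> carrier M"
  shows "lin_comb (\<lambda>j. a \<otimes>\<^bsub>R\<^esub> c j) v n = a \<odot> lin_comb c v n"
proof -
  have "a \<odot> lin_comb c v n = (\<Oplus>j\<in>{..<n}. a \<odot> (c j \<odot> v j))"
    unfolding lin_comb_def using assms by (intro finsum_smult_ldistr) auto
  also have "\<dots> = lin_comb (\<lambda>j. a \<otimes>\<^bsub>R\<^esub> c j) v n"
    unfolding lin_comb_def using assms by (intro M.finsum_cong') (auto simp: smult_assoc1)
  finally show ?thesis by simp
qed

lemma lin_comb_zero:
  assumes "\<And>j. j < n \<Longrightarrow> c j = \<zero>\<^bsub>R\<^esub>" "\<And>j. j < n \<Longrightarrow> v j \<in> carrier M"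
  shows "lin_comb c v n = \<zero>"
proof -
  have "lin_comb c v n = (\<Oplus>j\<in>{..<n}. \<zero>)"
    unfolding lin_comb_def using assms by (intro M.finsum_cong') auto
  then show ?thesis by simp
qed

lemma lin_span_submodule:
  assumes v: "\<And>j. j < n \<Longrightarrow> v j \<in> carrier M"
  shows "submodule (lin_span v n) R M"
proof (rule submoduleI)
  show "lin_span v n \<subseteq> carrier M"
    using v by (auto simp: lin_span_def intro!: lin_comb_closed)
  show "\<zero> \<in> lin_span v n"
    using lin_comb_zero[of n "\<lambda>_. \<zero>\<^bsub>R\<^esub>" v] v by (force simp: lin_span_def)
  show "x \<oplus> z \<in> lin_span v n" if "x \<in> lin_span v n" "z \<in> lin_span v n" for x z
  proof -
    obtain c d where "c \<in> {..<n} \<rightarrow> carrier R" "d \<in> {..<n} \<rightarrow> carrier R"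
      "x = lin_comb c v n" "z = lin_comb d v n" using \<open>x \<in> _\<close> \<open>z \<in> _\<close> by (auto simp: lin_span_def)
    moreover from this have "lin_comb (\<lambda>j. c j \<oplus>\<^bsub>R\<^esub> d j) v n = lin_comb c v n \<oplus> lin_comb d v n"
      using v by (intro lin_comb_add) auto
    ultimately show ?thesis
      unfolding lin_span_def by (intro image_eqI[where x = "\<lambda>j. c j \<oplus>\<^bsub>R\<^esub> d j"]) auto
  qed
  show sm: "a \<odot> x \<in> lin_span v n" if "a \<in> carrier R" "x \<in> lin_span v n" for a x
  proof -
    obtain c where "c \<in> {..<n} \<rightarrow> carrier R" "x = lin_comb c v n"
      using \<open>x \<in> _\<close> by (auto simp: lin_span_def)
    moreover from this have "lin_comb (\<lambda>j. a \<otimes>\<^bsub>R\<^esub> c j) v n = a \<odot> lin_comb c v n"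
      using v \<open>a \<in> carrier R\<close> by (intro lin_comb_smult) auto
    ultimately show ?thesis
      using \<open>a \<in> carrier R\<close> unfolding lin_span_def
      by (intro image_eqI[where x = "\<lambda>j. a \<otimes>\<^bsub>R\<^esub> c j"]) auto
  qed
  show "\<ominus> x \<in> lin_span v n" if "x \<in> lin_span v n" for x
  proof -
    have "x \<in> carrier M" using that v by (auto simp: lin_span_def intro!: lin_comb_closed)
    then have "\<ominus> x = (\<ominus>\<^bsub>R\<^esub> \<one>\<^bsub>R\<^esub>) \<odot> x" by (simp add: smult_l_minus)
    then show ?thesis using sm[OF _ that, of "\<ominus>\<^bsub>R\<^esub> \<one>\<^bsub>R\<^esub>"] by simp
  qed
qed

lemma mem_lin_span:
  assumes v: "\<And>j. j < n \<Longrightarrow> v j \<in> carrier M" and "j < n"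
  shows "v j \<in> lin_span v n"
proof -
  let ?c = "\<lambda>i. if i = j then \<one>\<^bsub>R\<^esub> else \<zero>\<^bsub>R\<^esub>"
  have "lin_comb ?c v n = (\<Oplus>i\<in>{..<n}. if j = i then v i else \<zero>)"
    unfolding lin_comb_def using v by (intro M.finsum_cong') auto
  also have "\<dots> = v j" using assms by (intro M.finsum_singleton) auto
  finally show ?thesis
    unfolding lin_span_def by (intro image_eqI[where x = ?c]) auto
qed

lemma coset_shift:
  assumes H: "submodule H R M" and "u \<in> carrier M" "v \<in> carrier M" "t \<in> carrier M"
  shows "H +> (u \<oplus> t) = H +> (v \<oplus> t) \<longleftrightarrow> H +> u = H +> v"
  using assms coset_eq_iff[OF H] add_diff_add_right by simp

lemma coset_subset_iff:
  assumes H: "submodule H R M" and T: "submodule T R M" "H \<subseteq> T" and u: "u \<in> carrier M"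
  shows "H +> u \<subseteq> T \<longleftrightarrow> u \<in> T"
proof
  assume "H +> u \<subseteq> T"
  moreover have "\<zero> \<oplus> u \<in> H +> u"
    using submodule_zero[OF H] unfolding a_r_coset_def' by blast
  ultimately show "u \<in> T" using u by auto
next
  assume "u \<in> T"
  then show "H +> u \<subseteq> T"
    using T submodule_add[OF T(1)] unfolding a_r_coset_def' by blast
qed

lemma card_translated_cosets:
  assumes "submodule H R M" "A \<subseteq> carrier M" "t \<in> carrier M"
  shows "card ((\<lambda>x. H +> (x \<oplus> t)) ` A) = module_index A H"
  unfolding coset_index_def a_r_coset_def[symmetric]
  using assms by (intro card_image_eq_if_same_kernel coset_shift) auto

text \<open>For every choice of $t_{ij} \in b_{ij} + L_i(M)$ there is exactly one good \<open>T\<close> that contains all $t_{ij}$: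
  the spans of the $t_{ij}$ for fixed $i$ satisfy the assumptions of \<open>generated_saturated\<close>,
  which gives existence; if $T_1$ and $T_2$ are two candidates, then $T_1 \cap T_2$ has the
  same layers, so \<open>saturated_minimal\<close> gives $T_1 = T_1 \cap T_2 = T_2$. Conversely, for a good \<open>T\<close> the
  admissible $t_{ij}$ in \<open>T\<close> form a coset of $L_i(T)$, which has index $e_i$ in $L_i(M)$. So the
  choices are divided into classes, one for each \<open>T\<close>, each of which makes up the fraction
  $\prod_i e_i^{-r_i}$ of all choices.

  To make this a count of finite sets, every $t_{ij}$ is replaced by its coset modulo
  $E_i = D \cap L_i(M)$, where \<open>D\<close> has finite index and is contained in all good \<open>T\<close>; whether \<open>T\<close>
  contains $t_{ij}$ depends only on this coset.\<close>
lemma card_saturated_same_layers: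
  fixes S :: "'b set" and b :: "nat \<Rightarrow> nat \<Rightarrow> 'b" and r e :: "nat \<Rightarrow> nat"
  defines "good \<equiv> {T. saturated T \<and> (\<forall>i\<in>{1..l}. layer T i = layer S i)}"
  assumes S: "saturated S"
    and D: "submodule D R M" "\<And>T. T \<in> good \<Longrightarrow> D \<subseteq> T"
    and fin: "finite ((\<lambda>a. D +> a) ` carrier M)"
    and b: "\<And>i j. i \<in> {1..l} \<Longrightarrow> j < r i \<Longrightarrow> b i j \<in> K i \<inter> S"
    and gen: "\<And>i x. i \<in> {1..l} \<Longrightarrow> x \<in> K i \<inter> S \<Longrightarrow>
        \<exists>c\<in>{..<r i} \<rightarrow> carrier R. x \<ominus> lin_comb c (b i) (r i) \<in> L S i"
    and ind: "\<And>i c j. \<lbrakk>i \<in> {1..l}; c \<in> {..<r i} \<rightarrow> carrier R; lin_comb c (b i) (r i) \<in> L S i; j < r i\<rbrakk>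
        \<Longrightarrow> c j = \<zero>\<^bsub>R\<^esub>"
    and e: "\<And>T i. T \<in> good \<Longrightarrow> i \<in> {1..l} \<Longrightarrow> module_index (L (carrier M) i) (L T i) = e i"
  shows "card good = (\<Prod>i=1..l. e i ^ r i)"
proof -
  have yS: "y_submodule S" using S by (simp add: saturated_def)
  define E where "E i = D \<inter> L (carrier M) i" for i
  have E: "submodule (E i) R M" for i
    unfolding E_def by (intro submodule_Int D LM_submodule)
  have LM_C: "L (carrier M) i \<subseteq> carrier M" for i
    by (rule submodule_carrier[OF LM_submodule])
  have good_sub: "submodule T R M" "y_submodule T" if "T \<in> good" for T
    using that y_submodule_submodule by (auto simp: good_def saturated_def)
  have E_good: "E i \<subseteq> T" if "T \<in> good" for i T
    using D(2)[OF that] by (auto simp: E_def)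
  have E_L: "E i \<subseteq> L T i" if "T \<in> good" "i \<in> {1..l}" for i T
    using D(2)[OF that(1)] that unfolding E_def good_def saturated_def by blast
  have finE: "finite ((\<lambda>a. E i +> a) ` L (carrier M) i)" for i
    using finite_cosets_mono[OF D(1) LM_submodule E _ fin] by (auto simp: E_def)
  have bC: "b i j \<in> carrier M" "b i j \<in> K i" "b i j \<in> S" if "i \<in> {1..l}" "j < r i" for i j
    using b[OF that] K_memD by auto
  define J where "J = (SIGMA i:{1..l}. {..<r i})"
  have J: "finite J" by (simp add: J_def)
  define cosets where "cosets = (\<lambda>(i, j). (\<lambda>x. E i +> (x \<oplus> b i j)) ` L (carrier M) i)"
  define in_cosets where "in_cosets T = (\<lambda>p. {C \<in> cosets p. C \<subseteq> T})" for T
  have card_cosets: "card (cosets (i, j)) = module_index (L (carrier M) i) (E i)"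
    if "(i, j) \<in> J" for i j
    unfolding cosets_def using card_translated_cosets[OF E LM_C] bC that by (auto simp: J_def)
  have fin_cosets: "finite (cosets p)" if "p \<in> J" for p
  proof -
    obtain i j where p: "p = (i, j)" by (cases p)
    have "cosets p = (\<lambda>C. C <+> {b i j}) ` (\<lambda>a. E i +> a) ` L (carrier M) i"
    proof -
      have "E i +> (x \<oplus> b i j) = (E i +> x) <+> {b i j}" if "x \<in> L (carrier M) i" for x
        using that LM_C submodule_carrier[OF E] bC \<open>p \<in> J\<close>
        by (auto simp: p J_def a_r_coset_def' set_add_def' M.a_assoc subset_iff)
      then show ?thesis by (auto simp: p cosets_def image_image)
    qed
    then show ?thesis using finE by simp
  qed
  have card_in_cosets: "card (in_cosets T (i, j)) = module_index (L T i) (E i)"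
    if T: "T \<in> good" and ij: "(i, j) \<in> J" for T i j
  proof -
    have i: "i \<in> {1..l}" "j < r i" using ij by (auto simp: J_def)
    have LT: "L T i \<subseteq> L (carrier M) i"
      using L_mono submodule_carrier[OF good_sub(1)[OF T]] .
    have "layer S i \<subseteq> layer T i" using T i by (auto simp: good_def)
    then obtain t where t: "t \<in> K i" "t \<in> T" "b i j \<ominus> t \<in> L (carrier M) i"
      using layer_subsetD bC[OF i] by metis
    have tC: "t \<in> carrier M" using t K_memD by blast
    \<comment> \<open>Since \<open>T\<close> has the layers of \<open>S\<close>, the translate meets \<open>T\<close> in some \<open>t\<close>; the part
    of the translate in \<open>T\<close> is \<open>t + L_i(T)\<close>.\<close>
    have "in_cosets T (i, j) = (\<lambda>x. E i +> (x \<oplus> t)) ` L T i"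
    proof
      show "in_cosets T (i, j) \<subseteq> (\<lambda>x. E i +> (x \<oplus> t)) ` L T i"
      proof
        fix C assume "C \<in> in_cosets T (i, j)"
        then obtain x where x: "x \<in> L (carrier M) i" "C = E i +> (x \<oplus> b i j)" "C \<subseteq> T"
          by (auto simp: in_cosets_def cosets_def)
        have xC: "x \<in> carrier M" using x LM_C by blast
        have "x \<oplus> b i j \<in> T"
          using coset_subset_iff[OF E good_sub(1)[OF T] E_good[OF T]] x xC bC[OF i] by simp
        then have "(x \<oplus> b i j) \<ominus> t \<in> T" using submodule_diff[OF good_sub(1)[OF T]] t by blast
        moreover have "(x \<oplus> b i j) \<ominus> t = x \<oplus> (b i j \<ominus> t)"
          using xC bC[OF i] tC by (simp add: M.minus_eq M.a_assoc)
        ultimately have "x \<oplus> (b i j \<ominus> t) \<in> T \<inter> L (carrier M) i"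
          using submodule_add[OF LM_submodule x(1) t(3)] by simp
        then have "x \<oplus> (b i j \<ominus> t) \<in> L T i" using T i by (auto simp: good_def saturated_def)
        moreover have "C = E i +> ((x \<oplus> (b i j \<ominus> t)) \<oplus> t)"
          using x(2) xC bC[OF i] tC by (simp add: M.minus_eq M.a_assoc M.l_neg)
        ultimately show "C \<in> (\<lambda>x. E i +> (x \<oplus> t)) ` L T i" by blast
      qed
      show "(\<lambda>x. E i +> (x \<oplus> t)) ` L T i \<subseteq> in_cosets T (i, j)"
      proof
        fix C assume "C \<in> (\<lambda>x. E i +> (x \<oplus> t)) ` L T i"
        then obtain x where x: "x \<in> L T i" "C = E i +> (x \<oplus> t)" by blast
        have xC: "x \<in> carrier M" using x LT LM_C by blast
        have "x \<ominus> (b i j \<ominus> t) \<in> L (carrier M) i"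
          using submodule_diff[OF LM_submodule] x LT t by blast
        moreover have "x \<oplus> t = (x \<ominus> (b i j \<ominus> t)) \<oplus> b i j"
          using xC bC[OF i] tC by (simp add: M.minus_eq M.minus_add M.a_ac M.r_neg M.l_neg)
        ultimately have "C \<in> cosets (i, j)" using x(2) by (auto simp: cosets_def)
        moreover have "x \<oplus> t \<in> T"
          using submodule_add[OF good_sub(1)[OF T]] x L_subset[OF good_sub(2)[OF T], of i] i t by auto
        ultimately show "C \<in> in_cosets T (i, j)"
          using coset_subset_iff[OF E good_sub(1)[OF T] E_good[OF T]] x xC tC
          by (simp add: in_cosets_def)
      qed
    qed
    then show ?thesis
      using card_translated_cosets[OF E subset_trans[OF LT LM_C] tC] by simp
  qed
  have unique: "\<exists>!T. T \<in> good \<and> (\<forall>p\<in>J. \<phi> p \<subseteq> T)" if \<phi>: "\<phi> \<in> Pi\<^sub>E J cosets" for \<phi>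
  proof -
    have "\<exists>x. x \<in> L (carrier M) i \<and> \<phi> (i, j) = E i +> (x \<oplus> b i j)" if "i \<in> {1..l}" "j < r i" for i j
      using PiE_mem[OF \<phi>, of "(i, j)"] that by (auto simp: J_def cosets_def)
    then obtain x where x: "\<And>i j. i \<in> {1..l} \<Longrightarrow> j < r i \<Longrightarrow>
        x i j \<in> L (carrier M) i \<and> \<phi> (i, j) = E i +> (x i j \<oplus> b i j)" by metis
    define t where "t i j = x i j \<oplus> b i j" for i j
    have t: "t i j \<in> carrier M" "t i j \<in> K i" "t i j \<ominus> b i j \<in> L (carrier M) i"
      "\<phi> (i, j) = E i +> t i j" if "i \<in> {1..l}" "j < r i" for i j
    proof -
      have xL: "x i j \<in> L (carrier M) i" and "\<phi> (i, j) = E i +> (x i j \<oplus> b i j)"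
        using x that by auto
      then show "\<phi> (i, j) = E i +> t i j" by (simp add: t_def)
      have "x i j \<in> K i" using L_subset[OF y_submodule_carrier, of i] xL that by auto
      then show tK: "t i j \<in> K i"
        unfolding t_def using submodule_add[OF K_submodule] bC[OF that] by blast
      then show "t i j \<in> carrier M" by (rule K_memD)
      have "x i j \<in> carrier M" using xL LM_C by blast
      then have "t i j \<ominus> b i j = x i j"
        using bC[OF that] by (simp add: t_def M.minus_eq M.a_assoc M.r_neg)
      then show "t i j \<ominus> b i j \<in> L (carrier M) i" using xL by simp
    qed
    define W where "W i = lin_span (t i) (r i)" for i
    have W_sub: "submodule (W i) R M" if "i \<in> {1..l}" for i
      unfolding W_def using t that by (intro lin_span_submodule) auto
    have W_K: "W i \<subseteq> K i" if "i \<in> {1..l}" for i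
      unfolding W_def lin_span_def using t that by (auto intro!: lin_comb_mem[OF K_submodule])
    have tW: "t i j \<in> W i" if "i \<in> {1..l}" "j < r i" for i j
      unfolding W_def using t that by (intro mem_lin_span) auto
    have diff: "lin_comb c (t i) (r i) \<ominus> lin_comb c (b i) (r i) \<in> L (carrier M) i"
      if "i \<in> {1..l}" "c \<in> {..<r i} \<rightarrow> carrier R" for i c
      using that t bC by (intro lin_comb_cong_mod[OF LM_submodule]) auto
    have lc_C: "lin_comb c (t i) (r i) \<in> carrier M" "lin_comb c (b i) (r i) \<in> carrier M"
      "lin_comb c (b i) (r i) \<in> K i \<inter> S"
      if "i \<in> {1..l}" "c \<in> {..<r i} \<rightarrow> carrier R" for i c
      using that t bC by (auto intro!: lin_comb_closed lin_comb_mem[OF K_submodule]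
          lin_comb_mem[OF y_submodule_submodule[OF yS]])
    have W_L: "W i \<inter> L (carrier M) i \<subseteq> {\<zero>}" if i: "i \<in> {1..l}" for i
    proof
      fix w assume w: "w \<in> W i \<inter> L (carrier M) i"
      then obtain c where c: "c \<in> {..<r i} \<rightarrow> carrier R" "w = lin_comb c (t i) (r i)"
        by (auto simp: W_def lin_span_def)
      let ?v = "lin_comb c (b i) (r i)"
      have "w \<ominus> (w \<ominus> ?v) \<in> L (carrier M) i"
        using submodule_diff[OF LM_submodule] w diff[OF i c(1)] c(2) by blast
      moreover have "w \<ominus> (w \<ominus> ?v) = ?v"
        using lc_C[OF i c(1)] c(2) by (simp add: M.minus_eq M.minus_add M.a_ac M.r_neg M.l_neg)
      ultimately have "?v \<in> L S i"
        using S lc_C(3)[OF i c(1)] i by (auto simp: saturated_def)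
      then have "\<And>j. j < r i \<Longrightarrow> c j = \<zero>\<^bsub>R\<^esub>" using ind[OF i c(1)] by blast
      then have "w = \<zero>" unfolding c(2) using t i by (intro lin_comb_zero) auto
      then show "w \<in> {\<zero>}" by simp
    qed
    have W_layer: "(\<lambda>a. L (carrier M) i +> a) ` W i = layer S i" if i: "i \<in> {1..l}" for i
    proof
      have eq: "L (carrier M) i +> lin_comb c (t i) (r i) = L (carrier M) i +> lin_comb c (b i) (r i)"
        if "c \<in> {..<r i} \<rightarrow> carrier R" for c
        using coset_eq_iff[OF LM_submodule] diff[OF i that] lc_C[OF i that] by blast
      then show "(\<lambda>a. L (carrier M) i +> a) ` W i \<subseteq> layer S i"
        using lc_C(3)[OF i] by (auto simp: W_def lin_span_def layer_def)
      show "layer S i \<subseteq> (\<lambda>a. L (carrier M) i +> a) ` W i"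
      proof
        fix C assume "C \<in> layer S i"
        then obtain u where u: "u \<in> K i \<inter> S" "C = L (carrier M) i +> u" by (auto simp: layer_def)
        obtain c where c: "c \<in> {..<r i} \<rightarrow> carrier R" "u \<ominus> lin_comb c (b i) (r i) \<in> L S i"
          using gen[OF i u(1)] by blast
        have "u \<ominus> lin_comb c (b i) (r i) \<in> L (carrier M) i"
          using c(2) L_mono[OF submodule_carrier[OF y_submodule_submodule[OF yS]]] by blast
        then have "C = L (carrier M) i +> lin_comb c (b i) (r i)"
          using coset_eq_iff[OF LM_submodule] lc_C[OF i c(1)] u K_memD by blast
        then show "C \<in> (\<lambda>a. L (carrier M) i +> a) ` W i"
          using eq[OF c(1)] c(1) by (auto simp: W_def lin_span_def)
      qed
    qed
    have mem_iff: "(\<forall>p\<in>J. \<phi> p \<subseteq> T) \<longleftrightarrow> (\<forall>i\<in>{1..l}. \<forall>j<r i. t i j \<in> T)" if T: "T \<in> good" for T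
      using coset_subset_iff[OF E good_sub(1)[OF T] E_good[OF T]] t by (auto simp: J_def)
    have W_subset: "W i \<subseteq> T" if "T \<in> good" "\<forall>p\<in>J. \<phi> p \<subseteq> T" "i \<in> {1..l}" for T i
    proof -
      have "t i j \<in> T" if "j < r i" for j
        using mem_iff[OF \<open>T \<in> good\<close>] \<open>\<forall>p\<in>J. \<phi> p \<subseteq> T\<close> \<open>i \<in> {1..l}\<close> that by blast
      then show ?thesis
        unfolding W_def lin_span_def
        by (auto intro!: lin_comb_mem[OF good_sub(1)[OF \<open>T \<in> good\<close>]])
    qed
    show ?thesis
    proof (rule ex_ex1I)
      let ?T = "generated W l"
      note gen_sat = generated_saturated[OF W_sub W_K W_L]
      have "?T \<in> good" using gen_sat(1,3) W_layer by (simp add: good_def)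
      moreover have "\<forall>i\<in>{1..l}. \<forall>j<r i. t i j \<in> ?T" using gen_sat(2) tW by blast
      ultimately show "\<exists>T. T \<in> good \<and> (\<forall>p\<in>J. \<phi> p \<subseteq> T)" using mem_iff[of ?T] by blast
    next
      fix T1 T2
      assume T12: "T1 \<in> good \<and> (\<forall>p\<in>J. \<phi> p \<subseteq> T1)" "T2 \<in> good \<and> (\<forall>p\<in>J. \<phi> p \<subseteq> T2)"
      have Int: "y_submodule (T1 \<inter> T2)" 
        using good_sub(2)[of T1] good_sub(2)[of T2] T12 by (intro y_submodule_Int) auto
      have lay: "layer S i \<subseteq> layer (T1 \<inter> T2) i" if "i \<in> {1..l}" for i
      proof -
        have "W i \<subseteq> K i \<inter> (T1 \<inter> T2)"
          using W_K[OF that] W_subset[of T1 i] W_subset[of T2 i] T12 that by simp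
        then show ?thesis
          unfolding W_layer[OF that, symmetric] layer_def[of "T1 \<inter> T2"] by (rule image_mono)
      qed
      have "T1 \<inter> T2 = T1"
        by (rule saturated_minimal[OF _ Int]) (use T12 lay in \<open>simp_all add: good_def\<close>)
      moreover have "T1 \<inter> T2 = T2"
        by (rule saturated_minimal[OF _ Int]) (use T12 lay in \<open>simp_all add: good_def\<close>)
      ultimately show "T1 = T2" by simp
    qed
  qed
  define \<tau> where "\<tau> \<phi> = (THE T. T \<in> good \<and> (\<forall>p\<in>J. \<phi> p \<subseteq> T))" for \<phi>
  have \<tau>: "\<tau> \<phi> \<in> good" "\<And>p. p \<in> J \<Longrightarrow> \<phi> p \<subseteq> \<tau> \<phi>"
    "\<And>T. T \<in> good \<Longrightarrow> (\<And>p. p \<in> J \<Longrightarrow> \<phi> p \<subseteq> T) \<Longrightarrow> \<tau> \<phi> = T" if "\<phi> \<in> Pi\<^sub>E J cosets" for \<phi>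
    using theI'[OF unique[OF that]] the1_equality[OF unique[OF that]] unfolding \<tau>_def by blast+
  have fibre: "{\<phi> \<in> Pi\<^sub>E J cosets. \<tau> \<phi> = T} = Pi\<^sub>E J (in_cosets T)" if T: "T \<in> good" for T
  proof (intro equalityI subsetI)
    fix \<phi> assume "\<phi> \<in> {\<phi> \<in> Pi\<^sub>E J cosets. \<tau> \<phi> = T}"
    then show "\<phi> \<in> Pi\<^sub>E J (in_cosets T)"
      using \<tau>(2)[of \<phi>] by (auto simp: PiE_iff in_cosets_def)
  next
    fix \<phi> assume a: "\<phi> \<in> Pi\<^sub>E J (in_cosets T)"
    then have "\<phi> \<in> Pi\<^sub>E J cosets" "\<And>p. p \<in> J \<Longrightarrow> \<phi> p \<subseteq> T"
      by (auto simp: PiE_iff in_cosets_def)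
    then show "\<phi> \<in> {\<phi> \<in> Pi\<^sub>E J cosets. \<tau> \<phi> = T}" using \<tau>(3) T by blast
  qed
  have index_E: "module_index (L (carrier M) i) (E i) = e i * module_index (L T i) (E i)"
    "module_index (L T i) (E i) > 0" if "T \<in> good" "i \<in> {1..l}" for T i
  proof -
    have LT: "submodule (L T i) R M" "L T i \<subseteq> L (carrier M) i"
      using L_submodule L_mono good_sub[OF that(1)] submodule_carrier by blast+
    show "module_index (L (carrier M) i) (E i) = e i * module_index (L T i) (E i)"
      using module_index_tower[OF LM_submodule LT E E_L[OF that] finE] e[OF that] by simp
    have "finite ((\<lambda>a. E i +> a) ` L T i)" 
      by (rule finite_subset[OF image_mono[OF LT(2)] finE])
    then show "module_index (L T i) (E i) > 0"
      using submodule_zero[OF LT(1)] by (auto simp: coset_index_def a_r_coset_def card_gt_0_iff)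
  qed
  have card_J: "(\<Prod>p\<in>J. f (fst p)) = (\<Prod>i=1..l. f i ^ r i)" for f :: "nat \<Rightarrow> nat"
  proof -
    have "(\<Prod>i=1..l. f i ^ r i) = (\<Prod>i=1..l. \<Prod>j<r i. f i)" by simp
    also have "\<dots> = (\<Prod>(i, j)\<in>J. f i)" unfolding J_def by (rule prod.Sigma) auto
    finally show ?thesis by (simp add: case_prod_beta)
  qed
  have S_good: "S \<in> good" using S by (simp add: good_def)
  define n where "n = (\<Prod>i=1..l. module_index (L S i) (E i) ^ r i)"
  have n: "card (Pi\<^sub>E J (in_cosets T)) = n" if T: "T \<in> good" for T
  proof -
    have same: "module_index (L T i) (E i) = module_index (L S i) (E i)" if "i \<in> {1..l}" for i
    proof -
      have "module_index (L (carrier M) i) (E i) > 0"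
        using submodule_zero[OF LM_submodule] finE[of i]
        by (auto simp: coset_index_def a_r_coset_def card_gt_0_iff)
      then show ?thesis using index_E(1)[OF T that] index_E(1)[OF S_good that] by simp
    qed
    have "card (Pi\<^sub>E J (in_cosets T)) = (\<Prod>p\<in>J. card (in_cosets T p))" by (rule card_PiE[OF J])
    also have "\<dots> = (\<Prod>p\<in>J. module_index (L S (fst p)) (E (fst p)))"
      using card_in_cosets[OF T] same by (intro prod.cong) (auto simp: J_def)
    finally show ?thesis unfolding n_def card_J[symmetric] .
  qed
  have n_pos: "n > 0" unfolding n_def using index_E(2)[OF S_good] by (intro prod_pos) simp
  have fin_tuples: "finite (Pi\<^sub>E J cosets)" using J fin_cosets by (intro finite_PiE) auto
  have image: "\<tau> ` Pi\<^sub>E J cosets = good"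
  proof
    show "\<tau> ` Pi\<^sub>E J cosets \<subseteq> good" using \<tau>(1) by blast
    show "good \<subseteq> \<tau> ` Pi\<^sub>E J cosets"
    proof
      fix T assume T: "T \<in> good"
      then have "Pi\<^sub>E J (in_cosets T) \<noteq> {}" using n[OF T] n_pos by auto
      then show "T \<in> \<tau> ` Pi\<^sub>E J cosets" using fibre[OF T] by blast
    qed
  qed
  have "card (Pi\<^sub>E J cosets) = (\<Sum>T\<in>good. card {\<phi> \<in> Pi\<^sub>E J cosets. \<tau> \<phi> = T})"
    using sum.image_gen[OF fin_tuples, of "\<lambda>_. 1::nat" \<tau>] image by simp
  also have "\<dots> = card good * n" using fibre n by simp
  finally have "card (Pi\<^sub>E J cosets) = card good * n" .
  moreover have "card (Pi\<^sub>E J cosets) = (\<Prod>p\<in>J. module_index (L (carrier M) (fst p)) (E (fst p)))"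
    unfolding card_PiE[OF J] using card_cosets by (intro prod.cong) auto
  moreover have "\<dots> = (\<Prod>i=1..l. e i ^ r i) * n"
    unfolding card_J[of "\<lambda>i. module_index (L (carrier M) i) (E i)"] n_def prod.distrib[symmetric] power_mult_distrib[symmetric]
    using index_E(1)[OF S_good] by (intro prod.cong) auto
  ultimately show ?thesis using n_pos by simp
qed

end

context nilpotent_endomorphism
begin

section \<open>The modules $Q_i$\<close>

text \<open>For \<open>T = carrier M\<close> this is $Q_i(M)$.\<close>
definition Q :: "'b set \<Rightarrow> nat \<Rightarrow> ('r, 'b set) module" where
  "Q T i = quotient_module (M\<lparr>carrier := K i \<inter> T\<rparr>) (L T i)"

definition Q_hom :: "'b set \<Rightarrow> nat \<Rightarrow> 'b set \<Rightarrow> 'b set" where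
  "Q_hom T i = (\<lambda>C\<in>carrier (Q T i). the_elem ((\<lambda>a. L (carrier M) i +> a) ` C))"

lemma coset_restrict [simp]: "H +>\<^bsub>M\<lparr>carrier := A\<rparr>\<^esub> x = H +> x"
  by (simp add: a_r_coset_def')

lemma module_layer: "y_submodule T \<Longrightarrow> module R (M\<lparr>carrier := K i \<inter> T\<rparr>)"
  using submodule.submodule_is_module[OF K_Int_submodule module_axioms] .

lemma L_submodule_layer:
  assumes T: "y_submodule T" and i: "1 \<le> i"
  shows "submodule (L T i) R (M\<lparr>carrier := K i \<inter> T\<rparr>)"
  using L_subset[OF assms] submodule_zero submodule_add submodule_smult L_submodule[OF T]
  by (intro module.module_incl_imp_submodule[OF module_layer[OF T]])
    (simp_all add: submodule.submodule_is_module[OF L_submodule[OF T] module_axioms])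

lemma Q_module: "y_submodule T \<Longrightarrow> 1 \<le> i \<Longrightarrow> module R (Q T i)"
  unfolding Q_def by (intro module_quotient_module module_layer L_submodule_layer)

lemma Q_carrier: "carrier (Q T i) = (\<lambda>x. L T i +> x) ` (K i \<inter> T)"
  by (simp add: Q_def quotient_module_carrier)

lemma Q_zero: "\<zero>\<^bsub>Q T i\<^esub> = L T i"
  by (simp add: Q_def quotient_module_zero)

lemma Q_add:
  assumes "y_submodule T" "1 \<le> i" "x \<in> K i \<inter> T" "z \<in> K i \<inter> T"
  shows "(L T i +> x) \<oplus>\<^bsub>Q T i\<^esub> (L T i +> z) = L T i +> (x \<oplus> z)"
  using quotient_module_add[OF module_layer L_submodule_layer, of T i x z] assms by (simp add: Q_def)

lemma Q_smult:
  assumes "y_submodule T" "1 \<le> i" "a \<in> carrier R" "x \<in> K i \<inter> T"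
  shows "a \<odot>\<^bsub>Q T i\<^esub> (L T i +> x) = L T i +> (a \<odot> x)"
  using quotient_module_smult[OF module_layer L_submodule_layer, of T i a x] assms by (simp add: Q_def)

lemma Q_coset_eq_zero_iff:
  assumes "y_submodule T" "1 \<le> i" "x \<in> K i \<inter> T"
  shows "L T i +> x = \<zero>\<^bsub>Q T i\<^esub> \<longleftrightarrow> x \<in> L T i"
proof -
  have "L T i +> \<zero> = L T i"
    using submodule_carrier[OF L_submodule[OF assms(1)]] by simp
  then show ?thesis
    using coset_eq_iff[OF L_submodule[OF assms(1)], of x \<zero> i] assms(3) K_memD
    by (auto simp: Q_zero diff_zero)
qed

lemma Q_coset_finsum:
  assumes T: "y_submodule T" and i: "1 \<le> i"
    and c: "c \<in> {..<n} \<rightarrow> carrier R" and v: "\<And>j. j < n \<Longrightarrow> v j \<in> K i \<inter> T"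
  shows "L T i +> lin_comb c v n = (\<Oplus>\<^bsub>Q T i\<^esub>j\<in>{..<n}. c j \<odot>\<^bsub>Q T i\<^esub> (L T i +> v j))"
proof -
  let ?N = "M\<lparr>carrier := K i \<inter> T\<rparr>"
  interpret N: module R ?N by (rule module_layer[OF T])
  have "lin_comb c v n = (\<Oplus>\<^bsub>?N\<^esub>j\<in>{..<n}. c j \<odot>\<^bsub>?N\<^esub> v j)"
    using c v
  proof (induction n)
    case 0
    then show ?case using N.M.finsum_empty by simp
  next
    case (Suc n)
    have C: "c n \<in> carrier R" "v n \<in> K i \<inter> T" using Suc.prems by auto
    have f: "(\<lambda>j. c j \<odot> v j) \<in> {..<n} \<rightarrow> K i \<inter> T"
    proof
      fix j assume "j \<in> {..<n}"
      then show "c j \<odot> v j \<in> K i \<inter> T"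
        using Suc.prems by (intro submodule_smult[OF K_Int_submodule[OF T]]) auto
    qed
    have "lin_comb c v (Suc n) = lin_comb c v n \<oplus> c n \<odot> v n"
      using Suc.prems K_memD by (intro lin_comb_Suc) (auto simp: less_Suc_eq_le)
    also have "lin_comb c v n = (\<Oplus>\<^bsub>?N\<^esub>j\<in>{..<n}. c j \<odot>\<^bsub>?N\<^esub> v j)"
      using Suc by (intro Suc.IH) auto
    finally show ?case
      using f C N.M.finsum_insert[of "{..<n}" n "\<lambda>j. c j \<odot> v j"] N.smult_closed[of "c n" "v n"]
        N.M.a_comm[of "c n \<odot> v n"] N.M.finsum_closed[of "\<lambda>j. c j \<odot> v j" "{..<n}"]
      by (simp add: lessThan_Suc)
  qed
  then show ?thesis
    using mod_hom_finsum[OF module_layer[OF T] Q_module[OF T i]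
        quotient_map_mod_hom[OF module_layer[OF T] L_submodule_layer[OF T i], folded Q_def],
        of "{..<n}" c v] c v by simp
qed

lemma Q_hom_coset:
  assumes T: "y_submodule T" and x: "x \<in> K i \<inter> T"
  shows "Q_hom T i (L T i +> x) = L (carrier M) i +> x"
proof -
  have xC: "x \<in> carrier M" using x K_memD by blast
  have TC: "T \<subseteq> carrier M" by (rule submodule_carrier[OF y_submodule_submodule[OF T]])
  have "L (carrier M) i +> z = L (carrier M) i +> x" if z: "z \<in> L T i +> x" for z
  proof -
    obtain u where u: "u \<in> L T i" "z = u \<oplus> x" using z by (auto simp: a_r_coset_def')
    have uL: "u \<in> L (carrier M) i" using u L_mono[OF TC] by blast
    then have uC: "u \<in> carrier M" using submodule_carrier[OF LM_submodule] by blast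
    have "z \<ominus> x = u" using u uC xC add_diff_cancel[of u x] by (simp add: M.a_comm)
    then show ?thesis using coset_eq_iff[OF LM_submodule] uL uC xC u by simp
  qed
  moreover have "x \<in> L T i +> x"
    using submodule_zero[OF L_submodule[OF T]] xC
    by (auto simp: a_r_coset_def' intro!: bexI[of _ \<zero>])
  ultimately have "(\<lambda>a. L (carrier M) i +> a) ` (L T i +> x) = {L (carrier M) i +> x}" by blast
  then show ?thesis using x by (auto simp: Q_hom_def Q_carrier)
qed

lemma Q_hom_mod_hom:
  assumes T: "y_submodule T" and i: "1 \<le> i"
  shows "Q_hom T i \<in> mod_hom R (Q T i) (Q (carrier M) i)"
proof -
  note coset = Q_hom_coset[OF T]
  note addT = Q_add[OF T i] and smT = Q_smult[OF T i]
    and addM = Q_add[OF y_submodule_carrier i] and smM = Q_smult[OF y_submodule_carrier i]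
  have cl: "u \<oplus> v \<in> K i \<inter> T" "a \<odot> u \<in> K i \<inter> T"
    if "u \<in> K i \<inter> T" "v \<in> K i \<inter> T" "a \<in> carrier R" for u v a
    using submodule_add[OF K_Int_submodule[OF T]] submodule_smult[OF K_Int_submodule[OF T]] that
    by blast+
  have M: "u \<in> K i \<inter> carrier M" if "u \<in> K i \<inter> T" for u using that K_memD by blast
  have add: "Q_hom T i (C \<oplus>\<^bsub>Q T i\<^esub> C') = Q_hom T i C \<oplus>\<^bsub>Q (carrier M) i\<^esub> Q_hom T i C'"
    if "C \<in> carrier (Q T i)" "C' \<in> carrier (Q T i)" for C C'
  proof -
    obtain u v where uv: "u \<in> K i \<inter> T" "v \<in> K i \<inter> T" "C = L T i +> u" "C' = L T i +> v"
      using that \<open>C \<in> _\<close> \<open>C' \<in> _\<close> unfolding Q_carrier by blast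
    show ?thesis
      unfolding uv(3,4) addT[OF uv(1,2)] coset[OF uv(1)] coset[OF uv(2)]
        coset[OF cl(1)[OF uv(1,2) R.zero_closed]] addM[OF M[OF uv(1)] M[OF uv(2)]] ..
  qed
  have sm: "Q_hom T i (a \<odot>\<^bsub>Q T i\<^esub> C) = a \<odot>\<^bsub>Q (carrier M) i\<^esub> Q_hom T i C"
    if a: "a \<in> carrier R" and C: "C \<in> carrier (Q T i)" for a C
  proof -
    obtain u where u: "u \<in> K i \<inter> T" "C = L T i +> u" using C unfolding Q_carrier by blast
    show ?thesis
      unfolding u(2) smT[OF a u(1)] coset[OF u(1)] coset[OF cl(2)[OF u(1) u(1) a]]
        smM[OF a M[OF u(1)]] ..
  qed
  have "Q_hom T i C \<in> carrier (Q (carrier M) i)" if "C \<in> carrier (Q T i)" for C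
    using that M coset unfolding Q_carrier by auto
  then show ?thesis using add sm by (simp add: mod_hom_def hom_def)
qed

lemma Q_hom_image: "y_submodule T \<Longrightarrow> Q_hom T i ` carrier (Q T i) = layer T i"
  unfolding Q_carrier layer_def by (simp add: image_image Q_hom_coset)

lemma Q_hom_inj_on:
  assumes T: "saturated T" and i: "i \<in> {1..l}"
  shows "inj_on (Q_hom T i) (carrier (Q T i))"
proof (rule inj_onI)
  have yT: "y_submodule T" using T by (simp add: saturated_def)
  fix C C' assume "C \<in> carrier (Q T i)" "C' \<in> carrier (Q T i)" and eq: "Q_hom T i C = Q_hom T i C'"
  then obtain u v where uv: "u \<in> K i \<inter> T" "v \<in> K i \<inter> T" "C = L T i +> u" "C' = L T i +> v"
    unfolding Q_carrier by blast
  have uvC: "u \<in> carrier M" "v \<in> carrier M" using uv K_memD by blast+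
  have "u \<ominus> v \<in> L (carrier M) i"
    using eq Q_hom_coset[OF yT uv(1)] Q_hom_coset[OF yT uv(2)] uv coset_eq_iff[OF LM_submodule uvC]
    by simp
  moreover have "u \<ominus> v \<in> T"
    using submodule_diff[OF y_submodule_submodule[OF yT]] uv by blast
  ultimately have "u \<ominus> v \<in> L T i" using T i by (auto simp: saturated_def)
  then show "C = C'" using coset_eq_iff[OF L_submodule[OF yT] uvC] uv by simp
qed

lemma Q_torsion_free:
  assumes R: "domain R" and T: "y_submodule T" and i: "1 \<le> i" and free: "free_module R (Q T i)"
    and s: "s \<in> carrier R" "s \<noteq> \<zero>\<^bsub>R\<^esub>" and x: "x \<in> K i \<inter> T" "s \<odot> x \<in> L T i"
  shows "x \<in> L T i"
proof -
  have "s \<odot> x \<in> K i \<inter> T" using submodule_smult[OF K_Int_submodule[OF T] s(1) x(1)] .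
  then have "s \<odot>\<^bsub>Q T i\<^esub> (L T i +> x) = \<zero>\<^bsub>Q T i\<^esub>"
    using Q_smult[OF T i s(1) x(1)] Q_coset_eq_zero_iff[OF T i] x(2) by simp
  moreover have "L T i +> x \<in> carrier (Q T i)" using x by (auto simp: Q_carrier)
  ultimately show ?thesis
    using free_module_torsion_free[OF R free s] Q_coset_eq_zero_iff[OF T i x(1)] by blast
qed

lemma saturated_if_free:
  assumes R: "domain R" and T: "y_submodule T"
    and s: "s \<in> carrier R" "s \<noteq> \<zero>\<^bsub>R\<^esub>" "\<And>x. x \<in> carrier M \<Longrightarrow> s \<odot> x \<in> T"
    and free: "\<And>i. i \<in> {1..l} \<Longrightarrow> free_module R (Q T i)"
  shows "saturated T"
  using Q_torsion_free[OF R T _ free s(1,2)]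
  by (intro saturatedI_torsion[OF T s(1,3)]) auto

lemma Q_free_if_same_layer:
  assumes S: "saturated S" and T: "saturated T" and i: "i \<in> {1..l}"
    and free: "free_module R (Q S i)" and layers: "layer T i = layer S i"
  shows "free_module R (Q T i)"
proof -
  have i1: "1 \<le> i" using i by simp
  have yS: "y_submodule S" and yT: "y_submodule T" using S T by (auto simp: saturated_def)
  show ?thesis
    using free_module_if_same_image[OF free Q_module[OF yT i1] Q_module[OF y_submodule_carrier i1]
        Q_hom_mod_hom[OF yS i1] Q_hom_inj_on[OF S i] Q_hom_mod_hom[OF yT i1] Q_hom_inj_on[OF T i]]
      Q_hom_image[OF yS] Q_hom_image[OF yT] layers by simp
qed

text \<open>A basis of $Q_i(S)$ consists of cosets; their representatives are independent and generating only
  modulo $L_i(S)$, which is the form in which \<open>card_saturated_same_layers\<close> uses them.\<close>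
lemma Q_basis_lifts:
  assumes S: "y_submodule S" and i: "1 \<le> i" and rank: "free_of_rank R (Q S i) r"
  shows "\<exists>b. (\<forall>j<r. b j \<in> K i \<inter> S) \<and>
    (\<forall>x\<in>K i \<inter> S. \<exists>c\<in>{..<r} \<rightarrow> carrier R. x \<ominus> lin_comb c b r \<in> L S i) \<and>
    (\<forall>c\<in>{..<r} \<rightarrow> carrier R. lin_comb c b r \<in> L S i \<longrightarrow> (\<forall>j<r. c j = \<zero>\<^bsub>R\<^esub>))"
proof -
  obtain \<beta> where \<beta>_basis: "\<forall>j<r. \<beta> j \<in> carrier (Q S i)"
    "\<forall>x\<in>carrier (Q S i). \<exists>c\<in>{..<r} \<rightarrow> carrier R. x = (\<Oplus>\<^bsub>Q S i\<^esub>j\<in>{..<r}. c j \<odot>\<^bsub>Q S i\<^esub> \<beta> j)"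
    "\<forall>c\<in>{..<r} \<rightarrow> carrier R. (\<Oplus>\<^bsub>Q S i\<^esub>j\<in>{..<r}. c j \<odot>\<^bsub>Q S i\<^esub> \<beta> j) = \<zero>\<^bsub>Q S i\<^esub> \<longrightarrow>
      (\<forall>j<r. c j = \<zero>\<^bsub>R\<^esub>)"
    using free_of_rank_indexed_basis[OF rank] by (elim exE conjE) (rule that)
  note \<beta> = \<beta>_basis(1)[rule_format] \<beta>_basis(2)[rule_format] \<beta>_basis(3)[rule_format]
  interpret Q: module R "Q S i" by (rule Q_module[OF S i])
  have "\<exists>b. b \<in> K i \<inter> S \<and> \<beta> j = L S i +> b" if "j < r" for j
    using \<beta>(1)[OF that] unfolding Q_carrier by blast
  then obtain b where b: "\<And>j. j < r \<Longrightarrow> b j \<in> K i \<inter> S \<and> \<beta> j = L S i +> b j" by metis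
  have comb: "L S i +> lin_comb c b r = (\<Oplus>\<^bsub>Q S i\<^esub>j\<in>{..<r}. c j \<odot>\<^bsub>Q S i\<^esub> \<beta> j)"
    if "c \<in> {..<r} \<rightarrow> carrier R" for c
  proof -
    have "L S i +> lin_comb c b r = (\<Oplus>\<^bsub>Q S i\<^esub>j\<in>{..<r}. c j \<odot>\<^bsub>Q S i\<^esub> (L S i +> b j))"
      using b that by (intro Q_coset_finsum[OF S i]) auto
    also have "\<dots> = (\<Oplus>\<^bsub>Q S i\<^esub>j\<in>{..<r}. c j \<odot>\<^bsub>Q S i\<^esub> \<beta> j)"
      using b that \<beta>(1) by (intro Q.M.finsum_cong') (auto simp: Pi_iff)
    finally show ?thesis .
  qed
  have mem: "lin_comb c b r \<in> K i \<inter> S" if "c \<in> {..<r} \<rightarrow> carrier R" for c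
    using b that by (intro lin_comb_mem[OF K_Int_submodule[OF S]]) auto
  show ?thesis
  proof (intro exI[of _ b] conjI allI ballI impI)
    show "b j \<in> K i \<inter> S" if "j < r" for j using b that by blast
    show "\<exists>c\<in>{..<r} \<rightarrow> carrier R. x \<ominus> lin_comb c b r \<in> L S i" if x: "x \<in> K i \<inter> S" for x
    proof -
      have "L S i +> x \<in> carrier (Q S i)" using x by (auto simp: Q_carrier)
      then obtain c where c: "c \<in> {..<r} \<rightarrow> carrier R" "L S i +> x = L S i +> lin_comb c b r"
        using \<beta>(2)[of "L S i +> x"] comb by auto
      then show ?thesis
        using coset_eq_iff[OF L_submodule[OF S], of x "lin_comb c b r" i] x mem[OF c(1)] K_memD by blast
    qed
    show "c j = \<zero>\<^bsub>R\<^esub>" if c: "c \<in> {..<r} \<rightarrow> carrier R" "lin_comb c b r \<in> L S i" "j < r" for c j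
      using \<beta>(3)[OF c(1) _ c(3)] comb[OF c(1)] Q_coset_eq_zero_iff[OF S i mem[OF c(1)]] c(2) by simp
  qed
qed

end

context nilpotent_endomorphism
begin

section \<open>Index and number of standard submodules\<close>

text \<open>The submodules to be counted are the saturated ones with the layers of \<open>S\<close>: freeness of the $Q_i(T)$
  implies saturation, as $s^{l^2} M \subseteq T$ by \<open>layers_exponent\<close>, and conversely $Q_i(T)$ is
  isomorphic to $Q_i(S)$ through the common image in $Q_i(M)$. The indices $k_i$ and $e_i$ depend only on the
  $h_i$, hence agree for all these \<open>T\<close>, and the number of \<open>T\<close> is
  $\prod_i e_i^{r_i} = \prod_i (k_i / h_i)^{r_i}$, where $k_i = a_1 \cdots a_i$ and $a_j = h_j \cdots h_l$.\<close>
lemma index_and_count: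
  fixes r h :: "nat \<Rightarrow> nat"
  assumes R: "domain R" and S: "y_submodule S"
    and s: "s \<in> carrier R" "s \<noteq> \<zero>\<^bsub>R\<^esub>" "\<And>x. x \<in> carrier M \<Longrightarrow> s \<odot> x \<in> S"
    and fin: "\<And>D. \<lbrakk>submodule D R M; \<And>x. x \<in> carrier M \<Longrightarrow> (s [^]\<^bsub>R\<^esub> (l * l)) \<odot> x \<in> D\<rbrakk>
        \<Longrightarrow> finite ((\<lambda>a. D +> a) ` carrier M)"
    and rank: "\<And>i. i \<in> {1..l} \<Longrightarrow> free_of_rank R (Q S i) (r i)"
    and h: "\<And>i. i \<in> {1..l} \<Longrightarrow>
        h i = coset_index (layer_group i) ((\<lambda>a. L (carrier M) i +> a) ` K i) (layer S i)"
  shows "module_index (carrier M) S = (\<Prod>i=1..l. h i ^ i)"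
    and "real (card {T. y_submodule T \<and> (\<forall>i\<in>{1..l}. free_module R (Q T i)) \<and>
        (\<forall>i\<in>{1..l}. layer T i = layer S i)}) =
      (\<Prod>i=1..l. real ((\<Prod>j=i..l. h j) ^ (\<Sum>j=i..l. r j)) / real (h i ^ r i))"
proof -
  interpret R: domain R by fact
  define s' where "s' = s [^]\<^bsub>R\<^esub> (l * l)"
  define D where "D = (\<lambda>x. s' \<odot> x) ` carrier M"
  have s': "s' \<in> carrier R" using s by (simp add: s'_def)
  have s'0: "s' \<noteq> \<zero>\<^bsub>R\<^esub>"
  proof -
    have "s [^]\<^bsub>R\<^esub> n \<noteq> \<zero>\<^bsub>R\<^esub>" for n :: nat
      using s by (induction n) (auto simp: R.integral_iff)
    then show ?thesis by (simp add: s'_def)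
  qed
  have D: "submodule D R M"
    unfolding D_def
  proof (rule submoduleI)
    show "\<zero> \<in> (\<odot>) s' ` carrier M" using s' by (intro image_eqI[of _ _ \<zero>]) auto
    show "\<ominus> a \<in> (\<odot>) s' ` carrier M" if "a \<in> (\<odot>) s' ` carrier M" for a
      using that s' by (auto simp: smult_r_minus[symmetric])
    show "a \<oplus> b \<in> (\<odot>) s' ` carrier M" if "a \<in> (\<odot>) s' ` carrier M" "b \<in> (\<odot>) s' ` carrier M" for a b
      using that s' by (auto simp: smult_r_distr[symmetric])
    show "c \<odot> a \<in> (\<odot>) s' ` carrier M" if "c \<in> carrier R" "a \<in> (\<odot>) s' ` carrier M" for c a
    proof -
      obtain x where x: "x \<in> carrier M" "a = s' \<odot> x" using \<open>a \<in> (\<odot>) s' ` carrier M\<close> by auto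
      have "c \<odot> a = s' \<odot> (c \<odot> x)"
        using x that s' by (simp add: smult_assoc1[symmetric] R.m_comm)
      then show ?thesis using x that by auto
    qed
  qed (use s' in auto)
  have finD: "finite ((\<lambda>a. D +> a) ` carrier M)"
    by (rule fin[OF D]) (auto simp: D_def s'_def)
  have free: "free_module R (Q S i)" if "i \<in> {1..l}" for i
    using rank[OF that] by (auto simp: free_of_rank_def free_module_def)
  have S_sat: "saturated S" by (rule saturated_if_free[OF R S s free])
  define good where "good = {T. saturated T \<and> (\<forall>i\<in>{1..l}. layer T i = layer S i)}"
  have S_good: "S \<in> good" using S_sat by (simp add: good_def)
  have exponent: "s' \<odot> x \<in> T" if "y_submodule T" "\<And>i. i \<in> {1..l} \<Longrightarrow> layer T i = layer S i"
    "x \<in> carrier M" for T x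
    using layers_exponent[OF that(1) s(1,3) _ that(3)] that(2) by (simp add: s'_def)
  have D_good: "D \<subseteq> T" if "T \<in> good" for T
    using exponent[of T] that by (auto simp: D_def good_def saturated_def)
  have good: "{T. y_submodule T \<and> (\<forall>i\<in>{1..l}. free_module R (Q T i)) \<and>
      (\<forall>i\<in>{1..l}. layer T i = layer S i)} = good"
  proof (intro equalityI subsetI)
    fix T assume T: "T \<in> {T. y_submodule T \<and> (\<forall>i\<in>{1..l}. free_module R (Q T i)) \<and>
      (\<forall>i\<in>{1..l}. layer T i = layer S i)}"
    then have "saturated T"
      using exponent[of T] by (intro saturated_if_free[OF R _ s' s'0]) auto
    then show "T \<in> good" using T by (simp add: good_def)
  next
    fix T assume "T \<in> good"
    then show "T \<in> {T. y_submodule T \<and> (\<forall>i\<in>{1..l}. free_module R (Q T i)) \<and>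
      (\<forall>i\<in>{1..l}. layer T i = layer S i)}"
      using Q_free_if_same_layer[OF S_sat _ _ free] by (auto simp: good_def saturated_def)
  qed
  define a where "a j = (\<Prod>m=j..l. h m)" for j
  have indices: "module_index (K i) (K i \<inter> T) = (\<Prod>j=1..i. a j)" (is ?k)
    "module_index (K i) (K i \<inter> T) = h i * module_index (L (carrier M) i) (L T i)" (is ?e)
    "module_index (K i) (K i \<inter> T) > 0"
    if T: "T \<in> good" and i: "i \<in> {1..l}" for T i
  proof -
    have sat: "saturated T" and layers: "\<And>i. i \<in> {1..l} \<Longrightarrow> layer T i = layer S i"
      using T by (auto simp: good_def)
    note ind = saturated_indices[OF sat D D_good[OF T] finD]
    show ?k
      unfolding a_def
      by (rule index_recurrence_solution[where e = "\<lambda>i. module_index (L (carrier M) i) (L T i)"])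
        (use ind layers h i in auto)
    show ?e using ind(1)[OF i] layers[OF i] h[OF i] by simp
    show "module_index (K i) (K i \<inter> T) > 0" using ind(5) .
  qed
  have l0: "module_index (carrier M) S = (\<Prod>j=1..l. a j)"
  proof -
    note ind = saturated_indices[OF S_sat D D_good[OF S_good] finD]
    have "module_index (K l) (K l \<inter> S) = (\<Prod>j=1..l. \<Prod>m=j..l. h m)"
      by (rule index_recurrence_solution[where e = "\<lambda>i. module_index (L (carrier M) i) (L S i)"])
        (use ind h in auto)
    moreover have "K l \<inter> S = S"
      using K_top[of l] submodule_carrier[OF y_submodule_submodule[OF S]] by auto
    ultimately show ?thesis using K_top[of l] by (simp add: a_def)
  qed
  then show "module_index (carrier M) S = (\<Prod>i=1..l. h i ^ i)"
    unfolding a_def prod_triangle .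
  define e where "e i = module_index (L (carrier M) i) (L S i)" for i
  have h_pos: "h i > 0" if "i \<in> {1..l}" for i
    using indices(2,3)[OF S_good that] by (cases "h i = 0") simp_all
  have k_e: "h i * e i = (\<Prod>j=1..i. a j)" if "i \<in> {1..l}" for i
    using indices(1,2)[OF S_good that] by (simp add: e_def)
  have e: "module_index (L (carrier M) i) (L T i) = e i" if "T \<in> good" "i \<in> {1..l}" for T i
  proof -
    have "h i * module_index (L (carrier M) i) (L T i) = h i * e i"
      using indices[OF that] k_e[OF that(2)] by simp
    then show ?thesis using h_pos[OF that(2)] by simp
  qed
  have "\<forall>i\<in>{1..l}. \<exists>b. (\<forall>j<r i. b j \<in> K i \<inter> S) \<and>
    (\<forall>x\<in>K i \<inter> S. \<exists>c\<in>{..<r i} \<rightarrow> carrier R. x \<ominus> lin_comb c b (r i) \<in> L S i) \<and>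
    (\<forall>c\<in>{..<r i} \<rightarrow> carrier R. lin_comb c b (r i) \<in> L S i \<longrightarrow> (\<forall>j<r i. c j = \<zero>\<^bsub>R\<^esub>))"
    using Q_basis_lifts[OF S _ rank] by simp
  then obtain b where b: "\<And>i. i \<in> {1..l} \<Longrightarrow> (\<forall>j<r i. b i j \<in> K i \<inter> S) \<and>
    (\<forall>x\<in>K i \<inter> S. \<exists>c\<in>{..<r i} \<rightarrow> carrier R. x \<ominus> lin_comb c (b i) (r i) \<in> L S i) \<and>
    (\<forall>c\<in>{..<r i} \<rightarrow> carrier R. lin_comb c (b i) (r i) \<in> L S i \<longrightarrow> (\<forall>j<r i. c j = \<zero>\<^bsub>R\<^esub>))"
    by (elim bchoice[elim_format] exE) blast
  have card: "card good = (\<Prod>i=1..l. e i ^ r i)"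
    unfolding good_def
  proof (rule card_saturated_same_layers[OF S_sat D _ finD, where b = b])
    show "D \<subseteq> T" if "T \<in> {T. saturated T \<and> (\<forall>i\<in>{1..l}. layer T i = layer S i)}" for T
      using D_good that by (simp add: good_def)
    show "module_index (L (carrier M) i) (L T i) = e i"
      if "T \<in> {T. saturated T \<and> (\<forall>i\<in>{1..l}. layer T i = layer S i)}" "i \<in> {1..l}" for T i
      using e that by (simp add: good_def)
  qed (use b in blast)+
  have "(\<Prod>i=1..l. h i ^ r i) * card good = (\<Prod>i=1..l. (\<Prod>j=1..i. a j) ^ r i)"
    unfolding card prod.distrib[symmetric] power_mult_distrib[symmetric]
    using k_e by (intro prod.cong) auto
  also have "\<dots> = (\<Prod>j=1..l. a j ^ (\<Sum>i=j..l. r i))" by (rule prod_partial_products_power)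
  finally have "real (\<Prod>i=1..l. h i ^ r i) * real (card good) = real (\<Prod>j=1..l. a j ^ (\<Sum>i=j..l. r i))"
    by (metis of_nat_mult)
  moreover have "real (\<Prod>i=1..l. h i ^ r i) \<noteq> 0"
  proof -
    have "(\<Prod>i=1..l. h i ^ r i) > 0" using h_pos by (intro prod_pos) simp
    then show ?thesis by linarith
  qed
  ultimately have "real (card good) =
      real (\<Prod>j=1..l. a j ^ (\<Sum>i=j..l. r i)) / real (\<Prod>i=1..l. h i ^ r i)"
    by (simp add: field_simps)
  also have "\<dots> = (\<Prod>i=1..l. real (a i ^ (\<Sum>j=i..l. r j)) / real (h i ^ r i))"
    by (simp add: prod_dividef)
  finally show "real (card {T. y_submodule T \<and> (\<forall>i\<in>{1..l}. free_module R (Q T i)) \<and>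
        (\<forall>i\<in>{1..l}. layer T i = layer S i)}) =
      (\<Prod>i=1..l. real ((\<Prod>j=i..l. h j) ^ (\<Sum>j=i..l. r j)) / real (h i ^ r i))"
    unfolding good a_def .
qed

end

section \<open>Truncated polynomial rings\<close>

lemma trunc_ideal_ideal:
  assumes R: "cring R" shows "ideal (trunc_ideal R l) (UP R)"
proof -
  interpret UP_cring R "UP R" using R by (rule UP_cring.intro)
  show ?thesis unfolding trunc_ideal_def by (intro P.cgenideal_ideal P.nat_pow_closed monom_closed) simp
qed

lemma trunc_proj_hom:
  assumes R: "cring R"
  shows "(\<lambda>p. trunc_ideal R l +>\<^bsub>UP R\<^esub> p) \<in> ring_hom (UP R) (trunc_poly_ring R l)"
  unfolding trunc_poly_ring_def by (rule ideal.rcos_ring_hom[OF trunc_ideal_ideal[OF R]])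

lemma trunc_poly_ring_cring:
  assumes R: "cring R" shows "cring (trunc_poly_ring R l)"
proof -
  interpret UP_cring R "UP R" using R by (rule UP_cring.intro)
  show ?thesis
    unfolding trunc_poly_ring_def
    by (rule ideal.quotient_is_cring[OF trunc_ideal_ideal[OF R] P.is_cring])
qed

lemma trunc_const_hom:
  assumes R: "cring R" shows "trunc_const R l \<in> ring_hom R (trunc_poly_ring R l)"
proof -
  interpret UP_cring R "UP R" using R by (rule UP_cring.intro)
  show ?thesis
    using ring_hom_trans[OF const_ring_hom trunc_proj_hom[OF R, of l]]
    by (simp add: trunc_const_def[abs_def] comp_def)
qed

lemma trunc_var_closed:
  assumes R: "cring R" shows "trunc_var R l \<in> carrier (trunc_poly_ring R l)"
proof -
  interpret UP_cring R "UP R" using R by (rule UP_cring.intro)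
  show ?thesis
    unfolding trunc_var_def by (intro ring_hom_closed[OF trunc_proj_hom[OF R]] monom_closed) simp
qed

lemma trunc_var_pow:
  assumes R: "cring R"
  shows "trunc_ideal R l +>\<^bsub>UP R\<^esub> (up_ring.monom (UP R) \<one>\<^bsub>R\<^esub> 1 [^]\<^bsub>UP R\<^esub> (n::nat)) =
    trunc_var R l [^]\<^bsub>trunc_poly_ring R l\<^esub> n"
proof -
  interpret UP_cring R "UP R" using R by (rule UP_cring.intro)
  interpret T: cring "trunc_poly_ring R l" by (rule trunc_poly_ring_cring[OF R])
  show ?thesis
  proof (induction n)
    case 0
    then show ?case using ring_hom_one[OF trunc_proj_hom[OF R]] by simp
  next
    case (Suc n)
    have "up_ring.monom (UP R) \<one>\<^bsub>R\<^esub> 1 \<in> carrier (UP R)" by simp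
    then show ?case
      using Suc ring_hom_mult[OF trunc_proj_hom[OF R], of
          "up_ring.monom (UP R) \<one>\<^bsub>R\<^esub> 1 [^]\<^bsub>UP R\<^esub> n" "up_ring.monom (UP R) \<one>\<^bsub>R\<^esub> 1" l]
      by (simp add: trunc_var_def)
  qed
qed

lemma trunc_var_nilpotent:
  assumes R: "cring R"
  shows "trunc_var R l [^]\<^bsub>trunc_poly_ring R l\<^esub> l = \<zero>\<^bsub>trunc_poly_ring R l\<^esub>"
proof -
  interpret UP_cring R "UP R" using R by (rule UP_cring.intro)
  interpret I: ideal "trunc_ideal R l" "UP R" by (rule trunc_ideal_ideal[OF R])
  have "up_ring.monom (UP R) \<one>\<^bsub>R\<^esub> 1 [^]\<^bsub>UP R\<^esub> l \<in> trunc_ideal R l"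
    unfolding trunc_ideal_def by (intro P.cgenideal_self P.nat_pow_closed monom_closed) simp
  then have "trunc_ideal R l +>\<^bsub>UP R\<^esub> (up_ring.monom (UP R) \<one>\<^bsub>R\<^esub> 1 [^]\<^bsub>UP R\<^esub> l) = trunc_ideal R l"
    by (rule I.a_rcos_const)
  then show ?thesis
    unfolding trunc_var_pow[OF R] by (simp add: trunc_poly_ring_def FactRing_def)
qed

lemma restrict_scalars_simps [simp]:
  "carrier (restrict_scalars \<phi> M) = carrier M"
  "\<zero>\<^bsub>restrict_scalars \<phi> M\<^esub> = \<zero>\<^bsub>M\<^esub>"
  "(\<oplus>\<^bsub>restrict_scalars \<phi> M\<^esub>) = (\<oplus>\<^bsub>M\<^esub>)"
  "a \<odot>\<^bsub>restrict_scalars \<phi> M\<^esub> x = \<phi> a \<odot>\<^bsub>M\<^esub> x"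
  by (simp_all add: restrict_scalars_def)

lemma restrict_scalars_carrier_update:
  "restrict_scalars \<phi> (M\<lparr>carrier := A\<rparr>) = (restrict_scalars \<phi> M)\<lparr>carrier := A\<rparr>"
  by (simp add: restrict_scalars_def)

lemma module_restrict_scalars:
  assumes R: "cring R" and \<phi>: "\<phi> \<in> ring_hom R P" and M: "module P M"
  shows "module R (restrict_scalars \<phi> M)"
proof -
  interpret M: module P M by fact
  interpret R: cring R by fact
  have closed: "\<phi> a \<in> carrier P" if "a \<in> carrier R" for a using \<phi> that by (rule ring_hom_closed)
  have "abelian_group (restrict_scalars \<phi> M)"
    by (rule abelian_groupI) (auto simp: M.M.a_ac intro: M.M.l_neg M.M.a_inv_closed)
  then show ?thesis
    by (intro moduleI R.is_cring)
      (auto simp: closed ring_hom_add[OF \<phi>] ring_hom_mult[OF \<phi>] ring_hom_one[OF \<phi>]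
        M.smult_l_distr M.smult_r_distr M.smult_assoc1)
qed

lemma trunc_pow_smult:
  assumes R: "cring R" and M: "module (trunc_poly_ring R l) M" and x: "x \<in> carrier M"
  shows "(trunc_var R l [^]\<^bsub>trunc_poly_ring R l\<^esub> (n::nat)) \<odot>\<^bsub>M\<^esub> x =
    ((\<lambda>m. trunc_var R l \<odot>\<^bsub>M\<^esub> m) ^^ n) x"
proof -
  interpret M: module "trunc_poly_ring R l" M by fact
  note v = trunc_var_closed[OF R, of l]
  show ?thesis
    using x
  proof (induction n arbitrary: x)
    case (Suc n)
    then show ?case using v by (simp add: M.smult_assoc1 funpow_swap1)
  qed simp
qed

lemma nilpotent_endomorphism_trunc:
  assumes R: "cring R" and M: "module (trunc_poly_ring R l) M"
  shows "nilpotent_endomorphism R (restrict_scalars (trunc_const R l) M) (\<lambda>m. trunc_var R l \<odot>\<^bsub>M\<^esub> m) l"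
proof -
  interpret M: module "trunc_poly_ring R l" M by fact
  note v = trunc_var_closed[OF R, of l]
  note c = ring_hom_closed[OF trunc_const_hom[OF R, of l]]
  show ?thesis
  proof (intro nilpotent_endomorphism.intro nilpotent_endomorphism_axioms.intro)
    show "module R (restrict_scalars (trunc_const R l) M)"
      by (rule module_restrict_scalars[OF R trunc_const_hom[OF R] M])
    fix x assume x: "x \<in> carrier (restrict_scalars (trunc_const R l) M)"
    show "trunc_var R l \<odot>\<^bsub>M\<^esub> x \<in> carrier (restrict_scalars (trunc_const R l) M)"
      using x v by simp
    show "((\<lambda>m. trunc_var R l \<odot>\<^bsub>M\<^esub> m) ^^ l) x = \<zero>\<^bsub>restrict_scalars (trunc_const R l) M\<^esub>"
      using trunc_pow_smult[OF R M, of x l] trunc_var_nilpotent[OF R, of l] x by simp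
  next
    fix a x assume "a \<in> carrier R" "x \<in> carrier (restrict_scalars (trunc_const R l) M)"
    then show "trunc_var R l \<odot>\<^bsub>M\<^esub> (a \<odot>\<^bsub>restrict_scalars (trunc_const R l) M\<^esub> x) =
      a \<odot>\<^bsub>restrict_scalars (trunc_const R l) M\<^esub> (trunc_var R l \<odot>\<^bsub>M\<^esub> x)"
      using v c M.R.m_comm by (simp add: M.smult_assoc1[symmetric])
  qed (use v in \<open>simp add: M.smult_r_distr\<close>)
qed

text \<open>Every element of $R[y]/(y^l)$ is a sum of products of constants with powers of the variable.\<close>
lemma trunc_smult_mem:
  assumes R: "cring R" and M: "module (trunc_poly_ring R l) M"
    and T: "subgroup T (add_monoid M)"
    and const: "\<And>a x. a \<in> carrier R \<Longrightarrow> x \<in> T \<Longrightarrow> trunc_const R l a \<odot>\<^bsub>M\<^esub> x \<in> T"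
    and var: "\<And>x. x \<in> T \<Longrightarrow> trunc_var R l \<odot>\<^bsub>M\<^esub> x \<in> T"
    and q: "q \<in> carrier (trunc_poly_ring R l)" and x: "x \<in> T"
  shows "q \<odot>\<^bsub>M\<^esub> x \<in> T"
proof -
  interpret UP_cring R "UP R" using R by (rule UP_cring.intro)
  interpret M: module "trunc_poly_ring R l" M by fact
  interpret T: subgroup T "add_monoid M" by fact
  let ?\<pi> = "\<lambda>p. trunc_ideal R l +>\<^bsub>UP R\<^esub> p"
  let ?mon = "up_ring.monom (UP R)"
  note \<pi> = trunc_proj_hom[OF R, of l]
  have TM: "t \<in> carrier M" if "t \<in> T" for t using T.subset that by auto
  have var_pow: "?\<pi> (?mon \<one>\<^bsub>R\<^esub> n) \<odot>\<^bsub>M\<^esub> t \<in> T" if "t \<in> T" for n t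
    using that
  proof (induction n arbitrary: t)
    case 0
    have "?\<pi> (?mon \<one>\<^bsub>R\<^esub> 0) = \<one>\<^bsub>trunc_poly_ring R l\<^esub>"
      using ring_hom_one[OF \<pi>] by simp
    then show ?case using 0 TM by simp
  next
    case (Suc n)
    have "?\<pi> (?mon \<one>\<^bsub>R\<^esub> (Suc n)) = ?\<pi> (?mon \<one>\<^bsub>R\<^esub> n) \<otimes>\<^bsub>trunc_poly_ring R l\<^esub> trunc_var R l"
      unfolding monom_one_Suc trunc_var_def by (rule ring_hom_mult[OF \<pi>]) simp_all
    moreover have "?\<pi> (?mon \<one>\<^bsub>R\<^esub> n) \<in> carrier (trunc_poly_ring R l)"
      by (rule ring_hom_closed[OF \<pi>]) simp
    ultimately show ?case
      using Suc.IH[OF var[OF Suc.prems]] TM[OF Suc.prems] trunc_var_closed[OF R, of l]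
      by (simp add: M.smult_assoc1)
  qed
  have monom: "?\<pi> (?mon a n) \<odot>\<^bsub>M\<^esub> t \<in> T" if "a \<in> carrier R" "t \<in> T" for a n t
  proof -
    have "?mon a n = ?mon a 0 \<otimes>\<^bsub>UP R\<^esub> ?mon \<one>\<^bsub>R\<^esub> n"
      using monom_mult[of a "\<one>\<^bsub>R\<^esub>" 0 n] that by simp
    then have "?\<pi> (?mon a n) = trunc_const R l a \<otimes>\<^bsub>trunc_poly_ring R l\<^esub> ?\<pi> (?mon \<one>\<^bsub>R\<^esub> n)"
      using ring_hom_mult[OF \<pi>, of "?mon a 0" "?mon \<one>\<^bsub>R\<^esub> n"] that by (simp add: trunc_const_def)
    moreover have "?\<pi> (?mon \<one>\<^bsub>R\<^esub> n) \<in> carrier (trunc_poly_ring R l)"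
      by (rule ring_hom_closed[OF \<pi>]) simp
    ultimately show ?thesis
      using const[OF that(1) var_pow[OF that(2)]] TM[OF that(2)]
        ring_hom_closed[OF trunc_const_hom[OF R, of l] that(1)]
      by (simp add: M.smult_assoc1)
  qed
  have sum: "?\<pi> (\<Oplus>\<^bsub>UP R\<^esub>i\<in>{..n}. ?mon (f i) i) \<odot>\<^bsub>M\<^esub> x \<in> T"
    if f: "\<And>i. f i \<in> carrier R" for f :: "nat \<Rightarrow> 'a" and n
  proof (induction n)
    case 0
    have "(\<lambda>i. ?mon (f i) i) \<in> {..0} \<rightarrow> carrier (UP R)" using f by auto
    then show ?case using monom[OF f x, of 0 0] by (simp add: P.finsum_0 f)
  next
    case (Suc n)
    have m: "(\<lambda>i. ?mon (f i) i) \<in> {..n} \<rightarrow> carrier (UP R)" using f by auto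
    have mS: "?mon (f (Suc n)) (Suc n) \<in> carrier (UP R)" using f by simp
    have s: "(\<Oplus>\<^bsub>UP R\<^esub>i\<in>{..n}. ?mon (f i) i) \<in> carrier (UP R)" by (rule P.finsum_closed[OF m])
    have "(\<Oplus>\<^bsub>UP R\<^esub>i\<in>{..Suc n}. ?mon (f i) i) =
        ?mon (f (Suc n)) (Suc n) \<oplus>\<^bsub>UP R\<^esub> (\<Oplus>\<^bsub>UP R\<^esub>i\<in>{..n}. ?mon (f i) i)"
      using f by (intro P.finsum_Suc) auto
    then have "?\<pi> (\<Oplus>\<^bsub>UP R\<^esub>i\<in>{..Suc n}. ?mon (f i) i) \<odot>\<^bsub>M\<^esub> x =
        ?\<pi> (?mon (f (Suc n)) (Suc n)) \<odot>\<^bsub>M\<^esub> x \<oplus>\<^bsub>M\<^esub> ?\<pi> (\<Oplus>\<^bsub>UP R\<^esub>i\<in>{..n}. ?mon (f i) i) \<odot>\<^bsub>M\<^esub> x"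
      using ring_hom_add[OF \<pi> mS s] M.smult_l_distr[OF ring_hom_closed[OF \<pi> mS]
          ring_hom_closed[OF \<pi> s] TM[OF x]] by simp
    then show ?case using T.m_closed[OF monom[OF f x] Suc] by simp
  qed
  obtain p where p: "p \<in> carrier (UP R)" "q = ?\<pi> p"
    using q unfolding trunc_poly_ring_def FactRing_def A_RCOSETS_def' by auto
  have "p = (\<Oplus>\<^bsub>UP R\<^esub>i\<in>{..deg R p}. ?mon (up_ring.coeff (UP R) p i) i)"
    using up_repr[OF p(1)] by simp
  then show ?thesis
    using sum[of "up_ring.coeff (UP R) p" "deg R p"] p by simp
qed

section \<open>Standard submodules over the maximal order\<close>

text \<open>The ring $R[y]/(y^l)$ acts on \<open>M\<close>. Restricting the action to the constants and letting \<open>y\<close> be the action of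
  the variable turns \<open>M\<close> into an instance of the previous setting.\<close>
locale truncated_module =
  fixes R :: "('r, 'q) ring_scheme" and l :: nat
    and M :: "((nat \<Rightarrow> 'r) set, 'b, 'm) module_scheme"
  assumes R_cring: "cring R" and M_module: "module (trunc_poly_ring R l) M"
begin

abbreviation (input) M\<^sub>R :: "('r, 'b) module" where
  "M\<^sub>R \<equiv> restrict_scalars (trunc_const R l) M"

end

sublocale truncated_module \<subseteq>
    nilpotent_endomorphism R M\<^sub>R "\<lambda>m. trunc_var R l \<odot>\<^bsub>M\<^esub> m" l
  by (rule nilpotent_endomorphism_trunc[OF R_cring M_module])

context truncated_module
begin

lemma coset_restrict_scalars: "A +>\<^bsub>M\<^sub>R\<^esub> x = A +>\<^bsub>M\<^esub> x"
  by (simp add: a_r_coset_def')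

lemma K_sub_restrict: "T \<subseteq> carrier M \<Longrightarrow> K_sub R l (M\<lparr>carrier := T\<rparr>) i = K i \<inter> T"
  using trunc_pow_smult[OF R_cring M_module] by (auto simp: K_sub_def K_def)

lemma K_sub_eq: "K_sub R l M i = K i"
  using trunc_pow_smult[OF R_cring M_module] by (auto simp: K_sub_def K_def)

lemma L_sub_restrict: "T \<subseteq> carrier M \<Longrightarrow> L_sub R l (M\<lparr>carrier := T\<rparr>) i = L T i"
  by (simp add: L_sub_def L_def K_sub_restrict set_add_def')

lemma L_sub_eq: "L_sub R l M i = L (carrier M) i"
  using K_carrier by (simp add: L_sub_def L_def K_sub_eq set_add_def' Int_absorb2)

lemma Q_mod_restrict: "T \<subseteq> carrier M \<Longrightarrow> Q_mod R l (M\<lparr>carrier := T\<rparr>) i = Q T i"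
  by (simp add: Q_mod_def Q_def K_sub_restrict L_sub_restrict restrict_scalars_carrier_update)

lemma Q_mod_eq: "Q_mod R l M i = Q (carrier M) i"
  using K_carrier by (simp add: Q_mod_def Q_def K_sub_eq L_sub_eq restrict_scalars_carrier_update Int_absorb2)

lemma Q_map_eq: "T \<subseteq> carrier M \<Longrightarrow> Q_map R l M T i = Q_hom T i"
  by (simp add: Q_map_def Q_hom_def Q_mod_restrict L_sub_eq coset_restrict_scalars)

lemma a_inv_restrict_scalars: "\<ominus>\<^bsub>M\<^sub>R\<^esub> x = \<ominus>\<^bsub>M\<^esub> x"
  by (simp add: a_inv_def m_inv_def)

text \<open>The records \<open>M\<close> and \<open>M\<^sub>R\<close> have different types, so their additive monoids are related only
  through their operations.\<close>
lemma subgroup_if_submodule: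
  assumes T: "submodule T R M\<^sub>R"
  shows "subgroup T (add_monoid M)"
proof -
  interpret PM: module "trunc_poly_ring R l" M by (rule M_module)
  show ?thesis
    using submoduleE[OF T] submodule_carrier[OF T]
    by (intro group.subgroupI[OF PM.M.a_group])
      (simp_all add: a_inv_restrict_scalars a_inv_def[symmetric])
qed

lemma submodule_iff: "submodule T (trunc_poly_ring R l) M \<longleftrightarrow> y_submodule T"
proof
  interpret PM: module "trunc_poly_ring R l" M by (rule M_module)
  assume T: "submodule T (trunc_poly_ring R l) M"
  note E = PM.submoduleE[OF T]
  have zero: "\<zero>\<^bsub>M\<^esub> \<in> T"
    using subgroup.one_closed[OF submodule.axioms(1)[OF T]] by simp
  have "submodule T R M\<^sub>R"
    by (rule submoduleI)
      (use E zero ring_hom_closed[OF trunc_const_hom[OF R_cring, of l]] in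
        \<open>simp_all add: a_inv_restrict_scalars\<close>)
  then show "y_submodule T"
    using E(4)[OF trunc_var_closed[OF R_cring]] by (auto simp: y_submodule_def)
next
  interpret PM: module "trunc_poly_ring R l" M by (rule M_module)
  assume T: "y_submodule T"
  note Ts = y_submodule_submodule[OF T]
  note E = submoduleE[OF Ts]
  show "submodule T (trunc_poly_ring R l) M"
  proof (rule PM.submoduleI)
    show "q \<odot>\<^bsub>M\<^esub> x \<in> T" if "q \<in> carrier (trunc_poly_ring R l)" "x \<in> T" for q x
      using that
    proof (rule trunc_smult_mem[OF R_cring M_module subgroup_if_submodule[OF Ts], rotated 2])
      show "trunc_const R l a \<odot>\<^bsub>M\<^esub> x \<in> T" if "a \<in> carrier R" "x \<in> T" for a x
        using E(4)[OF that] by simp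
      show "trunc_var R l \<odot>\<^bsub>M\<^esub> x \<in> T" if "x \<in> T" for x
        using T that by (auto simp: y_submodule_def)
    qed
  qed (use E submodule_zero[OF Ts] in \<open>simp_all add: a_inv_restrict_scalars\<close>)
qed

lemma y_submodule_subset: "y_submodule T \<Longrightarrow> T \<subseteq> carrier M"
  using submodule_carrier[OF y_submodule_submodule] by fastforce

lemma Q_bar_eq: "y_submodule T \<Longrightarrow> Q_bar R l M T i = layer T i"
  using Q_hom_image[of T i] y_submodule_subset[of T]
  by (simp add: Q_bar_def Q_map_eq Q_mod_restrict)

lemma standard_submodule_iff:
  assumes "integral_module M"
  shows "standard_submodule R l M T \<longleftrightarrow> y_submodule T \<and> (\<forall>i\<in>{1..l}. free_module R (Q T i))"
proof -
  interpret PM: module "trunc_poly_ring R l" M by (rule M_module)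
  have "module (trunc_poly_ring R l) (M\<lparr>carrier := T\<rparr>) \<and> integral_module (M\<lparr>carrier := T\<rparr>)"
    if T: "y_submodule T"
  proof
    show "module (trunc_poly_ring R l) (M\<lparr>carrier := T\<rparr>)"
      using submodule.submodule_is_module[OF _ M_module] T by (simp add: submodule_iff)
    obtain n where n: "add_monoid M \<cong> int_power_group n"
      using assms unfolding integral_module_def by blast
    show "integral_module (M\<lparr>carrier := T\<rparr>)"
      using subgroup_iso_int_power_group[OF PM.M.a_comm_group n
          subgroup_if_submodule[OF y_submodule_submodule[OF T]]]
      by (simp add: integral_module_def)
  qed
  then show ?thesis
    using y_submodule_subset[of T] Q_mod_restrict[of T]
    by (auto simp: standard_submodule_def standard_module_def submodule_iff)
qed

lemma nat_scalar_smult: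
  assumes x: "x \<in> carrier M"
  shows "add_pow R (n::nat) \<one>\<^bsub>R\<^esub> \<odot>\<^bsub>M\<^sub>R\<^esub> x = x [^]\<^bsub>add_monoid M\<^esub> n"
proof (induction n)
  case 0
  have "\<zero>\<^bsub>R\<^esub> \<odot>\<^bsub>M\<^sub>R\<^esub> x = \<zero>\<^bsub>M\<^sub>R\<^esub>" using smult_l_null[of x] x by simp
  then show ?case by (simp add: add_pow_def)
next
  case (Suc n)
  have c: "add_pow R n \<one>\<^bsub>R\<^esub> \<in> carrier R" by simp
  have "add_pow R (Suc n) \<one>\<^bsub>R\<^esub> \<odot>\<^bsub>M\<^sub>R\<^esub> x =
      (add_pow R n \<one>\<^bsub>R\<^esub> \<oplus>\<^bsub>R\<^esub> \<one>\<^bsub>R\<^esub>) \<odot>\<^bsub>M\<^sub>R\<^esub> x"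
    by (simp add: add_pow_def)
  also have "\<dots> = add_pow R n \<one>\<^bsub>R\<^esub> \<odot>\<^bsub>M\<^sub>R\<^esub> x \<oplus>\<^bsub>M\<^sub>R\<^esub> \<one>\<^bsub>R\<^esub> \<odot>\<^bsub>M\<^sub>R\<^esub> x"
    using smult_l_distr[OF c R.one_closed, of x] x by simp
  also have "\<one>\<^bsub>R\<^esub> \<odot>\<^bsub>M\<^sub>R\<^esub> x = x" using smult_one[of x] x by simp
  finally show ?case using Suc by simp
qed

lemma nat_scalar_pow_smult:
  assumes x: "x \<in> carrier M"
  shows "(add_pow R (n::nat) \<one>\<^bsub>R\<^esub> [^]\<^bsub>R\<^esub> (k::nat)) \<odot>\<^bsub>M\<^sub>R\<^esub> x = x [^]\<^bsub>add_monoid M\<^esub> (n ^ k)"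
  using x
proof (induction k arbitrary: x)
  case 0
  interpret PM: module "trunc_poly_ring R l" M by (rule M_module)
  have "\<one>\<^bsub>R\<^esub> \<odot>\<^bsub>M\<^sub>R\<^esub> x = x" using smult_one[of x] 0 by simp
  then show ?case using PM.M.add.nat_pow_eone[of x] 0 by simp
next
  case (Suc k)
  interpret PM: module "trunc_poly_ring R l" M by (rule M_module)
  let ?s = "add_pow R n \<one>\<^bsub>R\<^esub>"
  have s: "?s \<in> carrier R" "?s [^]\<^bsub>R\<^esub> k \<in> carrier R" by simp_all
  have sx: "x [^]\<^bsub>add_monoid M\<^esub> n \<in> carrier M"
    using monoid.nat_pow_closed[OF PM.M.a_monoid, of x n] Suc.prems by simp
  have "(?s [^]\<^bsub>R\<^esub> Suc k) \<odot>\<^bsub>M\<^sub>R\<^esub> x = (?s [^]\<^bsub>R\<^esub> k) \<odot>\<^bsub>M\<^sub>R\<^esub> (?s \<odot>\<^bsub>M\<^sub>R\<^esub> x)"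
    using smult_assoc1[OF s(2,1), of x] Suc.prems by simp
  also have "\<dots> = (x [^]\<^bsub>add_monoid M\<^esub> n) [^]\<^bsub>add_monoid M\<^esub> (n ^ k)"
    unfolding nat_scalar_smult[OF Suc.prems] by (rule Suc.IH[OF sx])
  also have "\<dots> = x [^]\<^bsub>add_monoid M\<^esub> (n ^ Suc k)"
    using monoid.nat_pow_pow[OF PM.M.a_monoid, of x n "n ^ k"] Suc.prems by simp
  finally show ?case .
qed

text \<open>The scalar that multiplies \<open>M\<close> into \<open>S\<close> is the index of \<open>S\<close>, viewed as an element of \<open>R\<close>; it is nonzero by
  the assumption on the characteristic. All submodules that contain $d^{l^2} M$ have finite
  index because \<open>M\<close> is a finitely generated abelian group.\<close>
theorem standard_submodule_index_and_count:
  fixes r h :: "nat \<Rightarrow> nat"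
  assumes R: "domain R" and char_0: "\<And>n::nat. n > 0 \<Longrightarrow> add_pow R n \<one>\<^bsub>R\<^esub> \<noteq> \<zero>\<^bsub>R\<^esub>"
    and M: "integral_module M" and S: "standard_submodule R l M S"
    and fin: "finite (a_rcosets\<^bsub>M\<^esub> S)"
    and rank: "\<forall>i\<in>{1..l}. free_of_rank R (Q_mod R l (M\<lparr>carrier := S\<rparr>) i) (r i)"
    and h: "\<forall>i\<in>{1..l}. add_index (Q_mod R l M i) (Q_bar R l M S i) = h i"
  shows "(\<forall>i\<in>{1..l}.
      (\<forall>a\<in>K_sub R l (M\<lparr>carrier := S\<rparr>) i.
         Q_map R l M S i (L_sub R l (M\<lparr>carrier := S\<rparr>) i +>\<^bsub>M\<^esub> a) = L_sub R l M i +>\<^bsub>M\<^esub> a) \<and>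
      Q_map R l M S i \<in> mod_hom R (Q_mod R l (M\<lparr>carrier := S\<rparr>) i) (Q_mod R l M i) \<and>
      inj_on (Q_map R l M S i) (carrier (Q_mod R l (M\<lparr>carrier := S\<rparr>) i)))
    \<and> add_index M S = (\<Prod>i=1..l. h i ^ i)
    \<and> real (card {T. standard_submodule R l M T \<and>
                     (\<forall>i\<in>{1..l}. Q_bar R l M T i = Q_bar R l M S i)}) =
         (\<Prod>i=1..l. real ((\<Prod>j=i..l. h j) ^ (\<Sum>j=i..l. r j)) / real (h i ^ r i))"
proof -
  interpret PM: module "trunc_poly_ring R l" M by (rule M_module)
  have yS: "y_submodule S" and free: "\<And>i. i \<in> {1..l} \<Longrightarrow> free_module R (Q S i)"
    using S by (auto simp: standard_submodule_iff[OF M])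
  note SM = y_submodule_subset[OF yS]
  note S_sub = subgroup_if_submodule[OF y_submodule_submodule[OF yS]]
  define d where "d = card (a_rcosets\<^bsub>M\<^esub> S)"
  have "S +>\<^bsub>M\<^esub> \<zero>\<^bsub>M\<^esub> \<in> a_rcosets\<^bsub>M\<^esub> S" by (auto simp: A_RCOSETS_def')
  then have d: "d > 0" using fin by (auto simp: d_def card_gt_0_iff)
  define s where "s = add_pow R d \<one>\<^bsub>R\<^esub>"
  have s: "s \<in> carrier R" "s \<noteq> \<zero>\<^bsub>R\<^esub>" using char_0[OF d] by (auto simp: s_def)
  have sS: "s \<odot>\<^bsub>M\<^sub>R\<^esub> x \<in> S" if "x \<in> carrier M\<^sub>R" for x
    using pow_index_mem[OF PM.M.a_comm_group S_sub, of x] nat_scalar_smult[of x d] that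
    by (simp add: s_def d_def A_RCOSETS_def)
  have finD: "finite ((\<lambda>a. D +>\<^bsub>M\<^sub>R\<^esub> a) ` carrier M\<^sub>R)"
    if D: "submodule D R M\<^sub>R"
      and sD: "\<And>x. x \<in> carrier M\<^sub>R \<Longrightarrow> (s [^]\<^bsub>R\<^esub> (l * l)) \<odot>\<^bsub>M\<^sub>R\<^esub> x \<in> D" for D
  proof -
    obtain n where n: "add_monoid M \<cong> int_power_group n"
      using M unfolding integral_module_def by blast
    have "x [^]\<^bsub>add_monoid M\<^esub> (d ^ (l * l)) \<in> D" if "x \<in> carrier M" for x
      using sD[of x] nat_scalar_pow_smult[OF that, of d "l * l"] that by (simp add: s_def)
    then have "finite ((\<lambda>a. D #>\<^bsub>add_monoid M\<^esub> a) ` carrier M)"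
      using finite_quotient_by_powers[OF PM.M.a_comm_group n _ subgroup_if_submodule[OF D], of "d ^ (l * l)"] d
      by simp
    then show ?thesis by (simp add: coset_restrict_scalars) (simp add: a_r_coset_def)
  qed
  have rank': "free_of_rank R (Q S i) (r i)" if "i \<in> {1..l}" for i
    using rank that by (simp add: Q_mod_restrict[OF SM])
  have h': "h i = coset_index (layer_group i) ((\<lambda>a. L (carrier M\<^sub>R) i +>\<^bsub>M\<^sub>R\<^esub> a) ` K i) (layer S i)"
    if "i \<in> {1..l}" for i
  proof -
    have "h i = card ((\<lambda>C. layer S i +>\<^bsub>Q (carrier M) i\<^esub> C) ` carrier (Q (carrier M) i))"
      using h that
      by (simp add: add_index_def A_RCOSETS_def' Q_mod_eq Q_bar_eq[OF yS] UNION_singleton_eq_range)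
    also have "(\<lambda>C. layer S i +>\<^bsub>Q (carrier M) i\<^esub> C) = (\<lambda>C. layer S i #>\<^bsub>layer_group i\<^esub> C)"
      by (simp add: fun_eq_iff a_r_coset_def' r_coset_def Q_def layer_group_def quotient_module_def
          set_add_def' set_mult_def)
    finally show ?thesis
      using K_carrier[of i] by (simp add: coset_index_def Q_carrier Int_absorb2)
  qed
  note result = index_and_count[OF R yS s sS finD rank' h']
  have S_sat: "saturated S" by (rule saturated_if_free[OF R yS s sS free])
  have a: "(\<forall>a\<in>K_sub R l (M\<lparr>carrier := S\<rparr>) i.
         Q_map R l M S i (L_sub R l (M\<lparr>carrier := S\<rparr>) i +>\<^bsub>M\<^esub> a) = L_sub R l M i +>\<^bsub>M\<^esub> a) \<and>
      Q_map R l M S i \<in> mod_hom R (Q_mod R l (M\<lparr>carrier := S\<rparr>) i) (Q_mod R l M i) \<and>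
      inj_on (Q_map R l M S i) (carrier (Q_mod R l (M\<lparr>carrier := S\<rparr>) i))" if i: "i \<in> {1..l}" for i
    using Q_hom_coset[OF yS] Q_hom_mod_hom[OF yS, of i] Q_hom_inj_on[OF S_sat i] i
    by (simp add: K_sub_restrict[OF SM] L_sub_restrict[OF SM] Q_mod_restrict[OF SM] Q_map_eq[OF SM]
        L_sub_eq Q_mod_eq coset_restrict_scalars)
  have "add_index M S = module_index (carrier M\<^sub>R) S"
    by (auto simp: add_index_def coset_index_def A_RCOSETS_def' r_coset_def a_r_coset_def'
        intro!: arg_cong[where f = card])
  moreover have "{T. standard_submodule R l M T \<and> (\<forall>i\<in>{1..l}. Q_bar R l M T i = Q_bar R l M S i)} =
      {T. y_submodule T \<and> (\<forall>i\<in>{1..l}. free_module R (Q T i)) \<and> (\<forall>i\<in>{1..l}. layer T i = layer S i)}"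
    by (auto simp: standard_submodule_iff[OF M] Q_bar_eq[OF yS] Q_bar_eq)
  ultimately show ?thesis using a result by simp
qed

end

lemma maximal_order_simps:
  "carrier \<O> = {x. algebraic_int x}" "\<zero>\<^bsub>\<O>\<^esub> = 0" "\<one>\<^bsub>\<O>\<^esub> = 1"
  "x \<oplus>\<^bsub>\<O>\<^esub> z = x + z" "x \<otimes>\<^bsub>\<O>\<^esub> z = x * z"
  by (simp_all add: maximal_order_def ring_of_type_algebra_def)

text \<open>Inside a field there are no zero divisors, so the only point is that the algebraic integers form a ring. In
  the theorem below this is part of the assumption that the $Q_i(S)$ are \<open>\<O>\<close>-modules.\<close>
lemma domain_maximal_order:
  assumes "cring (\<O> :: 'k::field_char_0 ring)" shows "domain (\<O> :: 'k ring)"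
  using assms by (auto intro!: domain.intro simp: domain_axioms_def maximal_order_simps)

lemma add_pow_maximal_order: "add_pow \<O> (n::nat) \<one>\<^bsub>\<O>\<^esub> = of_nat n"
  by (induction n) (simp_all add: add_pow_def nat_pow_def maximal_order_simps)

theorem theorem1p1:
  fixes l :: nat
    and M :: "((nat \<Rightarrow> 'k::field_char_0) set, 'b, 'm) module_scheme"
    and S :: "'b set"
    and r h :: "nat \<Rightarrow> nat"
  assumes "number_field TYPE('k)"
    and "l > 0"
    and "module (trunc_poly_ring \<O> l) M"
    and "integral_module M"
    and "standard_submodule \<O> l M S"
    and "finite (a_rcosets\<^bsub>M\<^esub> S)"
    and "\<forall>i\<in>{1..l}. free_of_rank \<O> (Q_mod \<O> l (M\<lparr>carrier := S\<rparr>) i) (r i)"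
    and "\<forall>i\<in>{1..l}. add_index (Q_mod \<O> l M i) (Q_bar \<O> l M S i) = h i"
  shows "(\<forall>i\<in>{1..l}.
      (\<forall>a\<in>K_sub \<O> l (M\<lparr>carrier := S\<rparr>) i.
         Q_map \<O> l M S i (L_sub \<O> l (M\<lparr>carrier := S\<rparr>) i +>\<^bsub>M\<^esub> a) = L_sub \<O> l M i +>\<^bsub>M\<^esub> a) \<and>
      Q_map \<O> l M S i \<in> mod_hom \<O> (Q_mod \<O> l (M\<lparr>carrier := S\<rparr>) i) (Q_mod \<O> l M i) \<and>
      inj_on (Q_map \<O> l M S i) (carrier (Q_mod \<O> l (M\<lparr>carrier := S\<rparr>) i)))
    \<and> add_index M S = (\<Prod>i=1..l. h i ^ i)
    \<and> real (card {T. standard_submodule \<O> l M T \<and>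
                     (\<forall>i\<in>{1..l}. Q_bar \<O> l M T i = Q_bar \<O> l M S i)}) =
         (\<Prod>i=1..l. real ((\<Prod>j=i..l. h j) ^ (\<Sum>j=i..l. r j)) / real (h i ^ r i))"
proof -
  have "module \<O> (Q_mod \<O> l (M\<lparr>carrier := S\<rparr>) 1)"
    using assms(2,7) by (auto simp: free_of_rank_def)
  then have cring: "cring (\<O> :: 'k ring)" by (rule module.axioms)
  interpret truncated_module \<O> l M
    using cring assms(3) by (rule truncated_module.intro)
  show ?thesis
    by (rule standard_submodule_index_and_count[OF domain_maximal_order[OF cring] _ assms(4-8)])
      (simp only: add_pow_maximal_order maximal_order_simps(2) of_nat_eq_0_iff neq0_conv)
qed

end
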